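(* Let $\tau\in\mathfrak M_{1,c}(\mathrm{Rat})$ with $J_{\ker}(G_\tau)=\emptyset$, $J(G_\tau)\ne\emptyset$ and $S_\tau\subset F(G_\tau)$. Let $r=\prod_{L\in\mathrm{Min}(G_\tau,\hat{\mathbb C})}\dim_{\mathbb C}\mathrm{LS}(\mathcal U_{f,\tau}(L))$. Then there are constants $\alpha\in(0,1)$, $\lambda\in(0,1)$ and $C>0$ such that for every $\varphi\in C^\alpha(\hat{\mathbb C})$ and every $n\in\mathbb N$: (1) $\|M_\tau^{nr}(\varphi)-\pi_\tau(\varphi)\|_\alpha\le C\lambda^n\|\varphi-\pi_\tau(\varphi)\|_\alpha$; (2) $\|M_\tau^{n}(\varphi-\pi_\tau(\varphi))\|_\alpha\le C\lambda^n\|\varphi-\pi_\tau(\varphi)\|_\alpha$; (3) $\|M_\tau^{n}(\varphi-\pi_\tau(\varphi))\|_\alpha\le C\lambda^n\|\varphi\|_\alpha$; (4) $\|\pi_\tau(\varphi)\|_\alpha\le C\|\varphi\|_\alpha$.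
   Context: $\hat{\mathbb C}$, spherical distance $d$; $\mathrm{Rat}$ with $\kappa(f,g)=\sup_zd(f(z),g(z))$; $\langle\Gamma\rangle$, $F(G)$ (equicontinuity set), $J(G)$, $J_{\ker}(G)=\bigcap_{g\in G}g^{-1}(J(G))$, $\mathrm{Min}(G,\hat{\mathbb C})$ (inclusion-minimal non-empty compact $G$-forward-invariant sets). $\Gamma_\tau=\mathrm{supp}\,\tau$, $G_\tau=\langle\Gamma_\tau\rangle$, $S_\tau=\bigcup_{L\in\mathrm{Min}(G_\tau,\hat{\mathbb C})}L$, $M_\tau\varphi(z)=\int\varphi(g(z))d\tau(g)$ acting on $C(K)$ for compact $K$ with $G_\tau(K)\subset K$; $\mathcal U_{f,\tau}(K)$ = non-zero $\varphi\in C(K)$ with $M_\tau\varphi=a\varphi$, $|a|=1$; LS = linear span. Known: under $J_{\ker}(G_\tau)=\emptyset$, $J(G_\tau)\neq\emptyset$, $C(\hat{\mathbb C})=\mathrm{LS}(\mathcal U_{f,\tau}(\hat{\mathbb C}))\oplus\{\varphi:\|M^n_\tau\varphi\|_\infty\to0\}$, first summand finite-dimensional; $\pi_\tau$ = projection onto it. $C^\alpha(\hat{\mathbb C})$ = $\alpha$-Hölder functions with $\|\varphi\|_\alpha=\sup|\varphi|+\sup_{x\ne y}|\varphi(x)-\varphi(y)|/d(x,y)^\alpha$. *)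

theory Defs
  imports "HOL-Analysis.Analysis" "HOL-Computational_Algebra.Polynomial"
          "HOL-Library.Function_Algebras" "HOL-Probability.Probability_Measure"
begin

text \<open>The Riemann sphere is realised as the unit sphere in
  complex x real = R^3; the distance is the Euclidean (chordal) one,
  which under stereographic projection is the usual chordal metric
  2|z-w| / sqrt((1+|z|^2)(1+|w|^2)).\<close>

typedef rsphere = "{p :: complex \<times> real. (cmod (fst p))\<^sup>2 + (snd p)\<^sup>2 = 1}"
  by (rule exI[of _ "(0, 1)"]) simp

instantiation rsphere :: metric_space
begin
definition dist_rsphere :: "rsphere \<Rightarrow> rsphere \<Rightarrow> real"
  where "dist_rsphere x y = dist (Rep_rsphere x) (Rep_rsphere y)"
definition uniformity_rsphere :: "(rsphere \<times> rsphere) filter"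
  where "uniformity_rsphere = (INF e\<in>{0<..}. principal {(x, y). dist x y < e})"
definition open_rsphere :: "rsphere set \<Rightarrow> bool"
  where "open_rsphere U = (\<forall>x\<in>U. \<forall>\<^sub>F (x', y) in uniformity. x' = x \<longrightarrow> y \<in> U)"
instance
proof
  fix x y z :: rsphere
  show "(dist x y = 0) = (x = y)"
    by (simp add: dist_rsphere_def Rep_rsphere_inject)
  show "dist x y \<le> dist x z + dist y z"
    by (simp add: dist_rsphere_def dist_triangle2)
qed (simp_all add: uniformity_rsphere_def open_rsphere_def)
end

text \<open>Stereographic embedding of C and the point at infinity.\<close>
definition infty :: rsphere where
  "infty = Abs_rsphere (0, 1)"

definition pt :: "complex \<Rightarrow> rsphere" where
  "pt z = Abs_rsphere (2 * z / of_real (1 + (cmod z)\<^sup>2),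
                       ((cmod z)\<^sup>2 - 1) / ((cmod z)\<^sup>2 + 1))"

definition is_rat_map :: "(rsphere \<Rightarrow> rsphere) \<Rightarrow> bool" where
  "is_rat_map f \<longleftrightarrow> (\<exists>p q :: complex poly.
      coprime p q \<and> max (degree p) (degree q) \<ge> 1 \<and>
      (\<forall>z. poly q z \<noteq> 0 \<longrightarrow> f (pt z) = pt (poly p z / poly q z)) \<and>
      (\<forall>z. poly q z = 0 \<longrightarrow> f (pt z) = infty) \<and>
      f infty = (if degree p > degree q then infty
                 else pt (coeff p (degree q) / lead_coeff q)))"

definition Rat :: "(rsphere \<Rightarrow> rsphere) set" where
  "Rat = {f. is_rat_map f}"

definition kappa :: "(rsphere \<Rightarrow> rsphere) \<Rightarrow> (rsphere \<Rightarrow> rsphere) \<Rightarrow> real" where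
  "kappa f g = (SUP z. dist (f z) (g z))"

definition rat_top :: "(rsphere \<Rightarrow> rsphere) topology" where
  "rat_top = Metric_space.mtopology Rat kappa"

definition rat_borel :: "(rsphere \<Rightarrow> rsphere) measure" where
  "rat_borel = sigma Rat {U. openin rat_top U}"

definition supp :: "(rsphere \<Rightarrow> rsphere) measure \<Rightarrow> (rsphere \<Rightarrow> rsphere) set" where
  "supp \<tau> = {f \<in> Rat. \<forall>e>0. emeasure \<tau> {g \<in> Rat. kappa f g < e} > 0}"

definition M1c :: "(rsphere \<Rightarrow> rsphere) measure set" where
  "M1c = {\<tau>. prob_space \<tau> \<and> space \<tau> = Rat \<and> sets \<tau> = sets rat_borel \<and>
              compactin rat_top (supp \<tau>)}"

inductive_set gen_semigroup :: "(rsphere \<Rightarrow> rsphere) set \<Rightarrow> (rsphere \<Rightarrow> rsphere) set"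
  for \<Gamma> where
  base: "g \<in> \<Gamma> \<Longrightarrow> g \<in> gen_semigroup \<Gamma>"
| comp: "g \<in> gen_semigroup \<Gamma> \<Longrightarrow> h \<in> \<Gamma> \<Longrightarrow> h \<circ> g \<in> gen_semigroup \<Gamma>"

definition fatou :: "(rsphere \<Rightarrow> rsphere) set \<Rightarrow> rsphere set" where
  "fatou G = {z. \<exists>U. open U \<and> z \<in> U \<and>
      (\<forall>x\<in>U. \<forall>e>0. \<exists>\<delta>>0. \<forall>g\<in>G. \<forall>y\<in>U. dist x y < \<delta> \<longrightarrow> dist (g x) (g y) < e)}"

definition julia :: "(rsphere \<Rightarrow> rsphere) set \<Rightarrow> rsphere set" where
  "julia G = - fatou G"

definition kernel_julia :: "(rsphere \<Rightarrow> rsphere) set \<Rightarrow> rsphere set" where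
  "kernel_julia G = (\<Inter>g\<in>G. g -` julia G)"

definition fwd_inv :: "(rsphere \<Rightarrow> rsphere) set \<Rightarrow> rsphere set \<Rightarrow> bool" where
  "fwd_inv G K \<longleftrightarrow> K \<noteq> {} \<and> compact K \<and> (\<forall>g\<in>G. g ` K \<subseteq> K)"

definition Min_sets :: "(rsphere \<Rightarrow> rsphere) set \<Rightarrow> rsphere set set" where
  "Min_sets G = {K. fwd_inv G K \<and> (\<forall>K'. fwd_inv G K' \<longrightarrow> K' \<subseteq> K \<longrightarrow> K' = K)}"

definition Gtau :: "(rsphere \<Rightarrow> rsphere) measure \<Rightarrow> (rsphere \<Rightarrow> rsphere) set" where
  "Gtau \<tau> = gen_semigroup (supp \<tau>)"

definition Stau :: "(rsphere \<Rightarrow> rsphere) measure \<Rightarrow> rsphere set" where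
  "Stau \<tau> = \<Union> (Min_sets (Gtau \<tau>))"

definition Mop :: "(rsphere \<Rightarrow> rsphere) measure \<Rightarrow> (rsphere \<Rightarrow> complex) \<Rightarrow> (rsphere \<Rightarrow> complex)" where
  "Mop \<tau> \<phi> = (\<lambda>z. integral\<^sup>L \<tau> (\<lambda>g. \<phi> (g z)))"

text \<open>Elements of C(K) are represented by functions vanishing outside K.\<close>
definition Ufun :: "(rsphere \<Rightarrow> rsphere) measure \<Rightarrow> rsphere set \<Rightarrow> (rsphere \<Rightarrow> complex) set" where
  "Ufun \<tau> K = {\<phi>. continuous_on K \<phi> \<and> (\<forall>z. z \<notin> K \<longrightarrow> \<phi> z = 0) \<and> (\<exists>z\<in>K. \<phi> z \<noteq> 0) \<and>
      (\<exists>a. cmod a = 1 \<and> (\<forall>z\<in>K. Mop \<tau> \<phi> z = a * \<phi> z))}"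

definition fscale :: "complex \<Rightarrow> (rsphere \<Rightarrow> complex) \<Rightarrow> (rsphere \<Rightarrow> complex)" where
  "fscale c \<phi> = (\<lambda>z. c * \<phi> z)"

definition LS :: "(rsphere \<Rightarrow> complex) set \<Rightarrow> (rsphere \<Rightarrow> complex) set" where
  "LS A = module.span fscale A"

definition cdim :: "(rsphere \<Rightarrow> complex) set \<Rightarrow> nat" where
  "cdim A = vector_space.dim fscale A"

definition sup_norm :: "(rsphere \<Rightarrow> complex) \<Rightarrow> real" where
  "sup_norm \<phi> = (SUP z. cmod (\<phi> z))"

definition decaying :: "(rsphere \<Rightarrow> rsphere) measure \<Rightarrow> (rsphere \<Rightarrow> complex) set" where
  "decaying \<tau> = {\<phi>. continuous_on UNIV \<phi> \<and> (\<lambda>n. sup_norm ((Mop \<tau> ^^ n) \<phi>)) \<longlonglongrightarrow> 0}"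

definition proj :: "(rsphere \<Rightarrow> rsphere) measure \<Rightarrow> (rsphere \<Rightarrow> complex) \<Rightarrow> (rsphere \<Rightarrow> complex)" where
  "proj \<tau> \<phi> = (THE \<psi>. \<psi> \<in> LS (Ufun \<tau> UNIV) \<and> (\<lambda>z. \<phi> z - \<psi> z) \<in> decaying \<tau>)"

definition holder :: "real \<Rightarrow> (rsphere \<Rightarrow> complex) set" where
  "holder \<alpha> = {\<phi>. \<exists>K. \<forall>x y. cmod (\<phi> x - \<phi> y) \<le> K * dist x y powr \<alpha>}"

text \<open>Hoelder norm, valued in [0,infinity] so that an infinite norm is not silently
  replaced by a junk real value.\<close>
definition holder_norm :: "real \<Rightarrow> (rsphere \<Rightarrow> complex) \<Rightarrow> ennreal" where
  "holder_norm \<alpha> \<phi> = (SUP z. ennreal (cmod (\<phi> z))) +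
     (SUP xy\<in>{(x, y). x \<noteq> y}. ennreal (cmod (\<phi> (fst xy) - \<phi> (snd xy)) / dist (fst xy) (snd xy) powr \<alpha>))"

end

theory Submission
  imports Defs "HOL-Complex_Analysis.Complex_Analysis"
begin

text \<open>
  Call a point recurrent if near it every element of the semigroup can be undone, up to small errors,
  by another one. The identity theorem and Brouwer's theorem show that the set of recurrent points is
  open and closed and that it lies in the Fatou set; here the empty kernel Julia set is used. As the
  Julia set is non-empty and the sphere is connected, no point is recurrent. Hence an element of a
  minimal left ideal of the enveloping semigroup is locally constant near the attractor
  \<open>S\<^sub>\<tau>\<close>, so some words contract a neighbourhood of \<open>S\<^sub>\<tau>\<close> as
  strongly as desired. Every point is led to this neighbourhood with positive probability, which for a
  small Hoelder exponent gives a Doeblin--Fortet inequality: a high iterate of \<open>M\<^sub>\<tau>\<close>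
  maps \<open>\<phi>\<close> to a function whose Hoelder constant is at most a small multiple of that of
  \<open>\<phi>\<close> plus a fixed multiple of its supremum norm.

  On a minimal set \<open>L\<close>, call two points equivalent if words of equal length bring them
  arbitrarily close together. There are finitely many classes, all generators permute them in the same
  cyclic way, and the unimodular eigenfunctions on \<open>L\<close> are functions of the class; so their
  span has dimension equal to the number of classes. By a maximum principle the limit functions of
  \<open>M\<^sub>\<tau>\<^sup>n \<phi>\<close> are constant on classes and therefore
  \<open>r\<close>-periodic, first on each \<open>L\<close> and then on the sphere; this yields the
  projection. On the decaying functions the convergence to 0 is uniform on the Hoelder unit ball by
  Arzela--Ascoli, and the Doeblin--Fortet inequality turns this into exponential decay.
\<close>

section \<open>The Riemann sphere\<close>

text \<open>The hypotheses are topological, while the conclusion needs numerical contraction. The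
  bridge is the compactness of the space of all self-maps of the sphere under pointwise convergence.
  If \<open>e\<close> lies in a minimal left ideal, then for every \<open>g\<close> the point
  \<open>e x\<close> is a limit of points \<open>h (g (e x))\<close>. Equicontinuity makes this
  return uniform on any open set of values of \<open>e\<close> inside the Fatou set, so such values
  would lie in \<open>Rec\<close>; the open mapping theorem then leaves only locally constant
  \<open>e\<close>. The limit \<open>e\<close> is not itself a random word, and a single word may
  have probability 0. Therefore contraction is stated for a whole neighbourhood of a word, and the
  chance of drawing a word from it is estimated letter by letter. Away from the attractor, words of
  the relevant length may expand by a factor \<open>K\<close>. The Hoelder exponent reduces this
  loss to \<open>K powr \<alpha>\<close>, which for small \<alpha> is outweighed by the probability
  of reaching the attractor. The number \<open>r\<close> enters as a common multiple of the periods
  of the minimal sets.\<close>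

lemma Rep_rsphere_eq: "(cmod (fst (Rep_rsphere p)))\<^sup>2 + (snd (Rep_rsphere p))\<^sup>2 = 1"
  using Rep_rsphere[of p] by simp

lemma Rep_infty: "Rep_rsphere infty = (0, 1)"
  unfolding infty_def by (rule Abs_rsphere_inverse) simp

lemma one_plus_norm_sq_neq_0: "1 + complex_of_real ((cmod z)\<^sup>2) \<noteq> 0"
proof -
  have "complex_of_real (1 + (cmod z)\<^sup>2) \<noteq> 0"
    unfolding of_real_eq_0_iff by (smt (verit) zero_le_power2)
  thus ?thesis by simp
qed

lemma Rep_pt:
  "Rep_rsphere (pt z) = (2 * z / of_real (1 + (cmod z)\<^sup>2), ((cmod z)\<^sup>2 - 1) / ((cmod z)\<^sup>2 + 1))"
proof -
  define r where "r = (cmod z)\<^sup>2"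
  have r: "r \<ge> 0" by (simp add: r_def)
  have "(cmod (2 * z / of_real (1 + r)))\<^sup>2 = 4 * r / (1 + r)\<^sup>2"
    using r by (simp add: norm_divide norm_mult power_divide power_mult_distrib r_def del: of_real_add)
  moreover have "4 * r / (1 + r)\<^sup>2 + ((r - 1) / (r + 1))\<^sup>2 = 1"
    using r by (simp add: power_divide add_divide_distrib[symmetric] add.commute)
      (simp add: power2_eq_square algebra_simps)
  ultimately show ?thesis
    unfolding pt_def r_def[symmetric] by (intro Abs_rsphere_inverse) simp
qed

section \<open>The chordal distance in the affine coordinate\<close>

lemma dist_pt_sq:
  "(dist (pt z) (pt w))\<^sup>2 * ((1 + (cmod z)\<^sup>2) * (1 + (cmod w)\<^sup>2)) = 4 * (cmod (z - w))\<^sup>2"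
proof -
  obtain x y u v where z: "z = Complex x y" and w: "w = Complex u v"
    by (metis complex.exhaust)
  define A where "A = 1 + x\<^sup>2 + y\<^sup>2"
  define B where "B = 1 + u\<^sup>2 + v\<^sup>2"
  have A: "A > 0" and B: "B > 0"
    unfolding A_def B_def by (smt (verit) zero_le_power2)+
  have cz: "(cmod z)\<^sup>2 = A - 1" and cw: "(cmod w)\<^sup>2 = B - 1"
    by (simp_all add: z w cmod_power2 A_def B_def)
  have "(dist (pt z) (pt w))\<^sup>2 = (cmod (2*z/of_real A - 2*w/of_real B))\<^sup>2 + ((A-2)/A - (B-2)/B)\<^sup>2"
    unfolding dist_rsphere_def Rep_pt dist_prod_def cz cw
    by (simp add: dist_norm dist_real_def)
  also have "(cmod (2*z/of_real A - 2*w/of_real B))\<^sup>2 = (2*x/A - 2*u/B)\<^sup>2 + (2*y/A - 2 * v/B)\<^sup>2"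
    by (simp add: cmod_power2 z w Re_divide_of_real Im_divide_of_real)
  finally have d: "(dist (pt z) (pt w))\<^sup>2 =
      (2*x/A - 2*u/B)\<^sup>2 + (2*y/A - 2 * v/B)\<^sup>2 + ((A-2)/A - (B-2)/B)\<^sup>2" .
  have "(dist (pt z) (pt w))\<^sup>2 * (A*B)\<^sup>2 =
      (2*x*B - 2*u*A)\<^sup>2 + (2*y*B - 2 * v * A)\<^sup>2 + ((A-2)*B - (B-2)*A)\<^sup>2"
  proof -
    have "(2*x/A - 2*u/B) * (A*B) = 2*x*B - 2*u*A" "(2*y/A - 2 * v/B) * (A*B) = 2*y*B - 2 * v * A"
      "((A-2)/A - (B-2)/B) * (A*B) = (A-2)*B - (B-2)*A"
      using A B by (simp_all add: field_simps)
    thus ?thesis unfolding d distrib_right power_mult_distrib[symmetric] by simp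
  qed
  also have "\<dots> = A * B * (4 * ((x-u)\<^sup>2 + (y-v)\<^sup>2))"
    unfolding A_def B_def by (simp add: power2_eq_square algebra_simps)
  finally have "(dist (pt z) (pt w))\<^sup>2 * (A*B) = 4 * ((x-u)\<^sup>2 + (y-v)\<^sup>2)"
    using A B by (simp add: power2_eq_square)
  thus ?thesis by (simp add: cz cw) (simp add: z w cmod_power2)
qed

lemma dist_pt_le: "dist (pt z) (pt w) \<le> 2 * cmod (z - w)"
proof -
  have "1 \<le> (1 + (cmod z)\<^sup>2) * (1 + (cmod w)\<^sup>2)"
    using mult_mono[of 1 "1 + (cmod z)\<^sup>2" 1 "1 + (cmod w)\<^sup>2"] by simp
  hence "(dist (pt z) (pt w))\<^sup>2 * 1 \<le> 4 * (cmod (z - w))\<^sup>2"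
    unfolding dist_pt_sq[symmetric] by (intro mult_left_mono) auto
  hence "(dist (pt z) (pt w))\<^sup>2 \<le> (2 * cmod (z - w))\<^sup>2"
    by (simp add: power_mult_distrib)
  thus ?thesis by (rule power2_le_imp_le) simp
qed

text \<open>The product of the two denominators of the chordal metric is at most 10 here, and
  sqrt(10/4) < 2; on the disc of radius 2 it is at most 25, and sqrt(25/4) < 3.\<close>

lemma dist_pt_ge:
  assumes "cmod z \<le> 1" "cmod w \<le> 2"
  shows "cmod (z - w) \<le> 2 * dist (pt z) (pt w)"
proof -
  have "(1 + (cmod z)\<^sup>2) * (1 + (cmod w)\<^sup>2) \<le> (1 + 1\<^sup>2) * (1 + 2\<^sup>2)"
    using assms by (intro mult_mono add_mono power_mono) auto
  hence "4 * (cmod (z - w))\<^sup>2 \<le> (dist (pt z) (pt w))\<^sup>2 * 10"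
    unfolding dist_pt_sq[symmetric] by (intro mult_left_mono) auto
  also have "\<dots> \<le> (dist (pt z) (pt w))\<^sup>2 * 16" by simp
  finally have "(cmod (z - w))\<^sup>2 \<le> (2 * dist (pt z) (pt w))\<^sup>2"
    by (simp add: power_mult_distrib)
  thus ?thesis by (rule power2_le_imp_le) simp
qed

lemma dist_pt_ge2:
  assumes "cmod z \<le> 2" "cmod w \<le> 2"
  shows "cmod (z - w) \<le> 3 * dist (pt z) (pt w)"
proof -
  have "(1 + (cmod z)\<^sup>2) * (1 + (cmod w)\<^sup>2) \<le> (1 + 2\<^sup>2) * (1 + 2\<^sup>2)"
    using assms by (intro mult_mono add_mono power_mono) auto
  hence "4 * (cmod (z - w))\<^sup>2 \<le> (dist (pt z) (pt w))\<^sup>2 * 25"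
    unfolding dist_pt_sq[symmetric] by (intro mult_left_mono) auto
  also have "\<dots> \<le> (dist (pt z) (pt w))\<^sup>2 * 36" by simp
  finally have "(cmod (z - w))\<^sup>2 \<le> (3 * dist (pt z) (pt w))\<^sup>2"
    by (simp add: power_mult_distrib)
  thus ?thesis by (rule power2_le_imp_le) simp
qed

section \<open>Stereographic projection and the two charts\<close>

text \<open>At \<open>infty\<close> the value is 0 by division by zero; hence the guards
  \<open>\<noteq> infty\<close> wherever a value is read in a chart.\<close>

definition stereo :: "rsphere \<Rightarrow> complex" where
  "stereo p = fst (Rep_rsphere p) / of_real (1 - snd (Rep_rsphere p))"

lemma snd_Rep_eq_1_iff: "snd (Rep_rsphere p) = 1 \<longleftrightarrow> p = infty"
proof
  assume s: "snd (Rep_rsphere p) = 1"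
  with Rep_rsphere_eq[of p] have "fst (Rep_rsphere p) = 0" by simp
  with s have "Rep_rsphere p = Rep_rsphere infty" by (simp add: Rep_infty prod_eq_iff)
  thus "p = infty" by (simp add: Rep_rsphere_inject)
qed (simp add: Rep_infty)

lemma stereo_pt [simp]: "stereo (pt z) = z"
proof -
  define r where "r = (cmod z)\<^sup>2"
  have r: "r \<ge> 0" by (simp add: r_def)
  have "1 - (r - 1) / (r + 1) = 2 / (1 + r)" using r by (simp add: field_simps)
  hence "stereo (pt z) = (2 * z / of_real (1 + r)) / of_real (2 / (1 + r))"
    unfolding stereo_def Rep_pt r_def[symmetric] by simp
  also have "\<dots> = z" using one_plus_norm_sq_neq_0[of z] by (simp add: r_def)
  finally show ?thesis .
qed

lemma pt_neq_infty [simp]: "pt z \<noteq> infty"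
proof
  assume "pt z = infty"
  hence "((cmod z)\<^sup>2 - 1) / ((cmod z)\<^sup>2 + 1) = 1" using Rep_pt[of z] by (simp add: Rep_infty)
  moreover have "(cmod z)\<^sup>2 + 1 > 0" by (smt (verit) zero_le_power2)
  ultimately show False by (simp add: field_simps)
qed

lemma pt_stereo: "p \<noteq> infty \<Longrightarrow> pt (stereo p) = p"
proof -
  assume p: "p \<noteq> infty"
  define w t where "w = fst (Rep_rsphere p)" and "t = snd (Rep_rsphere p)"
  have t1: "t \<noteq> 1" using p by (simp add: snd_Rep_eq_1_iff t_def)
  have e: "(cmod w)\<^sup>2 = 1 - t\<^sup>2" using Rep_rsphere_eq[of p] by (simp add: w_def t_def)
  have t: "t < 1" 
  proof -
    have "t\<^sup>2 \<le> 1" using e zero_le_power2[of "cmod w"] by linarith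
    hence "\<bar>t\<bar> \<le> 1" by (simp add: abs_square_le_1)
    thus ?thesis using t1 by linarith
  qed
  have n: "(cmod (stereo p))\<^sup>2 = (1 + t) / (1 - t)"
  proof -
    have "(cmod (stereo p))\<^sup>2 = (1 - t\<^sup>2) / (1 - t)\<^sup>2"
      unfolding stereo_def w_def[symmetric] t_def[symmetric]
      using e by (simp add: norm_divide power_divide del: of_real_diff)
    also have "\<dots> = (1 + t) / (1 - t)"
    proof -
      have "1 - t\<^sup>2 = (1 - t) * (1 + t)" by (simp add: power2_eq_square algebra_simps)
      thus ?thesis using t by (simp add: power2_eq_square)
    qed
    finally show ?thesis .
  qed
  have s1: "1 + (cmod (stereo p))\<^sup>2 = 2 / (1 - t)"
    unfolding n using t by (simp add: field_simps)
  have "2 * stereo p / of_real (1 + (cmod (stereo p))\<^sup>2) = w"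
    unfolding s1 unfolding stereo_def w_def[symmetric] t_def[symmetric] using t1 by simp
  moreover have "((cmod (stereo p))\<^sup>2 - 1) / ((cmod (stereo p))\<^sup>2 + 1) = t"
    using s1 unfolding n using t by (simp add: field_simps)
  ultimately have "Rep_rsphere (pt (stereo p)) = Rep_rsphere p"
    unfolding Rep_pt w_def t_def by simp
  thus ?thesis by (simp add: Rep_rsphere_inject)
qed

text \<open>The rotation of the sphere that corresponds to \<open>z \<mapsto> 1/z\<close>.\<close>

definition flip :: "rsphere \<Rightarrow> rsphere" where
  "flip p = Abs_rsphere (cnj (fst (Rep_rsphere p)), - snd (Rep_rsphere p))"

lemma Rep_flip: "Rep_rsphere (flip p) = (cnj (fst (Rep_rsphere p)), - snd (Rep_rsphere p))"
  unfolding flip_def by (rule Abs_rsphere_inverse) (use Rep_rsphere_eq[of p] in simp)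

lemma flip_flip [simp]: "flip (flip p) = p"
  by (simp add: Rep_flip Rep_rsphere_inject[symmetric])

lemma dist_flip [simp]: "dist (flip p) (flip q) = dist p q"
proof -
  have "cmod (cnj a - cnj b) = cmod (a - b)" for a b
    by (metis complex_cnj_diff complex_mod_cnj)
  thus ?thesis
    by (simp add: dist_rsphere_def Rep_flip dist_prod_def dist_norm dist_real_def power2_commute)
qed

definition charts :: "(rsphere \<Rightarrow> rsphere) set" where
  "charts = {id, flip}"

lemma chart_invol [simp]: "a \<in> charts \<Longrightarrow> a (a x) = x"
  by (auto simp: charts_def)

lemma chart_dist [simp]: "a \<in> charts \<Longrightarrow> dist (a x) (a y) = dist x y"
  by (auto simp: charts_def)

lemma continuous_on_chart: "a \<in> charts \<Longrightarrow> continuous_on A a"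
  unfolding continuous_on_iff by (metis chart_dist)

lemma continuous_on_pt: "continuous_on A pt"
  unfolding continuous_on_iff
proof (intro ballI allI impI)
  fix x :: complex and e :: real assume "e > 0"
  thus "\<exists>d>0. \<forall>x'\<in>A. dist x' x < d \<longrightarrow> dist (pt x') (pt x) < e"
    using dist_pt_le[of _ x] by (intro exI[of _ "e/2"]) (auto simp: dist_norm intro!: le_less_trans[OF dist_pt_le])
qed

lemma continuous_on_Rep: "continuous_on A Rep_rsphere"
  unfolding continuous_on_iff dist_rsphere_def by blast

lemma continuous_on_stereo: "continuous_on (- {infty}) stereo"
  unfolding stereo_def
  by (intro continuous_intros continuous_on_Rep) (auto simp: snd_Rep_eq_1_iff)

lemma open_not_infty: "open (- {infty})"
  by (simp add: open_Compl)

lemma open_pt_image: "open U \<Longrightarrow> open (pt ` U)"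
proof -
  assume U: "open U"
  have "pt ` U = stereo -` U \<inter> - {infty}"
    by (auto simp: pt_stereo image_iff) (metis pt_stereo)
  moreover have "open (stereo -` U \<inter> - {infty})"
    using continuous_on_open_vimage[OF open_not_infty, of stereo] continuous_on_stereo U by blast
  ultimately show ?thesis by simp
qed

lemma chart_image: "a \<in> charts \<Longrightarrow> a ` A = a -` A"
  by (force simp: image_iff)

lemma open_chart_image: "a \<in> charts \<Longrightarrow> open U \<Longrightarrow> open (a ` U)"
  using continuous_on_chart[of a UNIV] by (simp add: chart_image continuous_on_open_vimage)

text \<open>A point closer than 1/4 to the lower hemisphere has last coordinate below 1/4, hence an
  affine coordinate \<open>w\<close> with |w|^2 < 5/3. This margin is the source of the bounds on
  radii and oscillations that recur below.\<close>

lemma near_lower: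
  assumes "cmod z0 \<le> 1" "dist (pt z0) x < 1/4"
  shows "x \<noteq> infty" "cmod (stereo x) \<le> 2" "cmod (stereo x - z0) \<le> 2 * dist (pt z0) x"
proof -
  have s0: "snd (Rep_rsphere (pt z0)) \<le> 0"
  proof -
    have "(cmod z0)\<^sup>2 \<le> 1" using assms(1) by (simp add: power_le_one)
    thus ?thesis unfolding Rep_pt by (simp add: divide_nonpos_pos add_nonneg_pos)
  qed
  have "\<bar>snd (Rep_rsphere (pt z0)) - snd (Rep_rsphere x)\<bar> \<le> dist (pt z0) x"
    unfolding dist_rsphere_def by (metis dist_snd_le dist_real_def)
  hence sx: "snd (Rep_rsphere x) < 1/4" using s0 assms(2) by linarith
  show x: "x \<noteq> infty" using sx by (auto simp: Rep_infty)
  define w where "w = stereo x"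
  have xw: "x = pt w" using pt_stereo[OF x] by (simp add: w_def)
  have pos: "(cmod w)\<^sup>2 + 1 > 0" by (smt (verit) zero_le_power2)
  have "((cmod w)\<^sup>2 - 1) / ((cmod w)\<^sup>2 + 1) < 1/4" using sx by (simp add: xw Rep_pt)
  hence "(cmod w)\<^sup>2 \<le> 2\<^sup>2" using pos by (simp add: field_simps)
  thus w2: "cmod (stereo x) \<le> 2" unfolding w_def[symmetric] by (rule power2_le_imp_le) simp
  show "cmod (stereo x - z0) \<le> 2 * dist (pt z0) x"
    using dist_pt_ge[OF assms(1), of w] w2 unfolding xw w_def[symmetric]
    by (simp add: w_def norm_minus_commute)
qed

lemma chart_exists: obtains a z0 where "a \<in> charts" "a x = pt z0" "cmod z0 \<le> 1"
proof -
  have *: "\<exists>z. p = pt z \<and> cmod z \<le> 1" if "snd (Rep_rsphere p) \<le> 0" for p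
  proof -
    have p: "p \<noteq> infty" using that by (auto simp: Rep_infty)
    define w where "w = stereo p"
    have pw: "p = pt w" using pt_stereo[OF p] by (simp add: w_def)
    have pos: "(cmod w)\<^sup>2 + 1 > 0" by (smt (verit) zero_le_power2)
    have "((cmod w)\<^sup>2 - 1) / ((cmod w)\<^sup>2 + 1) \<le> 0" using that by (simp add: pw Rep_pt)
    hence "(cmod w)\<^sup>2 \<le> 1\<^sup>2" using pos by (simp add: field_simps)
    hence "cmod w \<le> 1" by (rule power2_le_imp_le) simp
    thus ?thesis using pw by blast
  qed
  show ?thesis
  proof (cases "snd (Rep_rsphere x) \<le> 0")
    case True
    thus ?thesis using *[of x] that[of id] by (auto simp: charts_def)
  next
    case False
    hence "snd (Rep_rsphere (flip x)) \<le> 0" by (simp add: Rep_flip)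
    thus ?thesis using *[of "flip x"] that[of flip] by (auto simp: charts_def)
  qed
qed

lemma chart_disc:
  assumes "a \<in> charts" "a x = pt z0" "cmod z0 \<le> 1"
  shows "cmod (z - z0) < r \<Longrightarrow> a (pt z) \<in> ball x (2 * r)"
    and "y \<in> ball x r \<Longrightarrow> r \<le> 1/4 \<Longrightarrow>
      a y = pt (stereo (a y)) \<and> cmod (stereo (a y) - z0) < 2 * r \<and> cmod (stereo (a y)) \<le> 2"
proof -
  have x: "x = a (pt z0)" using assms by (metis chart_invol)
  { assume "cmod (z - z0) < r"
    thus "a (pt z) \<in> ball x (2 * r)"
      using dist_pt_le[of z0 z] assms by (simp add: x norm_minus_commute) }
  { assume y: "y \<in> ball x r" "r \<le> 1/4"
    hence "dist (pt z0) (a y) < r" using assms by (metis chart_dist mem_ball)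
    with near_lower[OF assms(3), of "a y"] y(2) show
      "a y = pt (stereo (a y)) \<and> cmod (stereo (a y) - z0) < 2 * r \<and> cmod (stereo (a y)) \<le> 2"
      by (auto simp: pt_stereo) }
qed

section \<open>Compactness and connectedness of the sphere\<close>

lemma range_Rep: "range Rep_rsphere = sphere 0 1"
proof -
  have "x \<in> range Rep_rsphere \<longleftrightarrow> norm x = 1" for x :: "complex \<times> real"
  proof -
    have "norm x = 1 \<longleftrightarrow> (cmod (fst x))\<^sup>2 + (snd x)\<^sup>2 = 1"
      by (simp add: norm_prod_def)
    thus ?thesis using type_definition.Rep_range[OF type_definition_rsphere] by auto
  qed
  thus ?thesis unfolding set_eq_iff by (simp add: dist_norm)
qed

lemma continuous_on_Abs: "continuous_on (sphere 0 1) Abs_rsphere"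
  unfolding continuous_on_iff range_Rep[symmetric]
  by (auto simp: dist_rsphere_def Rep_rsphere_inverse)

lemma UNIV_rsphere: "(UNIV :: rsphere set) = Abs_rsphere ` sphere 0 1"
  unfolding range_Rep[symmetric] by (auto simp: Rep_rsphere_inverse image_iff)

lemma compact_UNIV_rsphere: "compact (UNIV :: rsphere set)"
  unfolding UNIV_rsphere by (intro compact_continuous_image continuous_on_Abs compact_sphere)

lemma compact_rsphere: "closed (A :: rsphere set) \<Longrightarrow> compact A"
  using compact_Int_closed[OF compact_UNIV_rsphere, of A] by simp

lemma connected_UNIV_rsphere: "connected (UNIV :: rsphere set)"
  unfolding UNIV_rsphere
  by (intro connected_continuous_image continuous_on_Abs connected_sphere) simp

lemma dist_rsphere_le_2: "dist (x :: rsphere) y \<le> 2"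
proof -
  have n: "norm (Rep_rsphere p) = 1" for p
    using range_Rep by (metis rangeI mem_sphere_0)
  show ?thesis unfolding dist_rsphere_def dist_norm
    using norm_triangle_ineq4[of "Rep_rsphere x" "Rep_rsphere y"] by (simp add: n)
qed

lemma finite_net:
  assumes "compact (K :: 'a :: metric_space set)" "e > 0"
  obtains S where "finite S" "S \<subseteq> K" "\<And>x. x \<in> K \<Longrightarrow> \<exists>s\<in>S. dist s x < e"
proof -
  have "K \<subseteq> (\<Union>s\<in>K. ball s e)" using assms(2) by auto
  then obtain S where "S \<subseteq> K" "finite S" "K \<subseteq> (\<Union>s\<in>S. ball s e)"
    using compactE_image[OF assms(1), of K "\<lambda>s. ball s e"] by auto
  thus ?thesis using that[of S] by (auto simp: subset_iff)
qed

lemma rsphere_unif_cont: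
  fixes f :: "rsphere \<Rightarrow> 'b :: metric_space"
  assumes "continuous_on UNIV f" "e > 0"
  obtains d where "d > 0" "\<And>x y. dist x y < d \<Longrightarrow> dist (f x) (f y) < e"
  using compact_uniformly_continuous[OF assms(1) compact_UNIV_rsphere] assms(2)
  unfolding uniformly_continuous_on_def by (metis UNIV_I)

section \<open>Holomorphic self-maps of the sphere\<close>

text \<open>Requiring all four pairs of charts lets compositions pass through any intermediate
  chart. Poles are covered by the pairs with \<open>a = flip\<close>, the point \<open>infty\<close>
  by those with \<open>b = flip\<close>.\<close>

definition hol :: "(rsphere \<Rightarrow> rsphere) \<Rightarrow> bool" where
  "hol f \<longleftrightarrow> continuous_on UNIV f \<and>
     (\<forall>a\<in>charts. \<forall>b\<in>charts. \<forall>z. a (f (b (pt z))) \<noteq> infty \<longrightarrow>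
        (\<lambda>z. stereo (a (f (b (pt z))))) field_differentiable (at z))"

lemma hol_cont: "hol f \<Longrightarrow> continuous_on UNIV f"
  by (simp add: hol_def)

lemma continuous_on_chart_comp:
  assumes "hol f" "a \<in> charts" "b \<in> charts"
  shows "continuous_on A (\<lambda>z. a (f (b (pt z))))"
proof -
  have "continuous_on A (a \<circ> (f \<circ> (b \<circ> pt)))"
    by (intro continuous_on_compose continuous_on_pt continuous_on_chart assms
        continuous_on_subset[OF hol_cont[OF assms(1)]]) auto
  thus ?thesis by (simp add: o_def)
qed

lemma hol_comp:
  assumes "hol f" "hol g"
  shows "hol (g \<circ> f)"
proof -
  have "(\<lambda>z. stereo (a ((g \<circ> f) (b (pt z))))) field_differentiable (at z)"
    if ab: "a \<in> charts" "b \<in> charts" and nz: "a ((g \<circ> f) (b (pt z))) \<noteq> infty" for a b z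
  proof -
    obtain a' z0 where a': "a' \<in> charts" "a' (f (b (pt z))) = pt z0"
      by (rule chart_exists)
    define H where "H = (\<lambda>z. stereo (a' (f (b (pt z)))))"
    define K where "K = (\<lambda>w. stereo (a (g (a' (pt w)))))"
    have f0: "f (b (pt z)) = a' (pt z0)" using a' by (metis chart_invol)
    have H: "H field_differentiable (at z)"
      using assms(1) ab a' unfolding hol_def H_def by simp
    have Hz: "H z = z0" by (simp add: H_def a')
    have K: "K field_differentiable (at (H z))"
      using assms(2) ab a' nz unfolding hol_def K_def Hz by (simp add: f0)
    define V where "V = {z. a' (f (b (pt z))) \<noteq> infty}"
    have "open V"
    proof -
      have "V = (\<lambda>z. a' (f (b (pt z)))) -` (- {infty})" by (auto simp: V_def)
      thus ?thesis
        using continuous_on_chart_comp[OF assms(1) a'(1) ab(2), of UNIV] open_not_infty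
        by (simp add: continuous_on_open_vimage)
    qed
    have zV: "z \<in> V" by (simp add: V_def a')
    then obtain d where d: "d > 0" "ball z d \<subseteq> V" using \<open>open V\<close> open_contains_ball by blast
    have KH: "K (H z') = stereo (a ((g \<circ> f) (b (pt z'))))" if "z' \<in> V" for z'
      using that a' by (simp add: K_def H_def V_def pt_stereo)
    have "(K \<circ> H) field_differentiable (at z)"
      by (rule field_differentiable_compose[OF H K])
    then show ?thesis
      by (rule field_differentiable_transform_within[OF d(1), rotated 2])
        (use d KH in \<open>auto simp: dist_commute subset_iff\<close>)
  qed
  moreover have "continuous_on UNIV (g \<circ> f)"
    using assms by (meson continuous_on_compose continuous_on_subset hol_cont subset_UNIV)
  ultimately show ?thesis unfolding hol_def by blast
qed

lemma hol_chart_holomorphic: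
  assumes "hol f" "a \<in> charts" "b \<in> charts" "\<And>z. z \<in> D \<Longrightarrow> a (f (b (pt z))) \<noteq> infty"
  shows "(\<lambda>z. stereo (a (f (b (pt z))))) holomorphic_on D"
  unfolding holomorphic_on_def
proof
  fix z assume "z \<in> D"
  hence "(\<lambda>z. stereo (a (f (b (pt z))))) field_differentiable (at z)"
    using assms unfolding hol_def by blast
  thus "(\<lambda>z. stereo (a (f (b (pt z))))) field_differentiable (at z within D)"
    by (rule field_differentiable_at_within)
qed

text \<open>Cauchy's estimate for the derivative, transported to the sphere.\<close>

lemma hol_Schwarz:
  assumes f: "hol f" and r: "0 < r" "r \<le> 1/4" and eta: "eta < 1/4"
    and small: "\<And>y. y \<in> ball x r \<Longrightarrow> dist (f x) (f y) \<le> eta"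
    and y: "y \<in> ball x (r/8)" "y' \<in> ball x (r/8)"
  shows "dist (f y) (f y') \<le> 100 * eta / r * dist y y'"
proof -
  have eta0: "eta \<ge> 0" using small[of x] r by simp
  obtain b z0 where b: "b \<in> charts" "b x = pt z0" "cmod z0 \<le> 1" by (rule chart_exists)
  obtain a w0 where a: "a \<in> charts" "a (f x) = pt w0" "cmod w0 \<le> 1" by (rule chart_exists)
  define F where "F = (\<lambda>z. stereo (a (f (b (pt z)))))"
  define D where "D = ball z0 (r/2)"
  have D: "a (f (b (pt z))) \<noteq> infty" "cmod (F z - w0) \<le> 2 * eta" if "z \<in> D" for z
  proof -
    have "b (pt z) \<in> ball x r"
      using chart_disc(1)[OF b, of z "r/2"] that by (simp add: D_def dist_norm norm_minus_commute)
    hence *: "dist (pt w0) (a (f (b (pt z)))) \<le> eta"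
      using small a by (metis chart_dist)
    show "a (f (b (pt z))) \<noteq> infty" using near_lower(1)[OF a(3), of "a (f (b (pt z)))"] * eta by linarith
    show "cmod (F z - w0) \<le> 2 * eta"
      using near_lower(3)[OF a(3), of "a (f (b (pt z)))"] * eta unfolding F_def by linarith
  qed
  have holF: "(\<lambda>z. F z - w0) holomorphic_on D"
    unfolding F_def by (intro holomorphic_intros hol_chart_holomorphic f a b D(1))
  have bound: "cmod (deriv (\<lambda>z. F z - w0) z) \<le> 16 * eta / r" if z: "z \<in> ball z0 (r/4)" for z
  proof -
    have sub: "cball z (r/8) \<subseteq> D"
    proof
      fix u assume "u \<in> cball z (r/8)"
      thus "u \<in> D" using z r dist_triangle[of z0 u z] unfolding D_def by simp
    qed
    have "cmod ((deriv ^^ 1) (\<lambda>z. F z - w0) z) \<le> fact 1 * (2 * eta) / (r/8) ^ 1"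
    proof (rule Cauchy_inequality)
      show "(\<lambda>z. F z - w0) holomorphic_on ball z (r/8)"
        using holF sub by (meson ball_subset_cball holomorphic_on_subset order_trans)
      show "continuous_on (cball z (r/8)) (\<lambda>z. F z - w0)"
        using holF sub by (meson holomorphic_on_imp_continuous_on holomorphic_on_subset)
      show "cmod (F u - w0) \<le> 2 * eta" if "cmod (z - u) = r/8" for u
        using that sub by (intro D(2)) (auto simp: dist_norm subset_iff)
    qed (use r in auto)
    thus ?thesis using r by (simp add: field_simps)
  qed
  have Lip: "cmod ((F u - w0) - (F v - w0)) \<le> 16 * eta / r * cmod (u - v)"
    if "u \<in> ball z0 (r/4)" "v \<in> ball z0 (r/4)" for u v
  proof (rule field_differentiable_bound[OF convex_ball _ bound that])
    fix z assume z: "z \<in> ball z0 (r/4)"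
    have "z \<in> D" using z r by (simp add: D_def)
    hence "((\<lambda>z. F z - w0) has_field_derivative deriv (\<lambda>z. F z - w0) z) (at z)"
      using holF by (intro holomorphic_derivI[of _ D]) (auto simp: D_def)
    thus "((\<lambda>z. F z - w0) has_field_derivative deriv (\<lambda>z. F z - w0) z) (at z within ball z0 (r/4))"
      by (rule has_field_derivative_at_within)
  qed
  define u v where "u = stereo (b y)" and "v = stereo (b y')"
  have u: "b y = pt u" "u \<in> ball z0 (r/4)" "cmod u \<le> 2"
    using chart_disc(2)[OF b y(1)] r by (auto simp: u_def dist_norm norm_minus_commute)
  have v: "b y' = pt v" "v \<in> ball z0 (r/4)" "cmod v \<le> 2"
    using chart_disc(2)[OF b y(2)] r by (auto simp: v_def dist_norm norm_minus_commute)
  have uD: "u \<in> D" "v \<in> D" using u v r by (auto simp: D_def)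
  have yy: "y = b (pt u)" "y' = b (pt v)" using u v b by (metis chart_invol)+
  have fy: "a (f y) = pt (F u)" "a (f y') = pt (F v)"
    unfolding yy F_def using D(1)[OF uD(1)] D(1)[OF uD(2)] by (simp_all add: pt_stereo)
  have "dist (f y) (f y') = dist (pt (F u)) (pt (F v))"
    using a(1) by (metis chart_dist fy)
  also have "\<dots> \<le> 2 * cmod (F u - F v)" by (rule dist_pt_le)
  also have "\<dots> \<le> 2 * (16 * eta / r * cmod (u - v))"
    using Lip[OF u(2) v(2)] by simp
  also have "cmod (u - v) \<le> 3 * dist (pt u) (pt v)" using dist_pt_ge2 u v by blast
  also have "dist (pt u) (pt v) = dist y y'" using u v b by (metis chart_dist)
  finally have "dist (f y) (f y') \<le> 2 * (16 * eta / r * (3 * dist y y'))"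
    using eta0 r by (simp add: mult_left_mono divide_right_mono)
  \<comment> \<open>The constant found is 2 * 16 * 3 = 96: Cauchy's estimate on discs of radius
    \<open>r/8\<close> for a function bounded by \<open>2 * eta\<close> gives 16, the passages
    between chart and sphere give 2 and 3.\<close>
  also have "\<dots> \<le> 100 * eta / r * dist y y'"
    using eta0 r by (simp add: divide_simps mult_right_mono)
  finally show ?thesis .
qed

text \<open>\<open>nc\<close> excludes constancy on every non-empty open set, so the open mapping
  theorem applies in a pair of charts about each point.\<close>

lemma hol_open_map:
  assumes f: "hol f" and nc: "\<And>V c. open V \<Longrightarrow> V \<noteq> {} \<Longrightarrow> \<exists>x\<in>V. f x \<noteq> c" and U: "open U"
  shows "open (f ` U)"
proof (rule topological_space_class.openI)
  fix y assume "y \<in> f ` U"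
  then obtain x where x: "x \<in> U" "y = f x" by auto
  obtain b z0 where b: "b \<in> charts" "b x = pt z0" "cmod z0 \<le> 1" by (rule chart_exists)
  obtain a w0 where a: "a \<in> charts" "a (f x) = pt w0" "cmod w0 \<le> 1" by (rule chart_exists)
  define N where "N = U \<inter> f -` (ball (f x) (1/4))"
  have "open N"
    unfolding N_def using U hol_cont[OF f] by (intro open_Int) (auto simp: continuous_on_open_vimage)
  moreover have "x \<in> N" using x by (simp add: N_def)
  ultimately obtain r where r: "r > 0" "ball x r \<subseteq> N" using open_contains_ball by blast
  define D where "D = ball z0 (r/2)"
  define F where "F = (\<lambda>z. stereo (a (f (b (pt z)))))"
  have DN: "b (pt z) \<in> N" if "z \<in> D" for z
    using chart_disc(1)[OF b, of z "r/2"] that r by (auto simp: D_def dist_norm norm_minus_commute)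
  have D: "a (f (b (pt z))) \<noteq> infty" if "z \<in> D" for z
  proof -
    have "dist (pt w0) (a (f (b (pt z)))) < 1/4"
      using DN[OF that] a unfolding N_def by (metis IntD2 chart_dist mem_ball vimageD)
    thus ?thesis using near_lower(1)[OF a(3)] by blast
  qed
  have fF: "f (b (pt z)) = a (pt (F z))" if "z \<in> D" for z
    using D[OF that] a(1) by (simp add: F_def pt_stereo)
  have holF: "F holomorphic_on D"
    unfolding F_def by (intro hol_chart_holomorphic f a b D)
  have xD: "x = b (pt z0)" "z0 \<in> D" using b r by (metis chart_invol) (simp add: D_def r)
  have ncF: "\<not> F constant_on D"
  proof
    assume "F constant_on D"
    then obtain c where c: "\<And>z. z \<in> D \<Longrightarrow> F z = c" by (auto simp: constant_on_def)
    have "open (b ` pt ` D)" using b by (intro open_chart_image open_pt_image) (auto simp: D_def)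
    moreover have "b ` pt ` D \<noteq> {}" using xD by auto
    ultimately obtain q where "q \<in> b ` pt ` D" "f q \<noteq> a (pt c)" using nc by metis
    thus False using c fF by auto
  qed
  have "open (F ` D)"
    by (rule open_mapping_thm[OF holF _ _ _ _ ncF]) (auto simp: D_def)
  hence "open (a ` pt ` F ` D)" using a by (intro open_chart_image open_pt_image)
  moreover have "y \<in> a ` pt ` F ` D" using xD fF x by blast
  moreover have "a ` pt ` F ` D \<subseteq> f ` U"
  proof -
    have "a (pt (F z)) \<in> f ` U" if "z \<in> D" for z
      using DN[OF that] fF[OF that] unfolding N_def by (metis IntD1 image_eqI)
    thus ?thesis by blast
  qed
  ultimately show "\<exists>T. open T \<and> y \<in> T \<and> T \<subseteq> f ` U" by blast
qed

section \<open>Rational maps\<close>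

text \<open>The point with homogeneous coordinates \<open>[u : v]\<close>.\<close>

definition hpt :: "complex \<Rightarrow> complex \<Rightarrow> rsphere" where
  "hpt u v = (if v = 0 then infty else pt (u / v))"

lemma Rep_hpt:
  assumes "u \<noteq> 0 \<or> v \<noteq> 0"
  shows "Rep_rsphere (hpt u v) = (2 * u * cnj v / of_real ((cmod u)\<^sup>2 + (cmod v)\<^sup>2),
     ((cmod u)\<^sup>2 - (cmod v)\<^sup>2) / ((cmod u)\<^sup>2 + (cmod v)\<^sup>2))"
proof (cases "v = 0")
  case True
  thus ?thesis using assms by (simp add: hpt_def Rep_infty)
next
  case False
  define A B where "A = (cmod u)\<^sup>2" and "B = (cmod v)\<^sup>2"
  have A: "A \<ge> 0" and B: "B > 0" using False by (auto simp: A_def B_def)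
  have AB: "(cmod (u / v))\<^sup>2 = A / B" by (simp add: norm_divide power_divide A_def B_def)
  have vv: "v * cnj v = of_real B" by (simp add: B_def complex_norm_square[symmetric])
  have e: "1 + A / B = (A + B) / B" using B by (simp add: field_simps)
  have "2 * (u / v) / of_real (1 + A / B) = 2 * u * cnj v / of_real (A + B)"
  proof -
    have "2 * (u / v) = 2 * u * cnj v / of_real B" using False by (simp add: vv[symmetric])
    thus ?thesis unfolding e using B by simp
  qed
  moreover have "(A / B - 1) / (A / B + 1) = (A - B) / (A + B)"
    using A B by (simp add: divide_simps)
  ultimately show ?thesis using False
    unfolding hpt_def by (simp add: Rep_pt AB A_def[symmetric] B_def[symmetric] del: of_real_add)
qed

lemma flip_hpt: "u \<noteq> 0 \<or> v \<noteq> 0 \<Longrightarrow> flip (hpt u v) = hpt v u"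
  by (subst Rep_rsphere_inject[symmetric], subst Rep_flip)
    (auto simp: Rep_hpt add.commute minus_divide_left mult.commute)

lemma hpt_eq_iff:
  assumes "u \<noteq> 0 \<or> v \<noteq> 0" "c \<noteq> 0 \<or> d \<noteq> 0" "hpt u v = hpt c d"
  shows "u * d = v * c"
proof -
  have "u / v = c / d" if "v \<noteq> 0" "d \<noteq> 0"
    using assms(3) that by (simp add: hpt_def) (metis stereo_pt)
  thus ?thesis using assms
    by (auto simp: hpt_def frac_eq_eq mult.commute split: if_splits dest: sym)
qed

lemma hpt_surj: obtains c d where "c \<noteq> 0 \<or> d \<noteq> 0" "x = hpt c d"
proof (cases "x = infty")
  case True
  thus ?thesis using that[of 1 0] by (simp add: hpt_def)
next
  case False
  thus ?thesis using that[of "stereo x" 1] by (simp add: hpt_def pt_stereo)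
qed

lemma coprime_poly_no_common_root:
  fixes p q :: "complex poly"
  assumes "coprime p q"
  shows "poly p z \<noteq> 0 \<or> poly q z \<noteq> 0"
proof (rule ccontr)
  assume "\<not> ?thesis"
  hence "[:-z, 1:] dvd p" "[:-z, 1:] dvd q" by (auto simp: poly_eq_0_iff_dvd)
  hence "is_unit [:-z, 1:]" using assms by (meson coprime_common_divisor)
  thus False by (auto simp: is_unit_iff_degree)
qed

lemma coprime_poly_independent:
  fixes p q :: "complex poly"
  assumes "coprime p q" "max (degree p) (degree q) \<ge> 1" "c \<noteq> 0 \<or> d \<noteq> 0"
  shows "smult c p + smult d q \<noteq> 0"
proof
  have *: False if cp: "coprime p q" and m: "max (degree p) (degree q) \<ge> 1" and "c \<noteq> 0"
    and e: "smult c p + smult d q = 0" for p q :: "complex poly" and c d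
  proof -
    have "smult c p = - smult d q" using e by (simp add: eq_neg_iff_add_eq_0)
    hence "smult (1/c) (smult c p) = smult (1/c) (- smult d q)" by (rule arg_cong)
    hence p: "p = smult (- d / c) q" using \<open>c \<noteq> 0\<close> by simp
    hence "q dvd p" by (metis dvd_refl dvd_smult)
    hence "is_unit q" using cp by (meson coprime_common_divisor dvd_refl)
    hence "degree q = 0" by (metis is_unit_iff_degree not_is_unit_0)
    moreover have "degree p \<le> degree q" by (subst p) (rule degree_smult_le)
    ultimately show False using m by simp
  qed
  assume e: "smult c p + smult d q = 0"
  show False
  proof (cases "c = 0")
    case False thus ?thesis using *[OF assms(1,2) False e] by simp
  next
    case True
    thus ?thesis
      using *[of q p d c] assms e by (simp add: coprime_commute max.commute add.commute)
  qed
qed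

text \<open>Homogeneous coordinates treat poles and \<open>infty\<close> uniformly: near
  \<open>infty\<close> the two polynomials are replaced by their reversals. The absence of common
  zeros makes the value meaningful; linear independence encodes that the map is not
  constant.\<close>

lemma rat_map_homogeneous:
  assumes f: "is_rat_map f" and b: "b \<in> charts"
  obtains P Q where "\<And>z. f (b (pt z)) = hpt (poly P z) (poly Q z)"
    "\<And>z. poly P z \<noteq> 0 \<or> poly Q z \<noteq> 0"
    "\<And>c d. c \<noteq> 0 \<or> d \<noteq> 0 \<Longrightarrow> smult c P + smult d Q \<noteq> 0"
proof -
  obtain p q where cp: "coprime p q" and m: "max (degree p) (degree q) \<ge> 1"
    and f1: "\<And>z. poly q z \<noteq> 0 \<Longrightarrow> f (pt z) = pt (poly p z / poly q z)"
    and f2: "\<And>z. poly q z = 0 \<Longrightarrow> f (pt z) = infty"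
    and f3: "f infty = (if degree p > degree q then infty
                 else pt (coeff p (degree q) / lead_coeff q))"
    using f unfolding is_rat_map_def by blast
  have fh: "f (pt z) = hpt (poly p z) (poly q z)" for z
    using f1 f2 by (auto simp: hpt_def)
  show ?thesis
  proof (cases "b = id")
    case True
    show ?thesis
      by (rule that[of p q])
        (use True fh coprime_poly_no_common_root[OF cp] coprime_poly_independent[OF cp m] in auto)
  next
    case False
    hence bf: "b = flip" using b by (auto simp: charts_def)
    define n where "n = max (degree p) (degree q)"
    \<comment> \<open>\<open>reflect_poly\<close> reverses with respect to the degree of its own
      argument; the monomial lifts both reversals to the common degree \<open>n\<close>, so that
      their quotient is that of \<open>p\<close> and \<open>q\<close> at 1/z.\<close>
    define R where "R = (\<lambda>p :: complex poly. monom 1 (n - degree p) * reflect_poly p)"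
    have R: "poly (R p) z = z ^ n * poly p (inverse z)" if "z \<noteq> 0" "degree p \<le> n" for p z
    proof -
      have "poly (R p) z = (z ^ (n - degree p) * z ^ degree p) * poly p (inverse z)"
        using that by (simp add: R_def poly_reflect_poly_nz poly_monom)
      also have "z ^ (n - degree p) * z ^ degree p = z ^ n"
        using that by (simp add: power_add[symmetric])
      finally show ?thesis .
    qed
    have R0: "poly (R p) 0 = coeff p n" if "degree p \<le> n" for p
      using that by (auto simp: R_def poly_monom power_0_left coeff_eq_0)
    have le: "degree p \<le> n" "degree q \<le> n" by (auto simp: n_def)
    have flip0: "flip (pt 0) = infty" using flip_hpt[of 0 1] by (simp add: hpt_def)
    have flipz: "flip (pt z) = pt (inverse z)" if "z \<noteq> 0" for z
      using flip_hpt[of z 1] that by (simp add: hpt_def divide_inverse)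
    have ne: "p \<noteq> 0 \<or> q \<noteq> 0" "coeff p n \<noteq> 0 \<or> coeff q n \<noteq> 0"
    proof -
      show "p \<noteq> 0 \<or> q \<noteq> 0" using m by auto
      show "coeff p n \<noteq> 0 \<or> coeff q n \<noteq> 0"
      proof (cases "degree p \<ge> degree q")
        case True
        hence "n = degree p" by (simp add: n_def)
        thus ?thesis using m n_def by (metis degree_0 leading_coeff_0_iff not_one_le_zero)
      next
        case False
        hence "n = degree q" by (simp add: n_def)
        thus ?thesis using m n_def by (metis degree_0 leading_coeff_0_iff not_one_le_zero)
      qed
    qed
    show ?thesis
    proof (rule that[of "R p" "R q"])
      fix z
      show "f (b (pt z)) = hpt (poly (R p) z) (poly (R q) z)"
      proof (cases "z = 0")
        case True
        show ?thesis
        proof (cases "degree p > degree q")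
          case True
          hence "coeff q n = 0" by (simp add: n_def coeff_eq_0)
          thus ?thesis using True \<open>z = 0\<close> f3 le by (simp add: bf flip0 R0 hpt_def)
        next
          case F: False
          hence nq: "n = degree q" by (simp add: n_def)
          have "q \<noteq> 0" using nq m n_def by (metis degree_0 not_one_le_zero)
          thus ?thesis using F \<open>z = 0\<close> f3 le by (simp add: bf flip0 R0 hpt_def nq)
        qed
      next
        case False
        thus ?thesis by (simp add: bf flipz fh R le hpt_def)
      qed
      show "poly (R p) z \<noteq> 0 \<or> poly (R q) z \<noteq> 0"
        using ne(2) R0 R le coprime_poly_no_common_root[OF cp, of "inverse z"]
        by (cases "z = 0") auto
    next
      fix c d :: complex assume cd: "c \<noteq> 0 \<or> d \<noteq> 0"
      show "smult c (R p) + smult d (R q) \<noteq> 0"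
      proof
        assume e: "smult c (R p) + smult d (R q) = 0"
        have "poly (smult c p + smult d q) z = 0" if "z \<noteq> 0" for z
        proof -
          have "poly (smult c (R p) + smult d (R q)) (inverse z) = 0" by (simp add: e)
          hence "inverse z ^ n * (c * poly p z + d * poly q z) = 0"
            using that le by (simp add: R algebra_simps)
          thus ?thesis using that by simp
        qed
        hence "- {0} \<subseteq> {z. poly (smult c p + smult d q) z = 0}" by auto
        hence "infinite {z. poly (smult c p + smult d q) z = 0}"
          using infinite_UNIV_char_0 finite_subset
          by (metis finite_compl finite.emptyI finite_insert)
        thus False using coprime_poly_independent[OF cp m cd] poly_roots_finite by blast
      qed
    qed
  qed
qed

lemma rat_map_cont:
  assumes "is_rat_map f"
  shows "continuous_on UNIV f"
proof -
  have "isCont f x" for x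
  proof -
    obtain b z0 where b: "b \<in> charts" "b x = pt z0" "cmod z0 \<le> 1" by (rule chart_exists)
    obtain P Q where PQ: "\<And>z. f (b (pt z)) = hpt (poly P z) (poly Q z)"
      "\<And>z. poly P z \<noteq> 0 \<or> poly Q z \<noteq> 0"
      using rat_map_homogeneous[OF assms b(1)] by metis
    have "continuous_on UNIV (\<lambda>z. Rep_rsphere (hpt (poly P z) (poly Q z)))"
    proof -
      have "complex_of_real ((cmod (poly P z))\<^sup>2) + of_real ((cmod (poly Q z))\<^sup>2) \<noteq> 0"
        "(cmod (poly P z))\<^sup>2 + (cmod (poly Q z))\<^sup>2 \<noteq> 0" for z
        using PQ(2)[of z] by (simp_all add: sum_power2_eq_zero_iff flip: of_real_power of_real_add)
      thus ?thesis
        unfolding Rep_hpt[OF PQ(2)] by (intro continuous_intros) auto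
    qed
    hence "continuous_on UNIV (\<lambda>z. f (b (pt z)))"
      unfolding PQ(1)[symmetric] continuous_on_iff dist_rsphere_def .
    moreover define V where "V = {y. b y \<noteq> infty}"
    moreover have "continuous_on V (\<lambda>y. stereo (b y))"
      by (rule continuous_on_compose2[OF continuous_on_stereo continuous_on_chart[OF b(1)]])
        (auto simp: V_def)
    ultimately have "continuous_on V (\<lambda>y. f (b (pt (stereo (b y)))))"
      using continuous_on_compose2[of UNIV "\<lambda>z. f (b (pt z))" V "\<lambda>y. stereo (b y)"] by simp
    hence "continuous_on V f"
      by (rule continuous_on_eq) (use b in \<open>auto simp: V_def pt_stereo\<close>)
    moreover have "open V"
    proof -
      have "V = b -` (- {infty})" by (auto simp: V_def)
      thus ?thesis using continuous_on_chart[OF b(1), of UNIV] open_not_infty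
        by (simp add: continuous_on_open_vimage)
    qed
    moreover have "x \<in> V" using b by (simp add: V_def)
    ultimately show ?thesis by (simp add: continuous_on_eq_continuous_at)
  qed
  thus ?thesis by (simp add: continuous_on_eq_continuous_at)
qed

lemma poly_quotient_differentiable:
  fixes P Q :: "complex poly"
  assumes "poly Q z \<noteq> 0" "\<And>z. poly Q z \<noteq> 0 \<Longrightarrow> h z = poly P z / poly Q z"
  shows "h field_differentiable (at z)"
proof -
  have "open {z. poly Q z \<noteq> 0}"
    by (intro open_Collect_neq continuous_intros)
  then obtain d where d: "d > 0" "ball z d \<subseteq> {z. poly Q z \<noteq> 0}"
    using assms(1) open_contains_ball by blast
  have "poly P field_differentiable (at z)" "poly Q field_differentiable (at z)"
    unfolding field_differentiable_def using poly_DERIV by blast+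
  hence "(\<lambda>z. poly P z / poly Q z) field_differentiable (at z)"
    by (rule field_differentiable_divide) (rule assms)
  thus ?thesis
    by (rule field_differentiable_transform_within[OF d(1), rotated 2])
      (use d assms(2) in \<open>auto simp: dist_commute subset_iff\<close>)
qed

lemma rat_map_hol:
  assumes "is_rat_map f"
  shows "hol f"
  unfolding hol_def
proof (intro conjI ballI allI impI)
  show "continuous_on UNIV f" by (rule rat_map_cont[OF assms])
  fix a b z assume a: "a \<in> charts" and b: "b \<in> charts" and nz: "a (f (b (pt z))) \<noteq> infty"
  obtain P Q where PQ: "\<And>z. f (b (pt z)) = hpt (poly P z) (poly Q z)"
    "\<And>z. poly P z \<noteq> 0 \<or> poly Q z \<noteq> 0"
    using rat_map_homogeneous[OF assms b] by metis
  show "(\<lambda>z. stereo (a (f (b (pt z))))) field_differentiable at z"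
  proof (cases "a = id")
    case True
    show ?thesis
      by (rule poly_quotient_differentiable[of Q _ _ P])
        (use True nz in \<open>auto simp: PQ hpt_def split: if_splits\<close>)
  next
    case False
    hence "a = flip" using a by (auto simp: charts_def)
    moreover from this nz PQ(2)[of z] have "hpt (poly Q z) (poly P z) \<noteq> infty"
      by (simp add: PQ flip_hpt)
    hence "poly P z \<noteq> 0" by (auto simp: hpt_def)
    ultimately show ?thesis
      by (intro poly_quotient_differentiable[of P _ _ Q])
        (use PQ(2) in \<open>simp_all add: PQ flip_hpt\<close>, simp add: hpt_def)
  qed
qed

text \<open>Constancy on an open set would make a non-zero linear combination of the two homogeneous
  coordinates vanish on a disc.\<close>

lemma rat_map_nonconstant:
  assumes f: "is_rat_map f" and U: "open U" "U \<noteq> {}"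
  shows "\<exists>x\<in>U. f x \<noteq> c"
proof (rule ccontr)
  assume "\<not> ?thesis"
  hence fc: "\<And>x. x \<in> U \<Longrightarrow> f x = c" by blast
  obtain x where "x \<in> U" using U by blast
  obtain b z0 where b: "b \<in> charts" "b x = pt z0" "cmod z0 \<le> 1" by (rule chart_exists)
  obtain r where r: "r > 0" "ball x r \<subseteq> U" using U \<open>x \<in> U\<close> open_contains_ball by blast
  obtain P Q where PQ: "\<And>z. f (b (pt z)) = hpt (poly P z) (poly Q z)"
    "\<And>z. poly P z \<noteq> 0 \<or> poly Q z \<noteq> 0"
    "\<And>c d. c \<noteq> 0 \<or> d \<noteq> 0 \<Longrightarrow> smult c P + smult d Q \<noteq> 0"
    using rat_map_homogeneous[OF f b(1)] by metis
  obtain s t where st: "s \<noteq> 0 \<or> t \<noteq> 0" "c = hpt s t" by (rule hpt_surj)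
  have "poly (smult t P + smult (- s) Q) z = 0" if "z \<in> ball z0 (r/2)" for z
  proof -
    have "b (pt z) \<in> U"
      using chart_disc(1)[OF b, of z "r/2"] that r by (auto simp: dist_norm norm_minus_commute)
    hence "hpt (poly P z) (poly Q z) = hpt s t" using fc st PQ by metis
    from hpt_eq_iff[OF PQ(2) st(1) this] show ?thesis by (simp add: mult.commute)
  qed
  hence "ball z0 (r/2) \<subseteq> {z. poly (smult t P + smult (- s) Q) z = 0}" by auto
  moreover have "infinite (ball z0 (r/2))"
    using uncountable_ball[of "r/2" z0] r countable_finite by auto
  ultimately have "infinite {z. poly (smult t P + smult (- s) Q) z = 0}"
    using finite_subset by blast
  moreover have "smult t P + smult (- s) Q \<noteq> 0" using st(1) by (intro PQ(3)) auto
  ultimately show False using poly_roots_finite by blast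
qed

lemma rat_map_open:
  assumes "is_rat_map f" "open U"
  shows "open (f ` U)"
  using hol_open_map[OF rat_map_hol[OF assms(1)] _ assms(2)] rat_map_nonconstant[OF assms(1)] by blast

section \<open>Maps close to the identity\<close>

text \<open>By Montel's theorem a counterexample would have a holomorphic limit in a chart, which is the
  identity by the identity theorem.\<close>

lemma near_id_propagates:
  assumes r: "0 < r" "r \<le> 1/8"
    and hl: "\<And>h. h \<in> H \<Longrightarrow> hol h"
    and osc: "\<And>h y y'. h \<in> H \<Longrightarrow> y \<in> ball x r \<Longrightarrow> y' \<in> ball x r \<Longrightarrow> dist (h y) (h y') < 1/8"
    and W: "open W" "W \<noteq> {}" "W \<subseteq> ball x (r/4)"
    and app: "\<And>e. e > 0 \<Longrightarrow> \<exists>h\<in>H. \<forall>y\<in>W. dist (h y) y < e"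
    and e: "e > 0"
  shows "\<exists>h\<in>H. \<forall>y\<in>ball x (r/8). dist (h y) y < e"
proof -
  obtain b z0 where b: "b \<in> charts" "b x = pt z0" "cmod z0 \<le> 1" by (rule chart_exists)
  \<comment> \<open>The bound 1/32 together with the oscillation bound keeps all values inside one
    chart; the bound 1/(n+1) forces the limit to be the identity on \<open>W\<close>.\<close>
  have "\<forall>n. \<exists>h\<in>H. \<forall>y\<in>W. dist (h y) y < min (1/32) (inverse (real (Suc n)))"
    by (intro allI app) simp
  then obtain h where h: "\<And>n. h n \<in> H"
    "\<And>n y. y \<in> W \<Longrightarrow> dist (h n y) y < min (1/32) (inverse (real (Suc n)))"
    by metis
  define D where "D = ball z0 (r/2)"
  define F where "F = (\<lambda>n z. stereo (b (h n (b (pt z)))))"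
  obtain w where w: "w \<in> W" using W by blast
  have Dx: "b (pt z) \<in> ball x r" if "z \<in> D" for z
    using chart_disc(1)[OF b, of z "r/2"] that by (auto simp: D_def dist_norm norm_minus_commute)
  have near: "dist (pt z0) (b (h n y)) < 1/4" if "y \<in> ball x r" for n y
  proof -
    have wx: "w \<in> ball x r" "dist x w < r/4" using w W r by (auto simp: subset_iff)
    have "dist x (h n y) \<le> dist x w + dist w (h n w) + dist (h n w) (h n y)"
      by (metis add.assoc add_left_mono dist_triangle order_trans)
    also have "\<dots> < 1/32 + 1/32 + 1/8"
      using wx osc[OF h(1) wx(1) that, of n] h(2)[OF w, of n] r by (simp add: dist_commute)
    finally have "dist x (h n y) < 1/4" by simp
    thus ?thesis using b by (metis chart_dist)
  qed
  have D: "b (h n (b (pt z))) \<noteq> infty" "cmod (F n z) \<le> 2" if "z \<in> D" for n z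
    using near_lower[OF b(3) near[OF Dx[OF that]]] by (simp_all add: F_def)
  have holF: "F n holomorphic_on D" for n
    unfolding F_def by (intro hol_chart_holomorphic hl h b D(1))
  obtain g k where g: "g holomorphic_on D" "strict_mono (k :: nat \<Rightarrow> nat)"
    "\<And>z. z \<in> D \<Longrightarrow> (\<lambda>n. F (k n) z) \<longlonglongrightarrow> g z"
    "\<And>K. compact K \<Longrightarrow> K \<subseteq> D \<Longrightarrow> uniform_limit K (F \<circ> k) g sequentially"
  proof (rule Montel[of D "range F" F])
    show "open D" by (simp add: D_def)
    show "\<exists>B. \<forall>f\<in>range F. \<forall>z\<in>K. cmod (f z) \<le> B" if "compact K" "K \<subseteq> D" for K
      using D(2) that by (intro exI[of _ 2]) auto
  qed (use holF in auto)
  have zD: "cmod z \<le> 2" if "z \<in> D" for z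
  proof -
    have "cmod z \<le> cmod z0 + cmod (z - z0)" by (metis add_diff_cancel_left' norm_triangle_sub)
    thus ?thesis using that b r by (simp add: D_def dist_norm norm_minus_commute)
  qed
  have Fh: "dist (h n (b (pt z))) (b (pt z)) = dist (pt (F n z)) (pt z)" if "z \<in> D" for n z
    unfolding F_def pt_stereo[OF D(1)[OF that]] using b(1) by (metis chart_dist chart_invol)
  define W' where "W' = D \<inter> (\<lambda>z. b (pt z)) -` W"
  have gid: "g z = z" if "z \<in> W'" for z
  proof -
    have zz: "z \<in> D" "b (pt z) \<in> W" using that by (auto simp: W'_def)
    have "(\<lambda>n. F n z) \<longlonglongrightarrow> z"
    proof (rule LIMSEQ_I)
      fix s :: real assume "s > 0"
      then obtain N where N: "inverse (real (Suc N)) < s / 3"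
        using reals_Archimedean[of "s/3"] by auto
      have "norm (F n z - z) < s" if "n \<ge> N" for n
      proof -
        have "norm (F n z - z) \<le> 3 * dist (pt (F n z)) (pt z)"
          by (intro dist_pt_ge2 D zD zz)
        also have "\<dots> = 3 * dist (h n (b (pt z))) (b (pt z))" using Fh zz by simp
        also have "\<dots> < 3 * inverse (real (Suc n))" using h(2)[OF zz(2), of n] by simp
        also have "\<dots> \<le> 3 * inverse (real (Suc N))"
          using that by (intro mult_left_mono le_imp_inverse_le) auto
        finally show ?thesis using N by simp
      qed
      thus "\<exists>N. \<forall>n\<ge>N. norm (F n z - z) < s" by blast
    qed
    hence "(\<lambda>n. F (k n) z) \<longlonglongrightarrow> z"
      using LIMSEQ_subseq_LIMSEQ[OF _ g(2)] by (auto simp: o_def)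
    thus ?thesis using g(3)[OF zz(1)] LIMSEQ_unique by blast
  qed
  have "open W'"
  proof -
    have "continuous_on UNIV (b \<circ> pt)"
      by (intro continuous_on_compose continuous_on_pt continuous_on_chart b)
    thus ?thesis unfolding W'_def using W
      by (intro open_Int) (auto simp: D_def continuous_on_open_vimage o_def)
  qed
  moreover have "W' \<noteq> {}"
  proof -
    have "b w = pt (stereo (b w)) \<and> cmod (stereo (b w) - z0) < 2 * (r/4)"
      using chart_disc(2)[OF b, of w "r/4"] w W r by auto
    hence "stereo (b w) \<in> W'" using w b
      by (simp add: W'_def D_def dist_norm norm_minus_commute)
    thus ?thesis by blast
  qed
  moreover have "open D" "connected D" "W' \<subseteq> D" by (auto simp: D_def W'_def)
  ultimately have gD: "g z = z" if "z \<in> D" for z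
    using analytic_continuation_open[of W' D g "\<lambda>z. z" z] that gid g(1) holomorphic_on_ident
    by simp
  have "uniform_limit (cball z0 (r/4)) (F \<circ> k) g sequentially"
    by (rule g(4)) (use r in \<open>auto simp: D_def\<close>)
  then obtain n where n: "\<And>z. z \<in> cball z0 (r/4) \<Longrightarrow> dist (F (k n) z) (g z) < e/2"
    using e unfolding uniform_limit_iff eventually_sequentially o_def
    by (metis half_gt_zero order_refl)
  have "dist (h (k n) y) y < e" if "y \<in> ball x (r/8)" for y
  proof -
    define z where "z = stereo (b y)"
    have z: "b y = pt z" "z \<in> cball z0 (r/4)" "z \<in> D"
      using chart_disc(2)[OF b that] r by (auto simp: z_def D_def dist_norm norm_minus_commute)
    have y: "y = b (pt z)" using z b by (metis chart_invol)
    have "dist (h (k n) y) y = dist (pt (F (k n) z)) (pt z)" unfolding y by (rule Fh[OF z(3)])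
    also have "\<dots> \<le> 2 * cmod (F (k n) z - z)" by (rule dist_pt_le)
    also have "\<dots> < e" using n[OF z(2)] gD[OF z(3)] by (simp add: dist_norm)
    finally show ?thesis .
  qed
  thus ?thesis using h by blast
qed

text \<open>Brouwer's fixed point theorem for \<open>z \<mapsto> z\<^sub>0 + (z - f z)\<close> in a chart.\<close>

lemma near_id_covers:
  fixes f :: "rsphere \<Rightarrow> rsphere"
  assumes f: "continuous_on UNIV f" and r: "0 < r" "r \<le> 1/4"
    and near: "\<And>y. y \<in> ball x r \<Longrightarrow> dist (f y) y < r/16"
  shows "\<exists>y\<in>ball x r. f y = x"
proof -
  obtain b z0 where b: "b \<in> charts" "b x = pt z0" "cmod z0 \<le> 1" by (rule chart_exists)
  define D where "D = cball z0 (r/4)"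
  define F where "F = (\<lambda>z. stereo (b (f (b (pt z)))))"
  have Dx: "b (pt z) \<in> ball x (3*r/4)" if "z \<in> D" for z
    using chart_disc(1)[OF b, of z "3*r/8"] that r by (auto simp: D_def dist_norm norm_minus_commute)
  have Dr: "b (pt z) \<in> ball x r" if "z \<in> D" for z
    using Dx[OF that] r by auto
  have D: "b (f (b (pt z))) \<noteq> infty" "cmod (F z) \<le> 2" "cmod (F z - z) \<le> 3 * (r/16)" if "z \<in> D" for z
  proof -
    have n: "dist (f (b (pt z))) (b (pt z)) < r/16" using near[OF Dr[OF that]] .
    have "dist x (f (b (pt z))) \<le> dist x (b (pt z)) + dist (b (pt z)) (f (b (pt z)))"
      by (rule dist_triangle)
    also have "\<dots> < 3*r/4 + r/16" using Dx[OF that] n by (simp add: dist_commute)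
    also have "\<dots> < 1/4" using r by simp
    finally have "dist (pt z0) (b (f (b (pt z)))) < 1/4" using b by (metis chart_dist)
    from near_lower[OF b(3) this]
    show nz: "b (f (b (pt z))) \<noteq> infty" and F2: "cmod (F z) \<le> 2" by (simp_all add: F_def)
    have "cmod z \<le> cmod z0 + cmod (z - z0)" by (metis add_diff_cancel_left' norm_triangle_sub)
    hence z2: "cmod z \<le> 2" using that b r by (simp add: D_def dist_norm norm_minus_commute)
    have "cmod (F z - z) \<le> 3 * dist (pt (F z)) (pt z)" by (rule dist_pt_ge2[OF F2 z2])
    also have "dist (pt (F z)) (pt z) = dist (f (b (pt z))) (b (pt z))"
      unfolding F_def pt_stereo[OF nz] using b(1) by (metis chart_dist chart_invol)
    finally show "cmod (F z - z) \<le> 3 * (r/16)" using n by simp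
  qed
  have "continuous_on D (\<lambda>z. b (f (b (pt z))))"
  proof -
    have "continuous_on D (b \<circ> (f \<circ> (b \<circ> pt)))"
      by (intro continuous_on_compose continuous_on_pt continuous_on_chart b
          continuous_on_subset[OF f]) auto
    thus ?thesis by (simp add: o_def)
  qed
  hence "continuous_on D F"
    unfolding F_def
  proof (rule continuous_on_compose2[OF continuous_on_stereo])
    show "(\<lambda>z. b (f (b (pt z)))) ` D \<subseteq> - {infty}" using D(1) by fastforce
  qed
  hence cont: "continuous_on (cball z0 (r/4)) (\<lambda>z. z0 + (z - F z))"
    unfolding D_def by (intro continuous_intros)
  have "(\<lambda>z. z0 + (z - F z)) \<in> cball z0 (r/4) \<rightarrow> cball z0 (r/4)"
  proof
    fix z assume "z \<in> cball z0 (r/4)"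
    hence "cmod (F z - z) \<le> r/4" using D(3)[of z] r by (simp add: D_def)
    thus "z0 + (z - F z) \<in> cball z0 (r/4)" by (simp add: dist_norm norm_minus_commute)
  qed
  then obtain z where z: "z \<in> cball z0 (r/4)" "z0 + (z - F z) = z"
    using brouwer_ball[OF _ cont] r by (metis zero_less_divide_iff zero_less_numeral)
  hence "F z = z0" "z \<in> D" by (auto simp: D_def algebra_simps)
  hence "b (f (b (pt z))) = b x" using D(1) b unfolding F_def by (metis pt_stereo)
  hence "f (b (pt z)) = x" using b(1) by (metis chart_invol)
  thus ?thesis using Dr \<open>z \<in> D\<close> by blast
qed

text \<open>The centres have to lie in \<open>A\<close>, which may fail to be compact; so a net of
  the whole sphere at scale \<open>e/2\<close> is moved into \<open>A\<close>.\<close>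

lemma rsphere_net:
  assumes "e > 0"
  obtains S where "finite S" "S \<subseteq> A" "\<And>x :: rsphere. x \<in> A \<Longrightarrow> \<exists>s\<in>S. dist s x < e"
proof -
  obtain T where T: "finite T" "\<And>x :: rsphere. \<exists>t\<in>T. dist t x < e/2"
    using finite_net[OF compact_UNIV_rsphere, of "e/2"] assms by (metis UNIV_I half_gt_zero)
  define c where "c = (\<lambda>t. SOME x. x \<in> A \<and> dist t x < e/2)"
  define S where "S = c ` {t \<in> T. \<exists>x\<in>A. dist t x < e/2}"
  have c: "c t \<in> A \<and> dist t (c t) < e/2" if "x \<in> A" "dist t x < e/2" for t x
    unfolding c_def by (rule someI[of _ x]) (use that in simp)
  show ?thesis
  proof (rule that[of S])
    show "finite S" using T by (simp add: S_def)
    show "S \<subseteq> A" using c by (auto simp: S_def)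
    fix x assume x: "x \<in> A"
    then obtain t where t: "t \<in> T" "dist t x < e/2" using T by blast
    hence "c t \<in> S" using x by (auto simp: S_def)
    moreover have "dist (c t) x < e"
      using c[OF x t(2)] t(2) by (metis dist_commute dist_triangle_half_l)
    ultimately show "\<exists>s\<in>S. dist s x < e" by blast
  qed
qed

section \<open>Minimal invariant sets\<close>

text \<open>Zorn's lemma is applied to complements, since it provides maximal elements; compactness
  keeps the intersection of a chain non-empty. The setting is topological because the lemma serves
  both the sphere and the space of its self-maps with pointwise convergence.\<close>

lemma minimal_invariant_set:
  fixes K :: "'b :: topological_space set"
  assumes K: "compact K" "closed K" "K \<noteq> {}" and inv: "\<And>f. f \<in> A \<Longrightarrow> f ` K \<subseteq> K"
  obtains I where "I \<noteq> {}" "closed I" "I \<subseteq> K" "\<And>f. f \<in> A \<Longrightarrow> f ` I \<subseteq> I"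
    "\<And>J. J \<noteq> {} \<Longrightarrow> closed J \<Longrightarrow> J \<subseteq> I \<Longrightarrow> (\<And>f. f \<in> A \<Longrightarrow> f ` J \<subseteq> J) \<Longrightarrow> J = I"
proof -
  define P where "P = (\<lambda>J. J \<noteq> {} \<and> closed J \<and> J \<subseteq> K \<and> (\<forall>f\<in>A. f ` J \<subseteq> J))"
  define Q where "Q = {X. P (- X)}"
  have "\<exists>M\<in>Q. \<forall>X\<in>Q. M \<subseteq> X \<longrightarrow> X = M"
  proof (rule subset_Zorn_nonempty)
    have "- K \<in> Q" using K inv by (simp add: Q_def P_def)
    thus "Q \<noteq> {}" by blast
  next
    fix C assume C: "C \<noteq> {}" "subset.chain Q C"
    hence CQ: "C \<subseteq> Q" by (simp add: subset.chain_def)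
    have PC: "P (- X)" if "X \<in> C" for X using that CQ by (auto simp: Q_def)
    have "- \<Union>C \<noteq> {}"
    proof
      assume "- \<Union>C = {}"
      hence "K \<subseteq> \<Union>C" by blast
      moreover have "open X" if "X \<in> C" for X using PC[OF that] by (simp add: P_def open_closed)
      ultimately obtain C' where C': "C' \<subseteq> C" "finite C'" "K \<subseteq> \<Union>C'"
        using compactE[OF K(1), of C] by metis
      have "C' \<noteq> {}" using C' K by auto
      moreover have "subset.chain Q C'" using C(2) C'(1) unfolding subset.chain_def by blast
      ultimately have "\<Union>C' \<in> C'" using C'(2) by (intro Union_in_chain)
      hence "P (- \<Union>C')" using PC C'(1) by blast
      thus False using C'(3) by (auto simp: P_def)
    qed
    moreover have "closed (- \<Union>C)"
      using PC by (auto simp: P_def open_closed[symmetric] closed_def)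
    moreover have "- \<Union>C \<subseteq> K" using C(1) PC by (auto simp: P_def)
    moreover have "f ` (- \<Union>C) \<subseteq> - \<Union>C" if "f \<in> A" for f
    proof -
      have "f x \<notin> X" if x: "x \<in> - \<Union>C" and X: "X \<in> C" for x X
      proof -
        have "x \<in> - X" using x X by blast
        moreover have "f ` (- X) \<subseteq> - X" using PC[OF X] \<open>f \<in> A\<close> by (simp add: P_def)
        ultimately show ?thesis by blast
      qed
      thus ?thesis by blast
    qed
    ultimately show "\<Union>C \<in> Q" by (simp add: Q_def P_def)
  qed
  then obtain M where M: "M \<in> Q" "\<And>X. X \<in> Q \<Longrightarrow> M \<subseteq> X \<Longrightarrow> X = M" by blast
  show ?thesis
  proof (rule that[of "- M"])
    fix J assume J: "J \<noteq> {}" "closed J" "J \<subseteq> - M" "\<And>f. f \<in> A \<Longrightarrow> f ` J \<subseteq> J"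
    have "- J \<in> Q" using J M(1) by (auto simp: Q_def P_def)
    moreover have "M \<subseteq> - J" using J(3) by blast
    ultimately have "- J = M" by (rule M(2))
    thus "J = - M" by blast
  qed (use M(1) in \<open>auto simp: Q_def P_def\<close>)
qed

lemma Min_sets_exist:
  assumes "fwd_inv G K"
  obtains L where "L \<in> Min_sets G" "L \<subseteq> K"
proof -
  have K: "compact K" "closed K" "K \<noteq> {}" "\<And>f. f \<in> G \<Longrightarrow> f ` K \<subseteq> K"
    using assms by (auto simp: fwd_inv_def compact_imp_closed)
  show ?thesis
  proof (rule minimal_invariant_set[OF K])
    fix I assume I: "I \<noteq> {}" "closed I" "I \<subseteq> K" "\<And>f. f \<in> G \<Longrightarrow> f ` I \<subseteq> I"
      "\<And>J. J \<noteq> {} \<Longrightarrow> closed J \<Longrightarrow> J \<subseteq> I \<Longrightarrow> (\<And>f. f \<in> G \<Longrightarrow> f ` J \<subseteq> J) \<Longrightarrow> J = I"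
    have "I \<in> Min_sets G"
      unfolding Min_sets_def fwd_inv_def using I
      by (auto simp: compact_rsphere compact_imp_closed)
    thus thesis using that I by blast
  qed
qed

text \<open>Tychonoff's theorem. The closure of the semigroup in this space is its enveloping
  semigroup, whose elements need not be continuous.\<close>

lemma compact_UNIV_rsphere_fun: "compact (UNIV :: (rsphere \<Rightarrow> rsphere) set)"
proof -
  have "compactin (product_topology (\<lambda>_::rsphere. euclidean :: rsphere topology) UNIV)
     (PiE UNIV (\<lambda>_. UNIV))"
    unfolding compactin_PiE using compact_UNIV_rsphere by (simp add: compactin_euclidean_iff)
  thus ?thesis by (simp add: euclidean_product_topology compactin_euclidean_iff PiE_UNIV_domain)
qed

section \<open>Semigroups of holomorphic open maps\<close>

text \<open>Holomorphy and openness are the properties of rational maps that the dynamical argument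
  uses; both pass to compositions directly, without computing polynomials for them.\<close>

locale hol_semigroup =
  fixes \<Gamma> :: "(rsphere \<Rightarrow> rsphere) set"
  assumes \<Gamma>_hol: "g \<in> \<Gamma> \<Longrightarrow> hol g"
    and \<Gamma>_open: "g \<in> \<Gamma> \<Longrightarrow> open U \<Longrightarrow> open (g ` U)"
    and \<Gamma>_ne: "\<Gamma> \<noteq> {}"
begin

abbreviation G where "G \<equiv> gen_semigroup \<Gamma>"
abbreviation F where "F \<equiv> fatou G"

lemma G_hol: "g \<in> G \<Longrightarrow> hol g"
proof (induction rule: gen_semigroup.induct)
  case (comp g h)
  thus ?case using hol_comp \<Gamma>_hol by blast
qed (rule \<Gamma>_hol)

lemma G_cont: "g \<in> G \<Longrightarrow> continuous_on A g"
  using G_hol hol_cont continuous_on_subset by blast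

lemma G_open: "g \<in> G \<Longrightarrow> open U \<Longrightarrow> open (g ` U)"
proof (induction rule: gen_semigroup.induct)
  case (comp g h)
  thus ?case unfolding image_comp[symmetric] using \<Gamma>_open by blast
qed (rule \<Gamma>_open)

lemma G_comp: "h \<in> G \<Longrightarrow> g \<in> G \<Longrightarrow> h \<circ> g \<in> G"
proof (induction h rule: gen_semigroup.induct)
  case (base h)
  thus ?case by (intro gen_semigroup.comp)
next
  case (comp h h')
  thus ?case unfolding comp_assoc using gen_semigroup.comp by blast
qed

lemma G_ne: "G \<noteq> {}"
  using \<Gamma>_ne gen_semigroup.base by blast

section \<open>Equicontinuity on the Fatou set\<close>

lemma open_fatou: "open F"
proof (rule topological_space_class.openI)
  fix z assume "z \<in> F"
  then obtain U where U: "open U" "z \<in> U"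
    "\<forall>x\<in>U. \<forall>e>0. \<exists>\<delta>>0. \<forall>g\<in>G. \<forall>y\<in>U. dist x y < \<delta> \<longrightarrow> dist (g x) (g y) < e"
    unfolding fatou_def by blast
  have "U \<subseteq> F" unfolding fatou_def using U(1,3) by blast
  thus "\<exists>T. open T \<and> z \<in> T \<and> T \<subseteq> F" using U by blast
qed

lemma fatou_equicontinuous:
  assumes "x \<in> F" "e > 0"
  obtains d where "d > 0" "\<And>g y. g \<in> G \<Longrightarrow> dist x y < d \<Longrightarrow> dist (g x) (g y) < e"
proof -
  obtain U where U: "open U" "x \<in> U"
    "\<forall>x\<in>U. \<forall>e>0. \<exists>\<delta>>0. \<forall>g\<in>G. \<forall>y\<in>U. dist x y < \<delta> \<longrightarrow> dist (g x) (g y) < e"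
    using assms(1) unfolding fatou_def by blast
  obtain d where d: "d > 0" "\<forall>g\<in>G. \<forall>y\<in>U. dist x y < d \<longrightarrow> dist (g x) (g y) < e"
    using U assms(2) by blast
  obtain d' where d': "d' > 0" "ball x d' \<subseteq> U" using U open_contains_ball by blast
  show ?thesis
    by (rule that[of "min d d'"]) (use d d' in \<open>auto simp: subset_iff\<close>)
qed

text \<open>Openness of \<open>g\<close> is the point: everything near \<open>g z\<close> lifts to
  points near \<open>z\<close>, where \<open>h \<circ> g\<close> is again a member of the
  equicontinuous family.\<close>

lemma fatou_forward:
  assumes "g \<in> G" "z \<in> F"
  shows "g z \<in> F"
proof -
  obtain U where U: "open U" "z \<in> U"
    "\<forall>x\<in>U. \<forall>e>0. \<exists>\<delta>>0. \<forall>g\<in>G. \<forall>y\<in>U. dist x y < \<delta> \<longrightarrow> dist (g x) (g y) < e"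
    using assms(2) unfolding fatou_def by blast
  have "\<exists>\<delta>>0. \<forall>h\<in>G. \<forall>y\<in>g ` U. dist x y < \<delta> \<longrightarrow> dist (h x) (h y) < e"
    if x: "x \<in> g ` U" and e: "e > 0" for x e
  proof -
    obtain x0 where x0: "x0 \<in> U" "x = g x0" using x by blast
    obtain d where d: "d > 0" "\<forall>g\<in>G. \<forall>y\<in>U. dist x0 y < d \<longrightarrow> dist (g x0) (g y) < e"
      using U x0 e by blast
    have "open (g ` (U \<inter> ball x0 d))" using U assms by (intro G_open) auto
    moreover have "x \<in> g ` (U \<inter> ball x0 d)" using x0 d by auto
    ultimately obtain d' where d': "d' > 0" "ball x d' \<subseteq> g ` (U \<inter> ball x0 d)"
      using open_contains_ball by blast
    have "dist (h x) (h y) < e" if h: "h \<in> G" and y: "dist x y < d'" for h y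
    proof -
      obtain y0 where y0: "y0 \<in> U" "dist x0 y0 < d" "y = g y0" using d' y by auto
      have "h \<circ> g \<in> G" using G_comp h assms by blast
      hence "dist ((h \<circ> g) x0) ((h \<circ> g) y0) < e" using d y0 by blast
      thus ?thesis using x0 y0 by simp
    qed
    thus ?thesis using d' by blast
  qed
  moreover have "open (g ` U)" using U assms by (intro G_open) auto
  ultimately show ?thesis using U(2) unfolding fatou_def by blast
qed

text \<open>By the Lebesgue number of the cover only \<open>x\<close> has to be in \<open>K\<close>;
  so the bound also serves points near, but not in, an invariant set.\<close>

lemma unif_equicontinuous:
  assumes K: "compact K" "K \<subseteq> F" and e: "e > 0"
  obtains d where "d > 0" "\<And>g x y. g \<in> G \<Longrightarrow> x \<in> K \<Longrightarrow> dist x y < d \<Longrightarrow> dist (g x) (g y) < e"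
proof -
  have "\<forall>x\<in>K. \<exists>d>0. \<forall>g\<in>G. \<forall>y. dist x y < d \<longrightarrow> dist (g x) (g y) < e/2"
  proof
    fix x assume "x \<in> K"
    with K(2) have "x \<in> F" by blast
    then obtain d where "d > 0" "\<And>g y. g \<in> G \<Longrightarrow> dist x y < d \<Longrightarrow> dist (g x) (g y) < e/2"
      using fatou_equicontinuous[of x "e/2"] e by auto
    thus "\<exists>d>0. \<forall>g\<in>G. \<forall>y. dist x y < d \<longrightarrow> dist (g x) (g y) < e/2" by blast
  qed
  then obtain D where D: "\<And>x. x \<in> K \<Longrightarrow> D x > 0"
    "\<And>x g y. x \<in> K \<Longrightarrow> g \<in> G \<Longrightarrow> dist x y < D x \<Longrightarrow> dist (g x) (g y) < e/2"
    by metis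
  have "K \<subseteq> \<Union> ((\<lambda>x. ball x (D x)) ` K)" using D(1) by fastforce
  then obtain d where d: "d > 0" "\<forall>x\<in>K. \<exists>B\<in>(\<lambda>x. ball x (D x)) ` K. ball x d \<subseteq> B"
    by (rule Heine_Borel_lemma[OF K(1)]) auto
  show ?thesis
  proof (rule that[OF d(1)])
    fix g x y assume g: "g \<in> G" and x: "x \<in> K" and y: "dist x y < d"
    obtain c where c: "c \<in> K" "ball x d \<subseteq> ball c (D c)" using d(2) x by blast
    have "dist c x < D c" "dist c y < D c" using c(2) y d(1) by (auto simp: subset_iff)
    hence "dist (g c) (g x) < e/2" "dist (g c) (g y) < e/2" using D(2) c g by auto
    thus "dist (g x) (g y) < e" by (metis dist_commute dist_triangle_half_l)
  qed
qed

lemma compact_neighbourhood: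
  assumes S: "compact S" "S \<subseteq> F"
  obtains K \<rho> where "compact K" "K \<subseteq> F" "\<rho> > 0" "\<And>z y. z \<in> S \<Longrightarrow> dist z y < \<rho> \<Longrightarrow> y \<in> K"
proof -
  obtain r where r: "r > 0" "\<forall>x\<in>S. \<exists>B\<in>{F}. ball x r \<subseteq> B"
    by (rule Heine_Borel_lemma[OF S(1), of "{F}"]) (use S open_fatou in auto)
  define K where "K = closure (\<Union>z\<in>S. ball z (r/2))"
  show ?thesis
  proof (rule that[of K "r/2"])
    show "compact K" unfolding K_def by (intro compact_rsphere closed_closure)
    show "K \<subseteq> F"
    proof
      fix y assume "y \<in> K"
      then obtain u where u: "u \<in> (\<Union>z\<in>S. ball z (r/2))" "dist u y < r/2"
        unfolding K_def closure_approachable using r by (metis half_gt_zero)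
      then obtain z where z: "z \<in> S" "dist z u < r/2" by auto
      hence "dist z y < r" using u by (metis dist_commute dist_triangle_half_l)
      hence "y \<in> ball z r" by simp
      thus "y \<in> F" using r z by blast
    qed
    show "y \<in> K" if "z \<in> S" "dist z y < r/2" for z y
      unfolding K_def using that by (intro subsetD[OF closure_subset]) auto
  qed (use r in auto)
qed

text \<open>Points near which every semigroup element can be undone, up to small errors, by another one.\<close>

definition Rec :: "rsphere set" where
  "Rec = {z. \<exists>U. open U \<and> z \<in> U \<and> (\<forall>g\<in>G. \<forall>e>0. \<exists>h\<in>G. \<forall>y\<in>U. dist (h (g y)) y < e)}"

lemma open_Rec: "open Rec"
  by (rule topological_space_class.openI) (auto simp: Rec_def)

text \<open>A point of \<open>Rec\<close> near \<open>b\<close> supplies an open set on which some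
  \<open>h \<circ> g\<close> is close to the identity, and the oscillation bound lets this spread to
  a ball about \<open>b\<close>. The bound is demanded for this one \<open>g\<close> only, so the
  lemma can be used before \<open>b\<close> is known to be a Fatou point.\<close>

lemma Rec_near_id:
  assumes b: "b \<in> closure Rec" and HG: "g \<in> G"
    and r: "0 < r" "r \<le> 1/8"
    and osc: "\<And>h y y'. h \<in> G \<Longrightarrow> y \<in> ball b r \<Longrightarrow> y' \<in> ball b r \<Longrightarrow>
       dist (h (g y)) (h (g y')) < 1/8"
    and e: "e > 0"
  shows "\<exists>h\<in>G. \<forall>y\<in>ball b (r/8). dist (h (g y)) y < e"
proof -
  obtain w where w: "w \<in> Rec" "dist w b < r/4"
    using b r unfolding closure_approachable by (metis divide_pos_pos zero_less_numeral)
  obtain U where U: "open U" "w \<in> U" "\<forall>g\<in>G. \<forall>e>0. \<exists>h\<in>G. \<forall>y\<in>U. dist (h (g y)) y < e"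
    using w unfolding Rec_def by blast
  have "\<exists>h\<in>(\<lambda>h. h \<circ> g) ` G. \<forall>y\<in>ball b (r/8). dist (h y) y < e"
  proof (rule near_id_propagates[OF r _ _ _ _ _ _ e, where W = "U \<inter> ball b (r/4)"])
    show "hol h" if "h \<in> (\<lambda>h. h \<circ> g) ` G" for h using that HG by (auto intro: hol_comp G_hol)
    fix e :: real assume "e > 0"
    show "\<exists>h\<in>(\<lambda>h. h \<circ> g) ` G. \<forall>y\<in>U \<inter> ball b (r/4). dist (h y) y < e"
    proof -
      obtain h where "h \<in> G" "\<forall>y\<in>U. dist (h (g y)) y < e" using U(3) HG \<open>e > 0\<close> by blast
      thus ?thesis by auto
    qed
  next
    show "U \<inter> ball b (r/4) \<noteq> {}" using w U by (auto simp: dist_commute)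
  qed (use U osc in auto)
  thus ?thesis by auto
qed

text \<open>The empty kernel Julia set gives one \<open>g\<close> with \<open>g b\<close> in the
  Fatou set, so the family of all \<open>h \<circ> g\<close> oscillates little near
  \<open>b\<close>. Some \<open>h \<circ> g\<close> is then near the identity there and, by Brouwer,
  takes the value \<open>b\<close> at a nearby \<open>y\<close>. As \<open>g y\<close> is a Fatou
  point, so is its image \<open>b\<close>.\<close>

lemma closure_Rec_subset_fatou:
  assumes ker: "kernel_julia G = {}"
  shows "closure Rec \<subseteq> F"
proof
  fix b assume b: "b \<in> closure Rec"
  have "b \<notin> kernel_julia G" using ker by simp
  then obtain g where g: "g \<in> G" "g b \<in> F" by (auto simp: kernel_julia_def julia_def)
  obtain \<rho> where \<rho>: "\<rho> > 0" "ball (g b) \<rho> \<subseteq> F" using open_fatou g open_contains_ball by blast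
  obtain d where d: "d > 0" "\<And>h y. h \<in> G \<Longrightarrow> dist (g b) y < d \<Longrightarrow> dist (h (g b)) (h y) < 1/16"
    using fatou_equicontinuous[OF g(2), of "1/16"] by auto
  have "isCont g b" using G_cont[OF g(1), of UNIV] by (simp add: continuous_on_eq_continuous_at)
  then obtain s where s: "s > 0" "\<And>y. dist y b < s \<Longrightarrow> dist (g y) (g b) < min \<rho> d"
    unfolding continuous_at_eps_delta using \<rho> d by (metis min_less_iff_conj)
  define r where "r = min s (1/8)"
  have r: "0 < r" "r \<le> 1/8" using s by (auto simp: r_def)
  have near: "dist (g b) (g y) < min \<rho> d" if "y \<in> ball b r" for y
    using s(2)[of y] that by (simp add: r_def dist_commute)
  have "dist (h (g y)) (h (g y')) < 1/8" if "h \<in> G" "y \<in> ball b r" "y' \<in> ball b r" for h y y'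
  proof -
    have "dist (h (g b)) (h (g y)) < 1/16" "dist (h (g b)) (h (g y')) < 1/16"
      using d(2) that near by auto
    thus ?thesis using dist_triangle[of "h (g y)" "h (g y')" "h (g b)"]
      by (simp add: dist_commute)
  qed
  then obtain h where h: "h \<in> G" "\<forall>y\<in>ball b (r/8). dist (h (g y)) y < (r/8)/16"
    using Rec_near_id[OF b g(1) r, of "(r/8)/16"] r by auto
  have "continuous_on UNIV (h \<circ> g)" using G_cont G_comp h g by blast
  then obtain y where y: "y \<in> ball b (r/8)" "(h \<circ> g) y = b"
    using near_id_covers[of "h \<circ> g" "r/8" b] h r by auto
  have "g y \<in> F" using near[of y] y r \<rho> by auto
  hence "h (g y) \<in> F" by (rule fatou_forward[OF h(1)])
  thus "b \<in> F" using y by simp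
qed

text \<open>Since \<open>b\<close> is already a Fatou point, the whole semigroup is equicontinuous
  at \<open>b\<close>, and \<open>Rec_near_id\<close> applies to every \<open>g\<close> with one
  radius.\<close>

lemma closed_Rec:
  assumes ker: "kernel_julia G = {}"
  shows "closed Rec"
proof -
  have "b \<in> Rec" if b: "b \<in> closure Rec" for b
  proof -
    have "b \<in> F" using closure_Rec_subset_fatou[OF ker] b by blast
    then obtain d where d: "d > 0" "\<And>h y. h \<in> G \<Longrightarrow> dist b y < d \<Longrightarrow> dist (h b) (h y) < 1/16"
      using fatou_equicontinuous[of b "1/16"] by auto
    define r where "r = min d (1/8)"
    have r: "0 < r" "r \<le> 1/8" using d by (auto simp: r_def)
    have osc: "dist (h y) (h y') < 1/8" if "h \<in> G" "y \<in> ball b r" "y' \<in> ball b r" for h y y'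
    proof -
      have "dist (h b) (h y) < 1/16" "dist (h b) (h y') < 1/16"
        using d(2) that by (auto simp: r_def)
      thus ?thesis using dist_triangle[of "h y" "h y'" "h b"]
        by (simp add: dist_commute)
    qed
    have "\<exists>h\<in>G. \<forall>y\<in>ball b (r/8). dist (h (g y)) y < e" if "g \<in> G" "e > 0" for g e
      by (rule Rec_near_id[OF b that(1) r _ that(2)])
        (use osc[of "_ \<circ> g"] G_comp that(1) in force)
    thus ?thesis unfolding Rec_def using r by (intro CollectI exI[of _ "ball b (r/8)"]) auto
  qed
  thus ?thesis by (metis closure_subset closure_closed subset_antisym subsetI closed_closure)
qed

lemma Rec_empty:
  assumes ker: "kernel_julia G = {}" and J: "julia G \<noteq> {}"
  shows "Rec = {}"
proof (rule ccontr)
  assume "Rec \<noteq> {}"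
  moreover have "Rec = {} \<or> Rec = UNIV"
    using connected_UNIV_rsphere open_Rec closed_Rec[OF ker]
    unfolding connected_clopen by (metis closed_closedin open_openin subtopology_UNIV)
  ultimately have "Rec = UNIV" by blast
  hence "F = UNIV" using closure_Rec_subset_fatou[OF ker] by auto
  thus False using J by (auto simp: julia_def)
qed

text \<open>An element of a minimal left ideal of the enveloping semigroup of \<open>G\<close>.\<close>

lemma minimal_left_ideal_element:
  obtains e :: "rsphere \<Rightarrow> rsphere" where
    "\<And>S \<epsilon>. finite S \<Longrightarrow> \<epsilon> > 0 \<Longrightarrow> \<exists>h\<in>G. \<forall>x\<in>S. dist (h x) (e x) < \<epsilon>"
    "\<And>g S \<epsilon>. g \<in> G \<Longrightarrow> finite S \<Longrightarrow> \<epsilon> > 0 \<Longrightarrow> \<exists>h\<in>G. \<forall>x\<in>S. dist (h (g (e x))) (e x) < \<epsilon>"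
proof -
  have near: "\<exists>f\<in>A. \<forall>x\<in>S. dist (f x) (e x) < \<epsilon>"
    if e: "e \<in> closure A" and S: "finite S" and \<epsilon>: "\<epsilon> > 0"
    for A :: "(rsphere \<Rightarrow> rsphere) set" and e S \<epsilon>
  proof -
    define V where "V = (\<Inter>x\<in>S. (\<lambda>f. f x) -` ball (e x) \<epsilon>)"
    have "open V" unfolding V_def using S
      by (intro open_INT ballI) (auto intro!: open_vimage continuous_on_product_coordinates)
    moreover have "e \<in> V" using \<epsilon> by (simp add: V_def)
    ultimately have "A \<inter> V \<noteq> {}" using e by (metis closure_iff_nhds_not_empty open_subset order_refl)
    then obtain f where "f \<in> A" "f \<in> V" by blast
    thus ?thesis by (auto simp: V_def dist_commute intro!: bexI[of _ f])
  qed
  \<comment> \<open>Composition on the left is continuous for pointwise convergence because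
    \<open>g\<close> is continuous; this keeps closures invariant.\<close>
  have contL: "continuous_on T (\<lambda>f. g \<circ> f)" if "g \<in> G" for g and T :: "(rsphere \<Rightarrow> rsphere) set"
  proof (rule continuous_on_coordinatewise_then_product)
    fix x
    have "continuous_on T (\<lambda>f. f x)"
      by (rule continuous_on_subset[OF continuous_on_product_coordinates]) simp
    thus "continuous_on T (\<lambda>f. (g \<circ> f) x)"
      unfolding o_def by (rule continuous_on_compose2[OF G_cont[OF that, of UNIV]]) simp
  qed
  define L :: "((rsphere \<Rightarrow> rsphere) \<Rightarrow> (rsphere \<Rightarrow> rsphere)) set"
    where "L = (\<lambda>g f. g \<circ> f) ` G"
  have clG: "compact (closure G)" "closed (closure G)" "closure G \<noteq> {}"
    using G_ne compact_Int_closed[OF compact_UNIV_rsphere_fun closed_closure, of G] by simp_all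
  have Linv: "f ` closure G \<subseteq> closure G" if "f \<in> L" for f
  proof -
    obtain g where g: "g \<in> G" "f = (\<lambda>h. g \<circ> h)" using \<open>f \<in> L\<close> by (auto simp: L_def)
    show ?thesis unfolding g(2)
      by (rule image_closure_subset[OF contL[OF g(1)] closed_closure])
        (use G_comp g(1) closure_subset in blast)
  qed
  obtain I where I: "I \<noteq> {}" "closed I" "I \<subseteq> closure G" "\<And>f. f \<in> L \<Longrightarrow> f ` I \<subseteq> I"
    "\<And>J. J \<noteq> {} \<Longrightarrow> closed J \<Longrightarrow> J \<subseteq> I \<Longrightarrow> (\<And>f. f \<in> L \<Longrightarrow> f ` J \<subseteq> J) \<Longrightarrow> J = I"
    using minimal_invariant_set[OF clG Linv] by metis
  obtain e where e: "e \<in> I" using I(1) by blast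
  have LI: "g \<circ> f \<in> I" if "g \<in> G" "f \<in> I" for g f
    using I(4)[of "\<lambda>f. g \<circ> f"] that by (auto simp: L_def)
  have e2: "e \<in> closure ((\<lambda>h. h \<circ> g \<circ> e) ` G)" if g: "g \<in> G" for g
  proof -
    \<comment> \<open>By minimality the closed left ideal generated by \<open>g \<circ> e\<close> is
      all of \<open>I\<close>; that it contains \<open>e\<close> is the second property.\<close>
    define J where "J = closure ((\<lambda>h. h \<circ> g \<circ> e) ` G)"
    have "J = I"
    proof (rule I(5))
      show "J \<noteq> {}" using G_ne by (simp add: J_def)
      show "closed J" by (simp add: J_def)
      show "J \<subseteq> I" unfolding J_def
        by (rule closure_minimal) (use I(2) LI g e in \<open>auto simp: comp_assoc\<close>)
      show "f ` J \<subseteq> J" if "f \<in> L" for f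
      proof -
        obtain k where k: "k \<in> G" "f = (\<lambda>h. k \<circ> h)" using \<open>f \<in> L\<close> by (auto simp: L_def)
        have "(\<lambda>h. k \<circ> h) ` (\<lambda>h. h \<circ> g \<circ> e) ` G \<subseteq> (\<lambda>h. h \<circ> g \<circ> e) ` G"
        proof clarify
          fix h assume h: "h \<in> G"
          have "k \<circ> (h \<circ> g \<circ> e) = (k \<circ> h) \<circ> g \<circ> e" by (simp add: comp_assoc)
          thus "k \<circ> (h \<circ> g \<circ> e) \<in> (\<lambda>h. h \<circ> g \<circ> e) ` G" using G_comp[OF k(1) h] by blast
        qed
        thus ?thesis unfolding k(2) J_def
          by (intro image_closure_subset[OF contL[OF k(1)] closed_closure])
            (use closure_subset in blast)
      qed
    qed
    thus ?thesis using e by (simp add: J_def)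
  qed
  show ?thesis
  proof (rule that[of e])
    show "\<exists>h\<in>G. \<forall>x\<in>S. dist (h x) (e x) < \<epsilon>" if "finite S" "\<epsilon> > 0" for S \<epsilon>
      using near[OF _ that, of e G] I(3) e by blast
    show "\<exists>h\<in>G. \<forall>x\<in>S. dist (h (g (e x))) (e x) < \<epsilon>" if "g \<in> G" "finite S" "\<epsilon> > 0" for g S \<epsilon>
      using near[OF e2[OF that(1)] that(2,3)] by auto
  qed
qed

end

lemma dist_triangle4: "dist (a :: 'a :: metric_space) d \<le> dist a b + dist b c + dist c d"
  using dist_triangle[of a d b] dist_triangle[of b d c] by linarith

context hol_semigroup
begin

text \<open>Without recurrent points, an element of a minimal left ideal is locally constant near an
  invariant compact subset of the Fatou set: otherwise its image there would contain an open set
  of points of \<^term>\<open>Rec\<close>.\<close>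

lemma contraction:
  assumes S: "compact S" "S \<subseteq> F" and inv: "\<And>g. g \<in> G \<Longrightarrow> g ` S \<subseteq> S" and R: "Rec = {}"
  obtains \<rho> where "\<rho> > 0"
    "\<And>\<eta>. \<eta> > 0 \<Longrightarrow> \<exists>g\<in>G. \<forall>z\<in>S. \<forall>y. dist z y < \<rho> \<longrightarrow> dist (g z) (g y) < \<eta>"
proof -
  obtain K \<rho>1 where K: "compact K" "K \<subseteq> F" "\<rho>1 > 0" "\<And>z y. z \<in> S \<Longrightarrow> dist z y < \<rho>1 \<Longrightarrow> y \<in> K"
    using compact_neighbourhood[OF S] by metis
  \<comment> \<open>With this oscillation the values of \<open>e\<close> near \<open>e z\<close>
    stay inside one chart and, since \<open>e z\<close> is in \<open>S\<close>, also inside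
    \<open>K\<close>.\<close>
  define \<epsilon>1 where "\<epsilon>1 = min \<rho>1 (1/8) / 2"
  have \<epsilon>1: "\<epsilon>1 > 0" "\<epsilon>1 < \<rho>1" "\<epsilon>1 \<le> 1/16" using K(3) by (auto simp: \<epsilon>1_def)
  obtain d where d: "d > 0" "\<And>g x y. g \<in> G \<Longrightarrow> x \<in> K \<Longrightarrow> dist x y < d \<Longrightarrow> dist (g x) (g y) < \<epsilon>1"
    using unif_equicontinuous[OF K(1,2) \<epsilon>1(1)] by metis
  obtain e where e1: "\<And>S \<epsilon>. finite S \<Longrightarrow> \<epsilon> > 0 \<Longrightarrow> \<exists>h\<in>G. \<forall>x\<in>S. dist (h x) (e x) < \<epsilon>"
    and e2: "\<And>g S \<epsilon>. g \<in> G \<Longrightarrow> finite S \<Longrightarrow> \<epsilon> > 0 \<Longrightarrow> \<exists>h\<in>G. \<forall>x\<in>S. dist (h (g (e x))) (e x) < \<epsilon>"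
    by (rule minimal_left_ideal_element) metis
  \<comment> \<open>Although \<open>e\<close> is only a pointwise limit, it inherits each bound that
    holds for all elements of the semigroup, in particular their modulus of continuity on
    \<open>K\<close>.\<close>
  have e_dist: "dist (e x) (e y) \<le> c" if "\<And>g. g \<in> G \<Longrightarrow> dist (g x) (g y) \<le> c" for x y c
  proof (rule field_le_epsilon)
    fix \<epsilon> :: real assume "\<epsilon> > 0"
    then obtain h where h: "h \<in> G" "dist (h x) (e x) < \<epsilon>/2" "dist (h y) (e y) < \<epsilon>/2"
      using e1[of "{x, y}" "\<epsilon>/2"] by auto
    have "dist (e x) (e y) \<le> dist (h x) (e x) + dist (h x) (h y) + dist (h y) (e y)"
      using dist_triangle4[of "e x" "e y" "h x" "h y"] by (simp add: dist_commute)
    thus "dist (e x) (e y) \<le> c + \<epsilon>" using that[OF h(1)] h by linarith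
  qed
  have eS: "e z \<in> S" if z: "z \<in> S" for z
  proof -
    have "\<exists>y\<in>S. dist y (e z) < \<epsilon>" if "\<epsilon> > 0" for \<epsilon>
      using e1[of "{z}" \<epsilon>] that inv z by blast
    thus ?thesis using compact_imp_closed[OF S(1)] closed_approachable by metis
  qed
  have eU: "\<exists>h\<in>G. \<forall>y\<in>K. dist (h y) (e y) < \<epsilon>" if \<epsilon>: "\<epsilon> > 0" for \<epsilon>
  proof -
    obtain d' where d': "d' > 0" "\<And>g x y. g \<in> G \<Longrightarrow> x \<in> K \<Longrightarrow> dist x y < d' \<Longrightarrow> dist (g x) (g y) < \<epsilon>/4"
      using unif_equicontinuous[OF K(1,2), of "\<epsilon>/4"] \<epsilon> by auto
    obtain T where T: "finite T" "T \<subseteq> K" "\<And>x. x \<in> K \<Longrightarrow> \<exists>s\<in>T. dist s x < d'"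
      using rsphere_net[OF d'(1), of K] by metis
    obtain h where h: "h \<in> G" "\<forall>x\<in>T. dist (h x) (e x) < \<epsilon>/4" using e1[OF T(1), of "\<epsilon>/4"] \<epsilon> by auto
    have "dist (h y) (e y) < \<epsilon>" if y: "y \<in> K" for y
    proof -
      obtain s where s: "s \<in> T" "dist s y < d'" using T(3)[OF y] by blast
      have sK: "s \<in> K" using s T by blast
      have "dist (e s) (e y) \<le> \<epsilon>/4" using d'(2)[OF _ sK s(2)] by (intro e_dist) (simp add: less_imp_le)
      moreover have "dist (h s) (h y) < \<epsilon>/4" using d'(2)[OF h(1) sK s(2)] .
      moreover have "dist (h s) (e s) < \<epsilon>/4" using h(2) s by blast
      moreover have "dist (h y) (e y) \<le> dist (h s) (h y) + dist (h s) (e s) + dist (e s) (e y)"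
        using dist_triangle4[of "h y" "e y" "h s" "e s"] by (simp add: dist_commute)
      ultimately show ?thesis using \<epsilon> by linarith
    qed
    thus ?thesis using h(1) by blast
  qed
  define r where "r = min d (min \<rho>1 (1/8))"
  have r: "r > 0" "r \<le> d" "r \<le> \<rho>1" "r \<le> 1/8" using d K(3) by (auto simp: r_def)
  have const: "e y = e z" if z: "z \<in> S" and y: "dist z y < r/4" for z y
  proof -
    obtain b z0 where b: "b \<in> charts" "b z = pt z0" "cmod z0 \<le> 1" by (rule chart_exists)
    obtain a w0 where a: "a \<in> charts" "a (e z) = pt w0" "cmod w0 \<le> 1" by (rule chart_exists)
    define D where "D = ball z0 (r/2)"
    have zK: "z \<in> K" using K(4)[OF z, of z] K(3) by simp
    have Dz: "dist z (b (pt u)) < r" if "u \<in> D" for u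
      using chart_disc(1)[OF b, of u "r/2"] that by (auto simp: D_def dist_norm norm_minus_commute)
    have DK: "b (pt u) \<in> K" if "u \<in> D" for u
      using K(4)[OF z] Dz[OF that] r by simp
    have De: "dist (e z) (e (b (pt u))) \<le> \<epsilon>1" if "u \<in> D" for u
      using d(2)[OF _ zK, of _ "b (pt u)"] Dz[OF that] r by (intro e_dist) (simp add: less_imp_le)
    define E where "E = (\<lambda>u. stereo (a (e (b (pt u)))))"
    have E: "a (e (b (pt u))) = pt (E u)" "cmod (E u) \<le> 2" if "u \<in> D" for u
    proof -
      have "dist (e z) (e (b (pt u))) < 1/4" using De[OF that] \<epsilon>1 by linarith
      hence "dist (pt w0) (a (e (b (pt u)))) < 1/4" using a by (metis chart_dist)
      from near_lower[OF a(3) this] show "a (e (b (pt u))) = pt (E u)" "cmod (E u) \<le> 2"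
        by (simp_all add: E_def pt_stereo)
    qed
    have "\<forall>n. \<exists>h\<in>G. \<forall>y\<in>K. dist (h y) (e y) < min (1/16) (inverse (real (Suc n)))"
      by (intro allI eU) simp
    then obtain h where h: "\<And>n. h n \<in> G"
      "\<And>n y. y \<in> K \<Longrightarrow> dist (h n y) (e y) < min (1/16) (inverse (real (Suc n)))" by metis
    define H where "H = (\<lambda>n u. stereo (a (h n (b (pt u)))))"
    have H: "a (h n (b (pt u))) \<noteq> infty" "a (h n (b (pt u))) = pt (H n u)" "cmod (H n u) \<le> 2"
      if u: "u \<in> D" for n u
    proof -
      have "dist (e z) (h n (b (pt u))) \<le> dist (e z) (e (b (pt u))) + dist (e (b (pt u))) (h n (b (pt u)))"
        by (rule dist_triangle)
      also have "\<dots> < 1/4" using De[OF u] h(2)[OF DK[OF u], of n] \<epsilon>1 by (simp add: dist_commute)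
      finally have "dist (pt w0) (a (h n (b (pt u)))) < 1/4" using a by (metis chart_dist)
      from near_lower[OF a(3) this]
      show "a (h n (b (pt u))) \<noteq> infty" "a (h n (b (pt u))) = pt (H n u)" "cmod (H n u) \<le> 2"
        by (simp_all add: H_def pt_stereo)
    qed
    have holH: "H n holomorphic_on D" for n
      unfolding H_def by (intro hol_chart_holomorphic G_hol h a b H(1))
    have "uniform_limit D H E sequentially"
      unfolding uniform_limit_iff eventually_sequentially
    proof (intro allI impI)
      fix s :: real assume "s > 0"
      then obtain N where N: "inverse (real (Suc N)) < s / 3"
        using reals_Archimedean[of "s/3"] by auto
      have "dist (H n u) (E u) < s" if "n \<ge> N" "u \<in> D" for n u
      proof -
        have "dist (H n u) (E u) \<le> 3 * dist (pt (H n u)) (pt (E u))"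
          unfolding dist_norm using dist_pt_ge2 H(3) E(2) that by blast
        also have "dist (pt (H n u)) (pt (E u)) = dist (h n (b (pt u))) (e (b (pt u)))"
          using H(2)[OF that(2)] E(1)[OF that(2)] a(1) by (metis chart_dist)
        also have "3 * \<dots> < 3 * inverse (real (Suc n))" using h(2)[OF DK[OF that(2)], of n] by simp
        also have "\<dots> \<le> 3 * inverse (real (Suc N))"
          using that by (intro mult_left_mono le_imp_inverse_le) auto
        finally show ?thesis using N by simp
      qed
      thus "\<exists>N. \<forall>n\<ge>N. \<forall>x\<in>D. dist (H n x) (E x) < s" by blast
    qed
    hence holE: "E holomorphic_on D"
    proof (intro holomorphic_uniform_sequence[OF _ holH])
      fix u assume u: "u \<in> D"
      then obtain s where "s > 0" "cball u s \<subseteq> D"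
        unfolding D_def using open_contains_cball open_ball by blast
      thus "\<exists>s>0. cball u s \<subseteq> D \<and> uniform_limit (cball u s) H E sequentially" if "uniform_limit D H E sequentially"
        using uniform_limit_on_subset[OF that] by blast
    qed (simp add: D_def)
    have "E constant_on D"
    proof (rule ccontr)
      assume nc: "\<not> E constant_on D"
      have "open (E ` D)" by (rule open_mapping_thm[OF holE _ _ _ _ nc]) (auto simp: D_def)
      hence oU: "open (a ` pt ` E ` D)" using a by (intro open_chart_image open_pt_image)
      define U where "U = a ` pt ` E ` D"
      have Ue: "\<exists>u\<in>D. y = e (b (pt u))" if "y \<in> U" for y
        using that E(1) a(1) unfolding U_def by (metis chart_invol imageE)
      have UK: "U \<subseteq> K"
      proof
        fix y assume "y \<in> U"
        then obtain u where u: "u \<in> D" "y = e (b (pt u))" using Ue by blast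
        show "y \<in> K" using K(4)[OF eS[OF z], of y] De[OF u(1)] \<epsilon>1 u by simp
      qed
      \<comment> \<open>Every point of \<open>U\<close> is a value of \<open>e\<close>. Choosing
        preimages of a finite net of \<open>U\<close> reduces the uniform return to the return
        property of \<open>e\<close> at finitely many points.\<close>
      have "\<exists>h\<in>G. \<forall>y\<in>U. dist (h (g y)) y < \<epsilon>" if g: "g \<in> G" and \<epsilon>: "\<epsilon> > 0" for g \<epsilon>
      proof -
        obtain d' where d': "d' > 0" "\<And>g x y. g \<in> G \<Longrightarrow> x \<in> K \<Longrightarrow> dist x y < d' \<Longrightarrow> dist (g x) (g y) < \<epsilon>/3"
          using unif_equicontinuous[OF K(1,2), of "\<epsilon>/3"] \<epsilon> by auto
        obtain T where T: "finite T" "T \<subseteq> U" "\<And>x. x \<in> U \<Longrightarrow> \<exists>s\<in>T. dist s x < min d' (\<epsilon>/3)"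
          using rsphere_net[of "min d' (\<epsilon>/3)" U] d'(1) \<epsilon> by auto
        have "\<forall>y\<in>T. \<exists>x. y = e x" using T(2) Ue by blast
        then obtain c where c: "\<And>y. y \<in> T \<Longrightarrow> e (c y) = y" by metis
        obtain h where h: "h \<in> G" "\<forall>x\<in>c ` T. dist (h (g (e x))) (e x) < \<epsilon>/3"
          using e2[OF g, of "c ` T" "\<epsilon>/3"] T(1) \<epsilon> by auto
        have "dist (h (g y)) y < \<epsilon>" if y: "y \<in> U" for y
        proof -
          obtain s where s: "s \<in> T" "dist s y < min d' (\<epsilon>/3)" using T(3)[OF y] by blast
          have "dist ((h \<circ> g) s) ((h \<circ> g) y) < \<epsilon>/3"
            using d'(2)[OF G_comp[OF h(1) g], of s y] s T(2) UK by auto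
          moreover have "dist (h (g s)) s < \<epsilon>/3" using h(2) s(1) c by force
          moreover have "dist (h (g y)) y \<le> dist (h (g s)) (h (g y)) + dist (h (g s)) s + dist s y"
            using dist_triangle4[of "h (g y)" y "h (g s)" s] by (simp add: dist_commute)
          ultimately show ?thesis using s by simp
        qed
        thus ?thesis using h(1) by blast
      qed
      hence "U \<subseteq> Rec" using oU unfolding Rec_def U_def[symmetric] by blast
      moreover have "z0 \<in> D" using r by (simp add: D_def)
      ultimately show False using R by (auto simp: U_def)
    qed
    then obtain c where c: "\<And>u. u \<in> D \<Longrightarrow> E u = c" by (auto simp: constant_on_def)
    have ey: "e y = a (pt c)" if "dist z y < r/4" for y
    proof -
      define u where "u = stereo (b y)"
      have u: "b y = pt u" "u \<in> D"
        using chart_disc(2)[OF b, of y "r/4"] that r by (auto simp: u_def D_def dist_norm norm_minus_commute)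
      have "y = b (pt u)" using u b by (metis chart_invol)
      thus ?thesis using E(1)[OF u(2)] c[OF u(2)] a(1) by (metis chart_invol)
    qed
    show ?thesis using ey[OF y] ey[of z] r by simp
  qed
  show ?thesis
  proof (rule that[of "r/4"])
    show "r/4 > 0" using r by simp
    fix \<eta> :: real assume \<eta>: "\<eta> > 0"
    obtain h where h: "h \<in> G" "\<forall>y\<in>K. dist (h y) (e y) < \<eta>/2" using eU[of "\<eta>/2"] \<eta> by auto
    have "dist (h z) (h y) < \<eta>" if z: "z \<in> S" "dist z y < r/4" for z y
    proof -
      have "z \<in> K" "y \<in> K" using K(4)[OF z(1)] z r K(3) by auto
      hence "dist (h z) (e z) < \<eta>/2" "dist (h y) (e y) < \<eta>/2" using h by auto
      thus ?thesis using const[OF z] by (metis dist_triangle_half_l dist_commute)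
    qed
    thus "\<exists>g\<in>G. \<forall>z\<in>S. \<forall>y. dist z y < r/4 \<longrightarrow> dist (g z) (g y) < \<eta>" using h(1) by blast
  qed
qed

end

section \<open>Words and the adapted pseudometric\<close>

context hol_semigroup
begin

text \<open>The new letter is applied first, as in the iterates of \<open>Mop\<close>, whose
  outermost average is over the first map. Unlike the elements of \<open>gen_semigroup\<close>,
  words carry a length, and length 0 gives the identity.\<close>

primrec words :: "nat \<Rightarrow> (rsphere \<Rightarrow> rsphere) set" where
  "words 0 = {id}"
| "words (Suc n) = {v \<circ> g | v g. v \<in> words n \<and> g \<in> \<Gamma>}"

declare words.simps(2) [simp del]

lemma words_SucI: "v \<in> words n \<Longrightarrow> g \<in> \<Gamma> \<Longrightarrow> v \<circ> g \<in> words (Suc n)"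
  by (auto simp: words.simps)

lemma words_SucE:
  assumes "w \<in> words (Suc n)"
  obtains v g where "w = v \<circ> g" "v \<in> words n" "g \<in> \<Gamma>"
  using assms by (auto simp: words.simps)

lemma words_add: "v \<in> words n \<Longrightarrow> u \<in> words m \<Longrightarrow> u \<circ> v \<in> words (m + n)"
proof (induction n arbitrary: v)
  case (Suc n)
  then obtain v' g where v: "v = v' \<circ> g" "v' \<in> words n" "g \<in> \<Gamma>" by (auto elim: words_SucE)
  have "(u \<circ> v') \<circ> g \<in> words (Suc (m + n))"
    by (rule words_SucI[OF Suc.IH[OF v(2) Suc.prems(2)] v(3)])
  thus ?case by (simp only: v(1) comp_assoc add_Suc_right)
qed simp

lemma words_split:
  assumes "w \<in> words (m + n)"
  obtains u v where "u \<in> words m" "v \<in> words n" "w = u \<circ> v"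
  using assms
proof (induction n arbitrary: w thesis)
  case 0
  thus ?case by (metis add_0_right comp_id insertI1 words.simps(1))
next
  case (Suc n)
  from Suc.prems(2) obtain w' g where w: "w = w' \<circ> g" "w' \<in> words (m + n)" "g \<in> \<Gamma>"
    by (auto elim: words_SucE)
  obtain u v where uv: "u \<in> words m" "v \<in> words n" "w' = u \<circ> v" using Suc.IH[OF _ w(2)] by blast
  show ?case
    by (rule Suc.prems(1)[OF uv(1) words_SucI[OF uv(2) w(3)]]) (simp add: w uv comp_assoc)
qed

lemma words_1: "g \<in> \<Gamma> \<Longrightarrow> g \<in> words 1"
  using words_SucI[of id 0 g] by simp

lemma G_imp_words:
  assumes "g \<in> G"
  obtains n where "g \<in> words (Suc n)"
  using assms
proof (induction arbitrary: thesis rule: gen_semigroup.induct)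
  case (base g)
  thus ?case using words_SucI[of id 0 g] by fastforce
next
  case (comp g h)
  then obtain n where n: "g \<in> words (Suc n)" by blast
  have "h \<circ> g \<in> words (1 + Suc n)" by (rule words_add[OF n words_1[OF comp.hyps(2)]])
  hence "h \<circ> g \<in> words (Suc (Suc n))" unfolding plus_1_eq_Suc .
  thus ?case by (rule comp.prems)
qed

lemma words_imp_G: "w \<in> words n \<Longrightarrow> n > 0 \<Longrightarrow> w \<in> G"
proof (induction n arbitrary: w)
  case (Suc n)
  then obtain v g where v: "w = v \<circ> g" "v \<in> words n" "g \<in> \<Gamma>" by (auto elim: words_SucE)
  show ?case
  proof (cases "n = 0")
    case True
    thus ?thesis using v gen_semigroup.base by auto
  next
    case False
    thus ?thesis unfolding v(1) using v Suc.IH G_comp gen_semigroup.base by blast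
  qed
qed simp

lemma words_cases: "w \<in> words n \<Longrightarrow> w = id \<or> w \<in> G"
  using words_imp_G by (cases n) auto

lemma words_ne: "words n \<noteq> {}"
proof (induction n)
  case (Suc n)
  thus ?case using \<Gamma>_ne words_SucI by fastforce
qed simp

lemma hol_id: "hol id"
  unfolding hol_def
proof (intro conjI ballI allI impI)
  fix a b z assume ab: "a \<in> charts" "b \<in> charts" and nz: "a (id (b (pt z))) \<noteq> infty"
  show "(\<lambda>z. stereo (a (id (b (pt z))))) field_differentiable at z"
  proof (cases "a = b")
    case True
    thus ?thesis using ab by simp
  next
    case False
    have ee: "a (id (b (pt z))) = hpt 1 z" for z
      using False ab flip_hpt[of z 1] by (auto simp: charts_def hpt_def)
    from nz have "hpt 1 z \<noteq> infty" unfolding ee .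
    hence "z \<noteq> 0" by (auto simp: hpt_def)
    thus ?thesis unfolding ee
      by (intro poly_quotient_differentiable[of "[:0, 1:]" _ _ 1]) (auto simp: hpt_def)
  qed
qed (simp add: id_def)

lemma words_hol: "w \<in> words n \<Longrightarrow> hol w"
  using words_cases hol_id G_hol by blast

lemma words_cont: "w \<in> words n \<Longrightarrow> continuous_on A w"
  using words_hol hol_cont continuous_on_subset by blast

lemma words_inv:
  assumes "w \<in> words n" "x \<in> L" "\<And>g. g \<in> G \<Longrightarrow> g ` L \<subseteq> L"
  shows "w x \<in> L"
  using words_cases[OF assms(1)] assms(2,3) by auto

text \<open>The supremum makes every word non-expanding (\<open>ds_mono\<close>). Near compact
  invariant parts of the Fatou set the new distance is comparable with \<open>dist\<close>, so
  nothing is lost where contraction takes place.\<close>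

definition ds :: "rsphere \<Rightarrow> rsphere \<Rightarrow> real" where
  "ds x y = (SUP w\<in>(\<Union>n. words n). dist (w x) (w y))"

lemma ds_bdd: "bdd_above ((\<lambda>w. dist (w x) (w y :: rsphere)) ` A)"
  using dist_rsphere_le_2 by (intro bdd_aboveI2[of _ _ 2])

lemma ds_least: "(\<And>n w. w \<in> words n \<Longrightarrow> dist (w x) (w y) \<le> c) \<Longrightarrow> ds x y \<le> c"
  unfolding ds_def using words_ne by (intro cSUP_least) auto

lemma ds_upper: "w \<in> words n \<Longrightarrow> dist (w x) (w y) \<le> ds x y"
  unfolding ds_def by (intro cSUP_upper ds_bdd) auto

lemma dist_le_ds: "dist x y \<le> ds x y"
  using ds_upper[of id 0] by simp

lemma ds_nonneg [simp]: "0 \<le> ds x y"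
  using dist_le_ds zero_le_dist order_trans by blast

lemma ds_self [simp]: "ds x x = 0"
  using ds_least[of x x 0] ds_nonneg[of x x] by simp

lemma ds_sym: "ds x y = ds y x"
  unfolding ds_def by (simp add: dist_commute)

lemma ds_triangle: "ds x z \<le> ds x y + ds y z"
proof (rule ds_least)
  fix n w assume "w \<in> words n"
  from ds_upper[OF this, of x y] ds_upper[OF this, of y z] dist_triangle[of "w x" "w z" "w y"]
  show "dist (w x) (w z) \<le> ds x y + ds y z" by linarith
qed

lemma ds_mono: "w \<in> words n \<Longrightarrow> ds (w x) (w y) \<le> ds x y"
proof (rule ds_least)
  fix m u assume "w \<in> words n" "u \<in> words m"
  from ds_upper[OF words_add[OF this], of x y] show "dist (u (w x)) (u (w y)) \<le> ds x y" by simp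
qed

lemma ds_small:
  assumes "compact K" "K \<subseteq> F" "e > 0"
  obtains d where "d > 0" "\<And>x y. x \<in> K \<Longrightarrow> dist x y < d \<Longrightarrow> ds x y < e"
proof -
  obtain d where d: "d > 0" "\<And>g x y. g \<in> G \<Longrightarrow> x \<in> K \<Longrightarrow> dist x y < d \<Longrightarrow> dist (g x) (g y) < e/2"
    using unif_equicontinuous[OF assms(1,2), of "e/2"] assms(3) by auto
  show ?thesis
  proof (rule that[of "min d (e/2)"])
    fix x y assume x: "x \<in> K" "dist x y < min d (e/2)"
    have "ds x y \<le> e/2"
    proof (rule ds_least)
      fix n w assume "w \<in> words n"
      from words_cases[OF this] show "dist (w x) (w y) \<le> e/2" using d x by (auto intro: less_imp_le)
    qed
    thus "ds x y < e" using assms(3) by simp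
  qed (use d assms in auto)
qed

text \<open>Equicontinuity bounds the oscillation of all words on a ball of fixed radius by 1/8;
  Cauchy's estimate turns this into a common Lipschitz constant on a smaller ball.\<close>

lemma equi_Lipschitz:
  assumes S: "compact S" "S \<subseteq> F"
  obtains \<delta> C where "\<delta> > 0" "C \<ge> 1"
    "\<And>z y y'. z \<in> S \<Longrightarrow> y \<in> ball z \<delta> \<Longrightarrow> y' \<in> ball z \<delta> \<Longrightarrow> ds y y' \<le> C * dist y y'"
proof -
  obtain d where d: "d > 0" "\<And>x y. x \<in> S \<Longrightarrow> dist x y < d \<Longrightarrow> ds x y < 1/8"
    using ds_small[OF S, of "1/8"] by auto
  define r where "r = min d (1/4)"
  have r: "r > 0" "r \<le> 1/4" using d by (auto simp: r_def)
  define C where "C = max 1 (100 * (1/8) / r)"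
  show ?thesis
  proof (rule that[of "r/8" C])
    fix z y y' assume z: "z \<in> S" and y: "y \<in> ball z (r/8)" "y' \<in> ball z (r/8)"
    show "ds y y' \<le> C * dist y y'"
    proof (rule ds_least)
      fix n w assume w: "w \<in> words n"
      have "dist (w y) (w y') \<le> 100 * (1/8) / r * dist y y'"
      proof (rule hol_Schwarz[OF words_hol[OF w] r _ _ y])
        fix u assume "u \<in> ball z r"
        hence "ds z u < 1/8" using d(2)[OF z, of u] by (simp add: r_def)
        thus "dist (w z) (w u) \<le> 1/8" using ds_upper[OF w, of z u] by linarith
      qed simp
      also have "\<dots> \<le> C * dist y y'" by (intro mult_right_mono) (auto simp: C_def)
      finally show "dist (w y) (w y') \<le> C * dist y y'" .
    qed
  qed (use r in \<open>auto simp: C_def\<close>)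
qed

text \<open>Since a single word may have probability 0, its contraction must survive perturbation.
  It does so because a small oscillation is stable under uniform perturbation, and for a holomorphic
  map it forces a small Lipschitz constant.\<close>

lemma robust_contraction:
  assumes S: "compact S" "S \<subseteq> F" and inv: "\<And>g. g \<in> G \<Longrightarrow> g ` S \<subseteq> S" and R: "Rec = {}"
  obtains \<delta> where "\<delta> > 0"
    "\<And>\<eta>. \<eta> > 0 \<Longrightarrow> \<exists>n v \<epsilon>. v \<in> words (Suc n) \<and> \<epsilon> > 0 \<and>
       (\<forall>v'. hol v' \<longrightarrow> (\<forall>x. dist (v x) (v' x) < \<epsilon>) \<longrightarrow>
         (\<forall>z\<in>S. \<forall>y\<in>ball z \<delta>. \<forall>y'\<in>ball z \<delta>. dist (v' y) (v' y') \<le> \<eta> * dist y y'))"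
proof -
  obtain \<rho> where \<rho>: "\<rho> > 0"
    "\<And>\<eta>. \<eta> > 0 \<Longrightarrow> \<exists>g\<in>G. \<forall>z\<in>S. \<forall>y. dist z y < \<rho> \<longrightarrow> dist (g z) (g y) < \<eta>"
    using contraction[OF assms] by metis
  define r where "r = min \<rho> (1/4)"
  have r: "r > 0" "r \<le> 1/4" using \<rho> by (auto simp: r_def)
  show ?thesis
  proof (rule that[of "r/8"])
    fix \<eta> :: real assume \<eta>: "\<eta> > 0"
    \<comment> \<open>A perturbed word oscillates by at most \<open>3 * \<epsilon>\<close>: one
      \<epsilon> from \<open>v\<close> and one from the perturbation at each of the two points.
      \<open>hol_Schwarz\<close> then multiplies by 100/r.\<close>
    define \<epsilon> where "\<epsilon> = min (1/16) (\<eta> * r / 300)"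
    have \<epsilon>: "\<epsilon> > 0" "3 * \<epsilon> < 1/4" "100 * (3 * \<epsilon>) / r \<le> \<eta>"
    proof -
      show "\<epsilon> > 0" "3 * \<epsilon> < 1/4" using \<eta> r by (auto simp: \<epsilon>_def)
      have "\<epsilon> \<le> \<eta> * r / 300" by (simp add: \<epsilon>_def)
      thus "100 * (3 * \<epsilon>) / r \<le> \<eta>" using r by (simp add: field_simps)
    qed
    obtain v where v: "v \<in> G" "\<forall>z\<in>S. \<forall>y. dist z y < \<rho> \<longrightarrow> dist (v z) (v y) < \<epsilon>"
      using \<rho>(2)[OF \<epsilon>(1)] by blast
    obtain n where n: "v \<in> words (Suc n)" using G_imp_words[OF v(1)] .
    have "dist (v' y) (v' y') \<le> \<eta> * dist y y'"
      if v': "hol v'" "\<forall>x. dist (v x) (v' x) < \<epsilon>" and z: "z \<in> S"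
        and y: "y \<in> ball z (r/8)" "y' \<in> ball z (r/8)" for v' z y y'
    proof -
      have "dist (v' y) (v' y') \<le> 100 * (3 * \<epsilon>) / r * dist y y'"
      proof (rule hol_Schwarz[OF v'(1) r \<epsilon>(2) _ y])
        fix u assume "u \<in> ball z r"
        hence "dist (v z) (v u) < \<epsilon>" using v(2) z by (simp add: r_def)
        thus "dist (v' z) (v' u) \<le> 3 * \<epsilon>"
          using dist_triangle4[of "v' z" "v' u" "v z" "v u"] v'(2)[rule_format, of z]
            v'(2)[rule_format, of u] by (simp add: dist_commute)
      qed
      also have "\<dots> \<le> \<eta> * dist y y'" by (intro mult_right_mono \<epsilon>(3)) simp
      finally show ?thesis .
    qed
    thus "\<exists>n v \<epsilon>. v \<in> words (Suc n) \<and> \<epsilon> > 0 \<and>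
       (\<forall>v'. hol v' \<longrightarrow> (\<forall>x. dist (v x) (v' x) < \<epsilon>) \<longrightarrow>
         (\<forall>z\<in>S. \<forall>y\<in>ball z (r/8). \<forall>y'\<in>ball z (r/8). dist (v' y) (v' y') \<le> \<eta> * dist y y'))"
      using n \<epsilon>(1) by blast
  qed (use r in simp)
qed

section \<open>The minimal sets of the semigroup\<close>

abbreviation S where "S \<equiv> \<Union> (Min_sets G)"

lemma Min_setD:
  assumes "L \<in> Min_sets G"
  shows "compact L" "closed L" "L \<noteq> {}" "\<And>g. g \<in> G \<Longrightarrow> g ` L \<subseteq> L"
    "\<And>K. fwd_inv G K \<Longrightarrow> K \<subseteq> L \<Longrightarrow> K = L"
  using assms by (auto simp: Min_sets_def fwd_inv_def compact_imp_closed)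

lemma fwd_inv_orbit: "fwd_inv G (closure ((\<lambda>g. g x) ` G))"
  unfolding fwd_inv_def
proof (intro conjI ballI)
  fix g assume g: "g \<in> G"
  have "g ` (\<lambda>g. g x) ` G \<subseteq> (\<lambda>g. g x) ` G"
  proof clarify
    fix h assume "h \<in> G"
    from imageI[OF G_comp[OF g this], of "\<lambda>g. g x"] show "g (h x) \<in> (\<lambda>g. g x) ` G" by simp
  qed
  thus "g ` closure ((\<lambda>g. g x) ` G) \<subseteq> closure ((\<lambda>g. g x) ` G)"
    by (intro image_closure_subset G_cont[OF g] closed_closure) (use closure_subset in blast)
qed (auto simp: G_ne compact_rsphere)

lemma orbit_reaches_Min_set:
  obtains L where "L \<in> Min_sets G" "\<And>z \<epsilon>. z \<in> L \<Longrightarrow> \<epsilon> > 0 \<Longrightarrow> \<exists>g\<in>G. dist (g x) z < \<epsilon>"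
proof -
  obtain L where L: "L \<in> Min_sets G" "L \<subseteq> closure ((\<lambda>g. g x) ` G)"
    using Min_sets_exist[OF fwd_inv_orbit] by metis
  show ?thesis
    by (rule that[OF L(1)]) (use L(2) in \<open>fastforce simp: closure_approachable\<close>)
qed

lemma Min_set_orbit_dense:
  assumes L: "L \<in> Min_sets G" "x \<in> L" "z \<in> L" "\<epsilon> > 0"
  shows "\<exists>g\<in>G. dist (g x) z < \<epsilon>"
proof -
  have "closure ((\<lambda>g. g x) ` G) \<subseteq> L"
    using Min_setD[OF L(1)] L(2) by (intro closure_minimal) auto
  hence "closure ((\<lambda>g. g x) ` G) = L" using Min_setD(5)[OF L(1) fwd_inv_orbit] by blast
  hence "z \<in> closure ((\<lambda>g. g x) ` G)" using L by simp
  thus ?thesis using L(4) by (fastforce simp: closure_approachable)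
qed

text \<open>Disjoint compact sets have positive distance, and a non-empty intersection of minimal
  sets is invariant, hence equal to both.\<close>

lemma Min_set_eqI:
  assumes L: "L \<in> Min_sets G" "L' \<in> Min_sets G"
    and close: "\<And>\<eta>. \<eta> > 0 \<Longrightarrow> \<exists>x\<in>L. \<exists>y\<in>L'. dist x y < \<eta>"
  shows "L = L'"
proof -
  have "L \<inter> L' \<noteq> {}"
  proof
    assume disj: "L \<inter> L' = {}"
    obtain x0 where x0: "x0 \<in> L" "\<forall>x\<in>L. infdist x0 L' \<le> infdist x L'"
      using continuous_attains_inf[OF Min_setD(1,3)[OF L(1)]
          continuous_on_infdist[OF continuous_on_id, of L L']] by blast
    have "infdist x0 L' > 0"
      using infdist_pos_not_in_closed[OF Min_setD(2,3)[OF L(2)], of x0] x0(1) disj by blast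
    then obtain x y where "x \<in> L" "y \<in> L'" "dist x y < infdist x0 L'" using close by blast
    thus False using x0(2) infdist_le[of y L' x] by fastforce
  qed
  moreover have "g ` (L \<inter> L') \<subseteq> L \<inter> L'" if "g \<in> G" for g
    using Min_setD(4)[OF L(1) that] Min_setD(4)[OF L(2) that] by blast
  ultimately have "fwd_inv G (L \<inter> L')"
    using Min_setD(2)[OF L(1)] Min_setD(2)[OF L(2)] unfolding fwd_inv_def by (auto simp: compact_rsphere)
  hence "L \<inter> L' = L" "L \<inter> L' = L'" using Min_setD(5)[OF L(1)] Min_setD(5)[OF L(2)] by auto
  thus ?thesis by simp
qed

text \<open>The points that some \<open>g\<close> brings within \<open>\<rho> L\<close> of
  \<open>L\<close> form an open set, and these sets cover the sphere. A minimal set meeting the one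
  that belongs to \<open>L\<close> is brought arbitrarily close to \<open>L\<close> by contraction
  and so equals \<open>L\<close>; hence a finite subcover lists all minimal sets.\<close>

lemma finite_Min_sets:
  assumes S: "S \<subseteq> F" and R: "Rec = {}"
  shows "finite (Min_sets G)"
proof -
  have "\<exists>\<rho>>0. \<forall>\<eta>>0. \<exists>g\<in>G. \<forall>z\<in>L. \<forall>y. dist z y < \<rho> \<longrightarrow> dist (g z) (g y) < \<eta>"
    if L: "L \<in> Min_sets G" for L
  proof -
    have "L \<subseteq> F" using S L by blast
    from contraction[OF Min_setD(1)[OF L] this Min_setD(4)[OF L] R] show ?thesis by metis
  qed
  then obtain \<rho> where \<rho>: "\<And>L. L \<in> Min_sets G \<Longrightarrow> \<rho> L > 0"
    "\<And>L \<eta>. L \<in> Min_sets G \<Longrightarrow> \<eta> > 0 \<Longrightarrow>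
      \<exists>g\<in>G. \<forall>z\<in>L. \<forall>y. dist z y < \<rho> L \<longrightarrow> dist (g z) (g y) < \<eta>"
    by metis
  define U where "U = (\<lambda>L. \<Union>g\<in>G. \<Union>z\<in>L. g -` ball z (\<rho> L))"
  have "open (U L)" for L
    unfolding U_def by (intro open_UN ballI open_vimage G_cont) auto
  moreover have "UNIV \<subseteq> \<Union> (U ` Min_sets G)"
  proof
    fix x
    obtain L where L: "L \<in> Min_sets G" "\<And>z \<epsilon>. z \<in> L \<Longrightarrow> \<epsilon> > 0 \<Longrightarrow> \<exists>g\<in>G. dist (g x) z < \<epsilon>"
      by (rule orbit_reaches_Min_set[of x]) metis
    obtain z where z: "z \<in> L" using Min_setD(3)[OF L(1)] by blast
    obtain g where "g \<in> G" "dist (g x) z < \<rho> L" using L(2)[OF z \<rho>(1)[OF L(1)]] by blast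
    thus "x \<in> \<Union> (U ` Min_sets G)" using L(1) z by (auto simp: U_def dist_commute)
  qed
  ultimately obtain M where M: "M \<subseteq> Min_sets G" "finite M" "UNIV \<subseteq> \<Union> (U ` M)"
    using compactE_image[OF compact_UNIV_rsphere, of "Min_sets G" U] by metis
  have "Min_sets G \<subseteq> M"
  proof
    fix L' assume L': "L' \<in> Min_sets G"
    obtain x where x: "x \<in> L'" using Min_setD(3)[OF L'] by blast
    obtain L where L: "L \<in> M" "x \<in> U L" using M(3) by blast
    obtain g z where g: "g \<in> G" "z \<in> L" "dist z (g x) < \<rho> L" using L(2) by (auto simp: U_def)
    have LM: "L \<in> Min_sets G" using L M by blast
    have "L = L'"
    proof (rule Min_set_eqI[OF LM L'])
      fix \<eta> :: real assume "\<eta> > 0"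
      then obtain h where h: "h \<in> G" "\<forall>z\<in>L. \<forall>y. dist z y < \<rho> L \<longrightarrow> dist (h z) (h y) < \<eta>"
        using \<rho>(2)[OF LM] by blast
      have "h z \<in> L" "h (g x) \<in> L'"
        using Min_setD(4)[OF LM h(1)] Min_setD(4)[OF L' h(1)] Min_setD(4)[OF L' g(1)] g(2) x by blast+
      thus "\<exists>x\<in>L. \<exists>y\<in>L'. dist x y < \<eta>" using h(2) g by blast
    qed
    thus "L' \<in> M" using L by simp
  qed
  thus ?thesis using M(2) finite_subset by blast
qed

lemma S_inv: "g \<in> G \<Longrightarrow> g ` S \<subseteq> S"
  using Min_setD(4) by blast

lemma orbit_reaches_S: "\<epsilon> > 0 \<Longrightarrow> \<exists>g\<in>G. \<exists>z\<in>S. dist (g x) z < \<epsilon>"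
proof -
  assume "\<epsilon> > 0"
  obtain L where L: "L \<in> Min_sets G" "\<And>z \<epsilon>. z \<in> L \<Longrightarrow> \<epsilon> > 0 \<Longrightarrow> \<exists>g\<in>G. dist (g x) z < \<epsilon>"
    by (rule orbit_reaches_Min_set[of x]) metis
  thus ?thesis using Min_setD(3)[OF L(1)] \<open>\<epsilon> > 0\<close> by blast
qed

lemma compact_S: "S \<subseteq> F \<Longrightarrow> Rec = {} \<Longrightarrow> compact S"
  using finite_Min_sets Min_setD(1) by (intro compact_Union) auto

end

section \<open>Cyclic classes of a minimal set\<close>

context hol_semigroup
begin

text \<open>Closeness in \<open>ds\<close> persists when the same word is applied to both points;
  this is what the proofs of transitivity and of compatibility with words rely on.\<close>

definition sim :: "rsphere \<Rightarrow> rsphere \<Rightarrow> bool" where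
  "sim x y \<longleftrightarrow> (\<forall>\<epsilon>>0. \<exists>k. \<exists>g\<in>words k. \<exists>h\<in>words k. ds (g x) (h y) < \<epsilon>)"

lemma simD:
  assumes "sim x y" "\<epsilon> > 0"
  obtains k g h where "g \<in> words k" "h \<in> words k" "ds (g x) (h y) < \<epsilon>"
  using assms unfolding sim_def by metis

lemma sim_refl [simp]: "sim x x"
  unfolding sim_def by (metis ds_self insertI1 words.simps(1))

lemma sim_sym: "sim x y \<Longrightarrow> sim y x"
  unfolding sim_def by (metis ds_sym)

lemma word_dense:
  assumes L: "L \<in> Min_sets G" "L \<subseteq> F" and x: "x \<in> L" "y \<in> L" and e: "\<epsilon> > 0"
  obtains n w where "w \<in> words n" "ds (w x) y < \<epsilon>"
proof -
  obtain d where d: "d > 0" "\<And>x y. x \<in> L \<Longrightarrow> dist x y < d \<Longrightarrow> ds x y < \<epsilon>"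
    using ds_small[OF Min_setD(1)[OF L(1)] L(2) e] by metis
  obtain g where g: "g \<in> G" "dist (g x) y < d" using Min_set_orbit_dense[OF L(1) x d(1)] by blast
  obtain n where n: "g \<in> words (Suc n)" using G_imp_words[OF g(1)] .
  have "ds y (g x) < \<epsilon>" using d(2)[OF x(2)] g(2) by (simp add: dist_commute)
  thus ?thesis using that[OF n] by (simp add: ds_sym)
qed

text \<open>By density of orbits, \<open>u\<close> returns from \<open>g y\<close> to near
  \<open>y\<close> and \<open>v\<close> returns from \<open>h y\<close> to near \<open>y\<close>.
  Following either loop by the other gives the words \<open>v \<circ> (h \<circ> u)\<close> at
  \<open>g y\<close> and \<open>u \<circ> (g \<circ> v)\<close> at \<open>h y\<close>. They have the
  same length whatever the return times, and both end near \<open>y\<close>.\<close>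

lemma sim_star:
  assumes L: "L \<in> Min_sets G" "L \<subseteq> F" and y: "y \<in> L" and gh: "g \<in> words k" "h \<in> words k"
  shows "sim (g y) (h y)"
  unfolding sim_def
proof (intro allI impI)
  fix \<epsilon> :: real assume "\<epsilon> > 0"
  hence e4: "\<epsilon> / 4 > 0" by simp
  have gy: "g y \<in> L" "h y \<in> L" using words_inv[OF _ y Min_setD(4)[OF L(1)]] gh by blast+
  obtain s u where u: "u \<in> words s" "ds (u (g y)) y < \<epsilon>/4" using word_dense[OF L gy(1) y e4] .
  obtain t v where v: "v \<in> words t" "ds (v (h y)) y < \<epsilon>/4" using word_dense[OF L gy(2) y e4] .
  define A where "A = v (h (u (g y)))"
  define B where "B = u (g (v (h y)))"
  have "ds A (v (h y)) \<le> ds (u (g y)) y"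
    using ds_mono[OF words_add[OF gh(2) v(1)], of "u (g y)" y] by (simp add: A_def)
  hence A: "ds A y < \<epsilon>/2" using ds_triangle[of A y "v (h y)"] u v by simp
  have "ds B (u (g y)) \<le> ds (v (h y)) y"
    using ds_mono[OF words_add[OF gh(1) u(1)], of "v (h y)" y] by (simp add: B_def)
  hence B: "ds B y < \<epsilon>/2" using ds_triangle[of B y "u (g y)"] u v by simp
  have "ds A B < \<epsilon>" using A B ds_triangle[of A B y] by (simp add: ds_sym)
  moreover have "v \<circ> (h \<circ> u) \<in> words (t + (k + s))" "u \<circ> (g \<circ> v) \<in> words (s + (k + t))"
    using words_add u v gh by blast+
  moreover have "s + (k + t) = t + (k + s)" by simp
  ultimately show "\<exists>k. \<exists>a\<in>words k. \<exists>b\<in>words k. ds (a (g y)) (b (h y)) < \<epsilon>"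
    unfolding A_def B_def by (metis comp_apply)
qed

text \<open>The two relations send \<open>y\<close> along unrelated words of lengths
  \<open>k\<close> and \<open>l\<close>. Applying \<open>sim_star\<close> at \<open>y\<close>
  reconciles them after padding to equal length, which is why \<open>y\<close> has to lie in a
  minimal set.\<close>

lemma sim_trans:
  assumes L: "L \<in> Min_sets G" "L \<subseteq> F" and y: "y \<in> L" and s: "sim x y" "sim y z"
  shows "sim x z"
  unfolding sim_def
proof (intro allI impI)
  fix \<epsilon> :: real assume "\<epsilon> > 0"
  hence e3: "\<epsilon> / 3 > 0" by simp
  obtain k g h where 1: "g \<in> words k" "h \<in> words k" "ds (g x) (h y) < \<epsilon>/3" using simD[OF s(1) e3] .
  obtain l h' g' where 2: "h' \<in> words l" "g' \<in> words l" "ds (h' y) (g' z) < \<epsilon>/3" using simD[OF s(2) e3] .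
  obtain w w' where w: "w \<in> words l" "w' \<in> words k" using words_ne by blast
  have "w' \<circ> h' \<in> words (l + k)" using words_add[OF 2(1) w(2)] by (simp add: add.commute)
  hence "sim ((w \<circ> h) y) ((w' \<circ> h') y)" using words_add[OF 1(2) w(1)] by (intro sim_star[OF L y])
  then obtain m u u' where u: "u \<in> words m" "u' \<in> words m"
      "ds (u ((w \<circ> h) y)) (u' ((w' \<circ> h') y)) < \<epsilon>/3" using simD[OF _ e3] by blast
  have a: "ds (u (w (g x))) (u (w (h y))) < \<epsilon>/3"
    using ds_mono[OF words_add[OF w(1) u(1)], of "g x" "h y"] 1 by simp
  have b: "ds (u' (w' (h' y))) (u' (w' (g' z))) < \<epsilon>/3"
    using ds_mono[OF words_add[OF w(2) u(2)], of "h' y" "g' z"] 2 by simp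
  have "ds (u (w (g x))) (u' (w' (g' z))) < \<epsilon>"
    using a b u(3) ds_triangle[of "u (w (g x))" "u' (w' (g' z))" "u (w (h y))"]
      ds_triangle[of "u (w (h y))" "u' (w' (g' z))" "u' (w' (h' y))"] by simp
  moreover have "u \<circ> (w \<circ> g) \<in> words (m + (l + k))" "u' \<circ> (w' \<circ> g') \<in> words (m + (k + l))"
    using words_add 1 2 u w by blast+
  moreover have "m + (k + l) = m + (l + k)" by simp
  ultimately show "\<exists>k. \<exists>g\<in>words k. \<exists>h\<in>words k. ds (g x) (h z) < \<epsilon>"
    by (metis comp_apply)
qed

text \<open>The prescribed words \<open>g\<close>, \<open>h\<close> and the words that bring
  \<open>x\<close> and \<open>y\<close> together come in the wrong order; \<open>sim_star\<close>,
  used once at \<open>x\<close> and once at \<open>y\<close>, exchanges them.\<close>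

lemma sim_words:
  assumes L: "L \<in> Min_sets G" "L \<subseteq> F" and xy: "x \<in> L" "y \<in> L" and s: "sim x y"
    and gh: "g \<in> words l" "h \<in> words l"
  shows "sim (g x) (h y)"
  unfolding sim_def
proof (intro allI impI)
  fix \<epsilon> :: real assume "\<epsilon> > 0"
  hence e3: "\<epsilon> / 3 > 0" by simp
  obtain k u v where 1: "u \<in> words k" "v \<in> words k" "ds (u x) (v y) < \<epsilon>/3" using simD[OF s e3] .
  obtain w w' where w: "w \<in> words k" "w' \<in> words l" using words_ne by blast
  have "w \<circ> g \<in> words (l + k)" using words_add[OF gh(1) w(1)] by (simp add: add.commute)
  hence "sim ((w \<circ> g) x) ((w' \<circ> u) x)" using words_add[OF 1(1) w(2)] by (intro sim_star[OF L xy(1)])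
  then obtain m p q where p: "p \<in> words m" "q \<in> words m"
      "ds (p ((w \<circ> g) x)) (q ((w' \<circ> u) x)) < \<epsilon>/3" using simD[OF _ e3] by blast
  obtain t where t: "t \<in> words m" using words_ne by blast
  have A: "q \<circ> (w' \<circ> v) \<in> words (m + (l + k))" "t \<circ> (w \<circ> h) \<in> words (m + (k + l))"
    using words_add 1 p w t gh by blast+
  have "t \<circ> (w \<circ> h) \<in> words (m + (l + k))" using A(2) by (metis add.commute)
  hence "sim ((q \<circ> (w' \<circ> v)) y) ((t \<circ> (w \<circ> h)) y)" by (rule sim_star[OF L xy(2) A(1)])
  then obtain m2 p2 q2 where p2: "p2 \<in> words m2" "q2 \<in> words m2"
      "ds (p2 ((q \<circ> (w' \<circ> v)) y)) (q2 ((t \<circ> (w \<circ> h)) y)) < \<epsilon>/3" using simD[OF _ e3] by blast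
  have a: "ds (p2 (p (w (g x)))) (p2 (q (w' (u x)))) < \<epsilon>/3"
    using ds_mono[OF p2(1), of "p (w (g x))" "q (w' (u x))"] p(3) by simp
  have b: "ds (p2 (q (w' (u x)))) (p2 (q (w' (v y)))) < \<epsilon>/3"
    using ds_mono[OF words_add[OF words_add[OF w(2) p(2)] p2(1)], of "u x" "v y"] 1 by simp
  have "ds (p2 (p (w (g x)))) (q2 (t (w (h y)))) < \<epsilon>"
    using a b p2(3) ds_triangle[of "p2 (p (w (g x)))" "q2 (t (w (h y)))" "p2 (q (w' (u x)))"]
      ds_triangle[of "p2 (q (w' (u x)))" "q2 (t (w (h y)))" "p2 (q (w' (v y)))"] by simp
  moreover have "p2 \<circ> (p \<circ> w) \<in> words (m2 + (m + k))" "q2 \<circ> (t \<circ> w) \<in> words (m2 + (m + k))"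
    using words_add p p2 t w by blast+
  ultimately show "\<exists>k. \<exists>a\<in>words k. \<exists>b\<in>words k. ds (a (g x)) (b (h y)) < \<epsilon>"
    by (metis comp_apply)
qed

lemma sim_cancel:
  assumes "g \<in> words l" "h \<in> words l" "sim (g x) (h y)"
  shows "sim x y"
  unfolding sim_def
proof (intro allI impI)
  fix \<epsilon> :: real assume "\<epsilon> > 0"
  then obtain k a b where 1: "a \<in> words k" "b \<in> words k" "ds (a (g x)) (b (h y)) < \<epsilon>"
    using simD[OF assms(3)] by blast
  have "a \<circ> g \<in> words (k + l)" "b \<circ> h \<in> words (k + l)" using words_add assms 1 by blast+
  thus "\<exists>k. \<exists>g\<in>words k. \<exists>h\<in>words k. ds (g x) (h y) < \<epsilon>" using 1 by (metis comp_apply)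
qed

lemma sim_limit:
  assumes "\<And>\<epsilon>. \<epsilon> > 0 \<Longrightarrow> \<exists>x' y'. ds x x' < \<epsilon> \<and> ds y y' < \<epsilon> \<and> sim x' y'"
  shows "sim x y"
  unfolding sim_def
proof (intro allI impI)
  fix \<epsilon> :: real assume "\<epsilon> > 0"
  hence e3: "\<epsilon> / 3 > 0" by simp
  obtain x' y' where xy: "ds x x' < \<epsilon>/3" "ds y y' < \<epsilon>/3" "sim x' y'" using assms[OF e3] by blast
  obtain k g h where 1: "g \<in> words k" "h \<in> words k" "ds (g x') (h y') < \<epsilon>/3" using simD[OF xy(3) e3] .
  have "ds (g x) (h y) < \<epsilon>"
    using xy 1 ds_mono[OF 1(1), of x x'] ds_mono[OF 1(2), of y' y]
      ds_triangle[of "g x" "h y" "g x'"] ds_triangle[of "g x'" "h y" "h y'"] ds_sym[of y y'] by simp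
  thus "\<exists>k. \<exists>g\<in>words k. \<exists>h\<in>words k. ds (g x) (h y) < \<epsilon>" using 1 by blast
qed

text \<open>Contraction makes a nearby pair arbitrarily close under one word. As a consequence the
  classes are open in \<open>L\<close>, and compactness leaves finitely many.\<close>

lemma sim_near:
  assumes L: "L \<in> Min_sets G" "L \<subseteq> F" and R: "Rec = {}"
  obtains \<rho> where "\<rho> > 0" "\<And>x y. x \<in> L \<Longrightarrow> dist x y < \<rho> \<Longrightarrow> sim x y"
proof -
  obtain \<rho> where \<rho>: "\<rho> > 0"
    "\<And>\<eta>. \<eta> > 0 \<Longrightarrow> \<exists>g\<in>G. \<forall>z\<in>L. \<forall>y. dist z y < \<rho> \<longrightarrow> dist (g z) (g y) < \<eta>"
    using contraction[OF Min_setD(1)[OF L(1)] L(2) Min_setD(4)[OF L(1)] R] by metis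
  show ?thesis
  proof (rule that[OF \<rho>(1)], unfold sim_def, intro allI impI)
    fix x y and \<epsilon> :: real assume x: "x \<in> L" "dist x y < \<rho>" and e: "\<epsilon> > 0"
    obtain d where d: "d > 0" "\<And>x y. x \<in> L \<Longrightarrow> dist x y < d \<Longrightarrow> ds x y < \<epsilon>"
      using ds_small[OF Min_setD(1)[OF L(1)] L(2) e] by metis
    obtain g where g: "g \<in> G" "\<forall>z\<in>L. \<forall>y. dist z y < \<rho> \<longrightarrow> dist (g z) (g y) < d"
      using \<rho>(2)[OF d(1)] by blast
    obtain n where n: "g \<in> words (Suc n)" using G_imp_words[OF g(1)] .
    have "g x \<in> L" using Min_setD(4)[OF L(1) g(1)] x by blast
    hence "ds (g x) (g y) < \<epsilon>" using g(2) x d(2) by blast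
    thus "\<exists>k. \<exists>g\<in>words k. \<exists>h\<in>words k. ds (g x) (h y) < \<epsilon>" using n by blast
  qed
qed

lemma funpow_words: "\<gamma> \<in> \<Gamma> \<Longrightarrow> \<gamma> ^^ n \<in> words n"
proof (induction n)
  case (Suc n)
  have "\<gamma> \<circ> \<gamma> ^^ n \<in> words (1 + n)" by (rule words_add[OF Suc.IH[OF Suc.prems] words_1[OF Suc.prems]])
  thus ?case unfolding funpow.simps plus_1_eq_Suc .
qed simp

text \<open>By \<open>sim_star\<close> the class reached from \<open>x0\<close> depends only on the
  length of the word, so a single generator \<open>\<gamma>\<close> runs through the whole cycle.
  The number \<open>d\<close> is its first return time to the class of \<open>x0\<close>, which
  exists by the pigeonhole principle on a finite net.\<close>

lemma cyclic_classes:
  assumes L: "L \<in> Min_sets G" "L \<subseteq> F" and R: "Rec = {}" and x0: "x0 \<in> L" and \<gamma>: "\<gamma> \<in> \<Gamma>"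
  obtains d where "d > 0" "sim ((\<gamma> ^^ d) x0) x0"
    "\<And>i j. i < d \<Longrightarrow> j < d \<Longrightarrow> sim ((\<gamma> ^^ i) x0) ((\<gamma> ^^ j) x0) \<Longrightarrow> i = j"
    "\<And>y. y \<in> L \<Longrightarrow> \<exists>i<d. sim y ((\<gamma> ^^ i) x0)"
proof -
  obtain \<rho> where \<rho>: "\<rho> > 0" "\<And>x y. x \<in> L \<Longrightarrow> dist x y < \<rho> \<Longrightarrow> sim x y"
    using sim_near[OF L R] by metis
  define x where "x = (\<lambda>i. (\<gamma> ^^ i) x0)"
  have w: "\<gamma> ^^ n \<in> words n" for n by (rule funpow_words[OF \<gamma>])
  have xL: "x i \<in> L" for i unfolding x_def by (rule words_inv[OF w x0 Min_setD(4)[OF L(1)]])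
  have shift: "sim (x 0) (x (j - i))" if "sim (x i) (x j)" "i \<le> j" for i j
  proof (rule sim_cancel[OF w w])
    have "(\<gamma> ^^ i) (x (j - i)) = x j" using that(2)
      by (simp add: x_def flip: funpow_add[THEN fun_cong, unfolded comp_apply])
    thus "sim ((\<gamma> ^^ i) (x 0)) ((\<gamma> ^^ i) (x (j - i)))" using that(1) by (simp add: x_def)
  qed
  obtain T where T: "finite T" "T \<subseteq> L" "\<And>x. x \<in> L \<Longrightarrow> \<exists>s\<in>T. dist s x < \<rho>/2"
    using rsphere_net[of "\<rho>/2" L] \<rho>(1) by auto
  obtain c where c: "\<And>i. c i \<in> T" "\<And>i. dist (c i) (x i) < \<rho>/2" using T(3)[OF xL] by metis
  have "\<not> inj c"
    using T(1) c(1) by (metis finite_imageD finite_subset image_subsetI infinite_UNIV_nat)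
  then obtain i j where ij: "i < j" "c i = c j" by (metis injI linorder_neqE_nat)
  have "dist (x i) (x j) < \<rho>" using c(2)[of i] c(2)[of j] ij(2) by (metis dist_commute dist_triangle_half_l)
  hence "sim (x i) (x j)" by (rule \<rho>(2)[OF xL])
  hence ex: "j - i > 0 \<and> sim (x (j - i)) x0" using ij(1) shift[of i j] by (simp add: x_def sim_sym)
  define d where "d = (LEAST d. d > 0 \<and> sim (x d) x0)"
  have d: "d > 0" "sim (x d) x0" using LeastI[of "\<lambda>d. d > 0 \<and> sim (x d) x0", OF ex] by (auto simp: d_def)
  have dmin: "\<not> sim (x k) x0" if "0 < k" "k < d" for k
    using not_less_Least[of k "\<lambda>d. d > 0 \<and> sim (x d) x0"] that by (auto simp: d_def)
  have per: "sim (x (q * d + k)) (x k)" for q k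
  proof (induction q)
    case (Suc q)
    have "sim ((\<gamma> ^^ (q * d + k)) (x d)) ((\<gamma> ^^ (q * d + k)) x0)"
      by (rule sim_words[OF L xL x0 d(2) w w])
    hence "sim (x (Suc q * d + k)) (x (q * d + k))"
      by (simp add: x_def add_ac flip: funpow_add[THEN fun_cong, unfolded comp_apply])
    thus ?case using sim_trans[OF L xL] Suc.IH by blast
  qed simp
  have ij_less: "\<not> sim (x i) (x j)" if "i < j" "j < d" for i j
  proof
    assume "sim (x i) (x j)"
    hence "sim (x 0) (x (j - i))" using shift that by simp
    hence "sim (x (j - i)) x0" by (simp add: x_def sim_sym)
    moreover have "0 < j - i" "j - i < d" using that by linarith+
    ultimately show False using dmin by blast
  qed
  show ?thesis
  proof (rule that[OF d(1) d(2)[unfolded x_def]])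
    show "i = j" if "i < d" "j < d" "sim ((\<gamma> ^^ i) x0) ((\<gamma> ^^ j) x0)" for i j
      using ij_less[of i j] ij_less[of j i] that sim_sym unfolding x_def by (metis linorder_neqE_nat)
    fix y assume y: "y \<in> L"
    obtain n u where u: "u \<in> words n" "ds (u x0) y < \<rho>" using word_dense[OF L x0 y \<rho>(1)] .
    have uL: "u x0 \<in> L" by (rule words_inv[OF u(1) x0 Min_setD(4)[OF L(1)]])
    have 1: "sim y (u x0)" using \<rho>(2)[OF uL, of y] u(2) dist_le_ds[of "u x0" y] sim_sym by fastforce
    have 2: "sim (u x0) (x n)" unfolding x_def by (rule sim_star[OF L x0 u(1) w])
    have 3: "sim (x n) (x (n mod d))" using per[of "n div d" "n mod d"] by simp
    have "sim y (x (n mod d))" by (rule sim_trans[OF L uL 1 sim_trans[OF L xL 2 3]])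
    thus "\<exists>i<d. sim y ((\<gamma> ^^ i) x0)" using d(1) unfolding x_def by (intro exI[of _ "n mod d"]) simp
  qed
qed

end

section \<open>The space of rational maps\<close>

lemma kappa_bdd: "bdd_above (range (\<lambda>z. dist (f z) (g z :: rsphere)))"
  using dist_rsphere_le_2 by (intro bdd_aboveI2[of _ _ 2])

lemma kappa_upper: "dist (f z) (g z) \<le> kappa f g"
  unfolding kappa_def by (intro cSUP_upper kappa_bdd UNIV_I)

lemma kappa_least: "(\<And>z. dist (f z) (g z) \<le> c) \<Longrightarrow> kappa f g \<le> c"
  unfolding kappa_def by (intro cSUP_least) auto

lemma kappa_nonneg [simp]: "kappa f g \<ge> 0"
  using kappa_upper zero_le_dist order_trans by blast

interpretation rat: Metric_space Rat kappa
proof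
  show "kappa f g = kappa g f" for f g by (simp add: kappa_def dist_commute)
  show "kappa f g = 0 \<longleftrightarrow> f = g" for f g
  proof
    assume k: "kappa f g = 0"
    show "f = g"
    proof
      fix z
      have "dist (f z) (g z) \<le> 0" using kappa_upper[of f z g] k by simp
      thus "f z = g z" by simp
    qed
  qed (simp add: kappa_def)
  show "kappa f h \<le> kappa f g + kappa g h" for f g h
  proof (rule kappa_least)
    fix z
    show "dist (f z) (h z) \<le> kappa f g + kappa g h"
      using dist_triangle[of "f z" "h z" "g z"] kappa_upper[of f z g] kappa_upper[of g z h] by linarith
  qed
qed simp

lemma Rat_hol: "f \<in> Rat \<Longrightarrow> hol f"
  by (simp add: Rat_def rat_map_hol)

text \<open>A rational map is determined, up to \<open>4/(k+1)\<close>, by its modulus of continuity at that scale and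
  by approximate values on a finite net.\<close>

lemma Rat_separable:
  obtains Q where "countable Q" "Q \<subseteq> Rat" "\<And>f e. f \<in> Rat \<Longrightarrow> e > 0 \<Longrightarrow> \<exists>q\<in>Q. kappa f q < e"
proof -
  have "\<forall>k::nat. \<exists>T. finite T \<and> (\<forall>x::rsphere. \<exists>s\<in>T. dist s x < inverse (Suc k))"
  proof
    fix k :: nat
    have "inverse (real (Suc k)) > 0" by simp
    from finite_net[OF compact_UNIV_rsphere this]
    show "\<exists>T. finite T \<and> (\<forall>x::rsphere. \<exists>s\<in>T. dist s x < inverse (Suc k))" by (metis UNIV_I)
  qed
  then obtain T :: "nat \<Rightarrow> rsphere set" where T: "\<And>k. finite (T k)"
    "\<And>k x. \<exists>s\<in>T k. dist s x < inverse (real (Suc k))" by metis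
  define P where "P = (\<lambda>(m, k, c) f. f \<in> Rat \<and>
     (\<forall>x y. dist x y < inverse (real (Suc m)) \<longrightarrow> dist (f x) (f y) < inverse (real (Suc k))) \<and>
     (\<forall>s\<in>T m. dist (c s) (f s) < inverse (real (Suc k))))"
  define I where "I = (SIGMA m:(UNIV::nat set). SIGMA k:(UNIV::nat set). PiE (T m) (\<lambda>_. T k))"
  define Q where "Q = (\<lambda>i. SOME f. P i f) ` {i \<in> I. \<exists>f. P i f}"
  have P: "P i (SOME f. P i f)" if "P i f" for i f using that by (rule someI[of "P i"])
  show ?thesis
  proof (rule that[of Q])
    have "countable (PiE (T m) (\<lambda>_. T k))" for m k
      by (rule countable_finite[OF finite_PiE[OF T(1) T(1)]])
    hence "countable I" unfolding I_def
      by (intro countable_SIGMA) (rule countableI_type, rule countableI_type)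
    moreover have "{i \<in> I. \<exists>f. P i f} \<subseteq> I" by blast
    ultimately show "countable Q" unfolding Q_def by (meson countable_image countable_subset)
    show "Q \<subseteq> Rat"
    proof
      fix q assume "q \<in> Q"
      then obtain i f where "q = (SOME f. P i f)" "P i f" by (auto simp: Q_def)
      thus "q \<in> Rat" using P[of i f] by (auto simp: P_def split: prod.splits)
    qed
    fix f and e :: real assume f: "f \<in> Rat" and e: "e > 0"
    \<comment> \<open>Four errors of size 1/(k+1) add up below; \<open>e/5\<close> leaves a strict
      inequality.\<close>
    obtain k where k: "inverse (real (Suc k)) < e/5" using reals_Archimedean[of "e/5"] e by auto
    obtain d where d: "d > 0" "\<And>x y. dist x y < d \<Longrightarrow> dist (f x) (f y) < inverse (real (Suc k))"
      using rsphere_unif_cont[OF hol_cont[OF Rat_hol[OF f]], of "inverse (real (Suc k))"] by auto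
    obtain m where m: "inverse (real (Suc m)) < d" using reals_Archimedean[OF d(1)] by auto
    have "\<forall>s. \<exists>t. t \<in> T k \<and> dist t (f s) < inverse (real (Suc k))" using T(2) by blast
    then obtain c0 where c0: "\<And>s. c0 s \<in> T k" "\<And>s. dist (c0 s) (f s) < inverse (real (Suc k))" by metis
    define c where "c = restrict c0 (T m)"
    have I: "(m, k, c) \<in> I" using c0 by (auto simp: I_def c_def)
    have Pf: "P (m, k, c) f"
      unfolding P_def using f d m c0 by (auto simp: c_def)
    define q where "q = (SOME f. P (m, k, c) f)"
    have qQ: "q \<in> Q" using I Pf by (auto simp: Q_def q_def)
    have Pq: "P (m, k, c) q" unfolding q_def by (rule P[OF Pf])
    have "dist (f x) (q x) \<le> 4 * inverse (real (Suc k))" for x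
    proof -
      obtain s where s: "s \<in> T m" "dist s x < inverse (real (Suc m))" using T(2) by blast
      have "dist (f s) (f x) < inverse (real (Suc k))" "dist (q s) (q x) < inverse (real (Suc k))"
        "dist (c s) (f s) < inverse (real (Suc k))" "dist (c s) (q s) < inverse (real (Suc k))"
        using Pf Pq s unfolding P_def by auto
      thus ?thesis using dist_triangle4[of "f x" "q x" "f s" "q s"] dist_triangle2[of "f s" "q s" "c s"]
        by (simp add: dist_commute)
    qed
    hence "kappa f q \<le> 4 * inverse (real (Suc k))" by (rule kappa_least)
    hence "kappa f q < e" using k e by simp
    thus "\<exists>q\<in>Q. kappa f q < e" using qQ by blast
  qed
qed

section \<open>Random rational maps\<close>

locale random_rat =
  fixes \<tau> :: "(rsphere \<Rightarrow> rsphere) measure"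
  assumes M1c: "\<tau> \<in> M1c"
begin

sublocale prob_space \<tau>
  using M1c by (simp add: M1c_def)

lemma space_tau: "space \<tau> = Rat"
  using M1c by (simp add: M1c_def)

lemma open_in_sets: "openin rat_top U \<Longrightarrow> U \<in> sets \<tau>"
proof -
  assume U: "openin rat_top U"
  have "{U. openin rat_top U} \<subseteq> Pow Rat"
    using openin_subset[of rat_top] by (auto simp: rat_top_def)
  thus ?thesis using M1c U by (simp add: M1c_def rat_borel_def)
qed

lemma ball_in_sets: "{g \<in> Rat. kappa f g < e} \<in> sets \<tau>"
proof (cases "f \<in> Rat")
  case True
  have "rat.mball f e = {g \<in> Rat. kappa f g < e}" using True by (auto simp: rat.mball_def)
  thus ?thesis using open_in_sets rat.openin_mball unfolding rat_top_def by metis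
next
  case False
  have "openin rat_top {g \<in> Rat. kappa f g < e}"
    unfolding rat_top_def rat.openin_mtopology
  proof (intro conjI allI impI)
    fix g assume g: "g \<in> {g \<in> Rat. kappa f g < e}"
    have "kappa f h < e" if "kappa g h < e - kappa f g" for h
    proof -
      have "kappa f h \<le> kappa f g + kappa g h"
        
      proof (rule kappa_least)
        fix z
        show "dist (f z) (h z) \<le> kappa f g + kappa g h"
          using dist_triangle[of "f z" "h z" "g z"] kappa_upper[of f z g] kappa_upper[of g z h] by linarith
      qed
      thus ?thesis using that by simp
    qed
    thus "\<exists>r>0. rat.mball g r \<subseteq> {g \<in> Rat. kappa f g < e}"
      using g by (intro exI[of _ "e - kappa f g"]) (auto simp: rat.mball_def)
  qed auto
  thus ?thesis by (rule open_in_sets)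
qed

lemma supp_Rat: "g \<in> supp \<tau> \<Longrightarrow> g \<in> Rat"
  by (simp add: supp_def)

lemma supp_mass: "g \<in> supp \<tau> \<Longrightarrow> e > 0 \<Longrightarrow> measure \<tau> {h \<in> Rat. kappa g h < e} > 0"
  unfolding supp_def by (simp add: emeasure_eq_measure)

text \<open>The complement of the support is covered by null balls, and separability of
  \<open>Rat\<close> reduces them to countably many.\<close>

lemma AE_supp: "AE g in \<tau>. g \<in> supp \<tau>"
proof -
  obtain Q where Q: "countable Q" "Q \<subseteq> Rat" "\<And>f e. f \<in> Rat \<Longrightarrow> e > 0 \<Longrightarrow> \<exists>q\<in>Q. kappa f q < e"
    by (rule Rat_separable) metis
  define B where "B = (\<lambda>(q, n::nat). {g \<in> Rat. kappa q g < inverse (real (Suc n))})"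
  define I where "I = {i \<in> Q \<times> UNIV. emeasure \<tau> (B i) = 0}"
  have "countable (Q \<times> (UNIV :: nat set))"
    by (rule countable_SIGMA[OF Q(1)]) (rule countableI_type)
  moreover have "I \<subseteq> Q \<times> UNIV" unfolding I_def by blast
  ultimately have "countable I" by (rule countable_subset[rotated])
  moreover have "B i \<in> null_sets \<tau>" if "i \<in> I" for i
    using that ball_in_sets by (auto simp: I_def B_def null_sets_def split: prod.splits)
  ultimately have "(\<Union>i\<in>I. B i) \<in> null_sets \<tau>" by (intro null_sets_UN') auto
  moreover have "{g \<in> space \<tau>. g \<notin> supp \<tau>} \<subseteq> (\<Union>i\<in>I. B i)"
  proof
    fix f assume "f \<in> {g \<in> space \<tau>. g \<notin> supp \<tau>}"
    hence f: "f \<in> Rat" "f \<notin> supp \<tau>" by (auto simp: space_tau)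
    then obtain e where e: "e > 0" "emeasure \<tau> {g \<in> Rat. kappa f g < e} = 0"
      unfolding supp_def by (auto simp: zero_less_iff_neq_zero)
    obtain n where n: "inverse (real (Suc n)) < e/2" using reals_Archimedean[of "e/2"] e by auto
    obtain q where q: "q \<in> Q" "kappa f q < inverse (real (Suc n))"
      using Q(3)[OF f(1), of "inverse (real (Suc n))"] by auto
    have "B (q, n) \<subseteq> {g \<in> Rat. kappa f g < e}"
    proof
      fix g assume "g \<in> B (q, n)"
      hence g: "g \<in> Rat" "kappa q g < inverse (real (Suc n))" by (auto simp: B_def)
      have "kappa f g \<le> kappa f q + kappa q g" using f g q Q(2) by (intro rat.triangle) auto
      thus "g \<in> {g \<in> Rat. kappa f g < e}" using g n q by simp
    qed
    hence "emeasure \<tau> (B (q, n)) \<le> emeasure \<tau> {g \<in> Rat. kappa f g < e}"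
      by (intro emeasure_mono ball_in_sets)
    hence "(q, n) \<in> I" using e q by (simp add: I_def)
    moreover have "f \<in> B (q, n)" using f q by (simp add: B_def rat.commute)
    ultimately show "f \<in> (\<Union>i\<in>I. B i)" by blast
  qed
  ultimately show ?thesis by (rule AE_I'[OF _ _])
qed

lemma supp_ne: "supp \<tau> \<noteq> {}"
proof
  assume "supp \<tau> = {}"
  hence "AE g in \<tau>. False" using AE_supp by simp
  thus False by simp
qed

sublocale hol_semigroup "supp \<tau>"
proof
  show "hol g" if "g \<in> supp \<tau>" for g using that supp_Rat Rat_hol by blast
  show "open (g ` U)" if "g \<in> supp \<tau>" "open U" for g U
    using supp_Rat[OF that(1)] rat_map_open that(2) by (auto simp: Rat_def)
  show "supp \<tau> \<noteq> {}" by (rule supp_ne)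
qed

text \<open>Total boundedness of the support gives one modulus of continuity for all generators,
  which Cauchy's estimate improves to a Lipschitz bound for nearby points. For distant points the
  diameter 2 of the sphere suffices.\<close>

lemma uniform_Lipschitz:
  obtains C where "C \<ge> 1" "\<And>g x y. g \<in> supp \<tau> \<Longrightarrow> dist (g x) (g y) \<le> C * dist x y"
proof -
  have "compactin rat_top (supp \<tau>)" using M1c by (simp add: M1c_def)
  hence "rat.mtotally_bounded (supp \<tau>)"
    unfolding rat_top_def by (rule rat.compactin_imp_mtotally_bounded)
  then obtain N where N: "finite N" "N \<subseteq> supp \<tau>" "supp \<tau> \<subseteq> (\<Union>f\<in>N. rat.mball f (1/32))"
    unfolding rat.mtotally_bounded_def by (metis zero_less_divide_1_iff zero_less_numeral)
  have "\<forall>f\<in>N. \<exists>d>0. \<forall>x y. dist x y < d \<longrightarrow> dist (f x) (f y) < 1/32"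
  proof
    fix f assume "f \<in> N"
    hence "continuous_on UNIV f" using N \<Gamma>_hol hol_cont by blast
    from rsphere_unif_cont[OF this, of "1/32"]
    show "\<exists>d>0. \<forall>x y. dist x y < d \<longrightarrow> dist (f x) (f y) < 1/32" by (metis zero_less_divide_1_iff zero_less_numeral)
  qed
  then obtain D where D: "\<And>f. f \<in> N \<Longrightarrow> D f > 0"
    "\<And>f x y. f \<in> N \<Longrightarrow> dist x y < D f \<Longrightarrow> dist (f x) (f y) < 1/32" by metis
  define r where "r = Min (insert (1/4) (D ` N))"
  have r: "r > 0" "r \<le> 1/4" "\<And>f. f \<in> N \<Longrightarrow> r \<le> D f"
  proof -
    have fin: "finite (insert (1/4) (D ` N))" using N(1) by simp
    show "r > 0" unfolding r_def using fin D(1) by (subst Min_gr_iff) auto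
    show "r \<le> 1/4" "\<And>f. f \<in> N \<Longrightarrow> r \<le> D f" unfolding r_def by (intro Min_le fin; simp)+
  qed
  define C where "C = 1 + 16 / r"
  show ?thesis
  proof (rule that[of C])
    fix g x y assume g: "g \<in> supp \<tau>"
    show "dist (g x) (g y) \<le> C * dist x y"
    proof (cases "dist x y < r/8")
      case True
      obtain f where f: "f \<in> N" "kappa f g < 1/32" using N(3) g by auto
      have "dist (g x) (g y) \<le> 100 * (1/8) / r * dist x y"
      proof (rule hol_Schwarz[OF \<Gamma>_hol[OF g] r(1,2)])
        fix u assume "u \<in> ball x r"
        hence "dist (f x) (f u) < 1/32" using D(2)[OF f(1), of x u] r(3)[OF f(1)] by simp
        thus "dist (g x) (g u) \<le> 1/8"
          using dist_triangle4[of "g x" "g u" "f x" "f u"] kappa_upper[of f x g] kappa_upper[of f u g] f(2)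
          by (simp add: dist_commute)
      qed (use True r in auto)
      also have "\<dots> \<le> C * dist x y" using r by (intro mult_right_mono) (auto simp: C_def field_simps)
      finally show ?thesis .
    next
      case False
      have "dist (g x) (g y) \<le> 2" by (rule dist_rsphere_le_2)
      also have "2 \<le> 16 / r * dist x y" using False r by (simp add: field_simps)
      also have "\<dots> \<le> C * dist x y" by (intro mult_right_mono) (auto simp: C_def)
      finally show ?thesis .
    qed
  qed (use r in \<open>auto simp: C_def\<close>)
qed

lemma measurable_kappa:
  fixes \<Phi> :: "(rsphere \<Rightarrow> rsphere) \<Rightarrow> 'b :: metric_space"
  assumes "\<And>g e. g \<in> Rat \<Longrightarrow> e > 0 \<Longrightarrow> \<exists>d>0. \<forall>h\<in>Rat. kappa g h < d \<longrightarrow> dist (\<Phi> g) (\<Phi> h) < e"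
  shows "\<Phi> \<in> borel_measurable \<tau>"
proof (rule borel_measurableI)
  fix S :: "'b set" assume S: "open S"
  have "openin rat_top (\<Phi> -` S \<inter> Rat)"
    unfolding rat_top_def rat.openin_mtopology
  proof (intro conjI allI impI)
    fix g assume g: "g \<in> \<Phi> -` S \<inter> Rat"
    then obtain e where e: "e > 0" "ball (\<Phi> g) e \<subseteq> S" using S open_contains_ball by blast
    obtain d where "d > 0" "\<forall>h\<in>Rat. kappa g h < d \<longrightarrow> dist (\<Phi> g) (\<Phi> h) < e"
      using assms[of g e] g e by blast
    thus "\<exists>r>0. rat.mball g r \<subseteq> \<Phi> -` S \<inter> Rat" using e by (intro exI[of _ d]) (auto simp: subset_iff)
  qed auto
  thus "\<Phi> -` S \<inter> space \<tau> \<in> sets \<tau>" unfolding space_tau by (rule open_in_sets)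
qed

lemma measurable_eval [measurable]: "(\<lambda>g. g x) \<in> borel_measurable \<tau>"
  by (rule measurable_kappa) (metis kappa_upper order_le_less_trans)

section \<open>The transition operator\<close>

text \<open>Elements of C(K) extended by 0 are in general discontinuous on the sphere; bounded Borel
  functions comprise them as well as the continuous functions and can be integrated along
  \<tau>.\<close>

definition bm :: "(rsphere \<Rightarrow> complex) \<Rightarrow> bool" where
  "bm \<phi> \<longleftrightarrow> \<phi> \<in> borel_measurable borel \<and> (\<exists>B. \<forall>z. cmod (\<phi> z) \<le> B)"

lemma bm_integrable: "bm \<phi> \<Longrightarrow> integrable \<tau> (\<lambda>g. \<phi> (g x))"
  unfolding bm_def
  by (elim conjE exE, rule integrable_const_bound) (auto intro: measurable_compose[OF measurable_eval])

lemma continuous_on_closed_bm: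
  assumes "continuous_on K \<phi>" "closed K" "\<And>z. z \<notin> K \<Longrightarrow> \<phi> z = 0"
  shows "bm \<phi>"
  unfolding bm_def
proof
  have "(\<lambda>x. indicat_real K x *\<^sub>R \<phi> x) \<in> borel_measurable borel"
    by (rule borel_measurable_continuous_on_indicator[OF _ assms(1)]) (use assms(2) in simp)
  also have "(\<lambda>x. indicat_real K x *\<^sub>R \<phi> x) = \<phi>" using assms(3) by (auto simp: indicator_def)
  finally show "\<phi> \<in> borel_measurable borel" .
  have "bounded (\<phi> ` K)"
    by (intro compact_imp_bounded compact_continuous_image assms compact_rsphere)
  then obtain B where "\<And>z. z \<in> K \<Longrightarrow> cmod (\<phi> z) \<le> B" by (auto simp: bounded_iff)
  hence "cmod (\<phi> z) \<le> max B 0" for z using assms(3)[of z] by (cases "z \<in> K") (auto simp: le_max_iff_disj)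
  thus "\<exists>B. \<forall>z. cmod (\<phi> z) \<le> B" by blast
qed

lemma continuous_bm: "continuous_on UNIV \<phi> \<Longrightarrow> bm \<phi>"
  by (rule continuous_on_closed_bm) auto

lemma Mop_add: "bm \<phi> \<Longrightarrow> bm \<psi> \<Longrightarrow> Mop \<tau> (\<lambda>z. \<phi> z + \<psi> z) x = Mop \<tau> \<phi> x + Mop \<tau> \<psi> x"
  unfolding Mop_def by (intro Bochner_Integration.integral_add bm_integrable)

lemma Mop_diff: "bm \<phi> \<Longrightarrow> bm \<psi> \<Longrightarrow> Mop \<tau> (\<lambda>z. \<phi> z - \<psi> z) x = Mop \<tau> \<phi> x - Mop \<tau> \<psi> x"
  unfolding Mop_def by (intro Bochner_Integration.integral_diff bm_integrable)

lemma Mop_scale: "Mop \<tau> (\<lambda>z. c * \<phi> z) x = c * Mop \<tau> \<phi> x"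
  unfolding Mop_def by simp

text \<open>Bounds on the support suffice, as it has full measure. The event \<open>U\<close>
  carries the better bound \<open>B\<close>; in this form positive probability enters the estimates
  below.\<close>

lemma norm_integral_split:
  fixes f :: "(rsphere \<Rightarrow> rsphere) \<Rightarrow> complex"
  assumes f: "integrable \<tau> f" and A: "\<And>g. g \<in> supp \<tau> \<Longrightarrow> cmod (f g) \<le> A"
    and U: "U \<in> sets \<tau>" and B: "\<And>g. g \<in> supp \<tau> \<Longrightarrow> g \<in> U \<Longrightarrow> cmod (f g) \<le> B"
  shows "cmod (integral\<^sup>L \<tau> f) \<le> measure \<tau> U * B + (1 - measure \<tau> U) * A"
proof -
  have "cmod (integral\<^sup>L \<tau> f) \<le> (\<integral>g. cmod (f g) \<partial>\<tau>)" by (rule integral_norm_bound)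
  also have "\<dots> \<le> (\<integral>g. indicat_real U g * (B - A) + A \<partial>\<tau>)"
  proof (rule integral_mono_AE)
    show "AE g in \<tau>. cmod (f g) \<le> indicat_real U g * (B - A) + A"
      using AE_supp by eventually_elim (use A B in \<open>auto simp: indicator_def\<close>)
    show "integrable \<tau> (\<lambda>g. indicat_real U g * (B - A) + A)"
      using U by (intro Bochner_Integration.integrable_add integrable_mult_left integrable_const)
        (auto simp: integrable_indicator_iff emeasure_eq_measure)
  qed (use f in simp)
  also have "\<dots> = measure \<tau> U * (B - A) + A"
    using U by (subst Bochner_Integration.integral_add)
      (auto simp: integrable_indicator_iff emeasure_eq_measure prob_space)
  finally show ?thesis by (simp add: algebra_simps)
qed

lemma norm_integral_le:
  fixes f :: "(rsphere \<Rightarrow> rsphere) \<Rightarrow> complex"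
  assumes f: "integrable \<tau> f" and A: "\<And>g. g \<in> supp \<tau> \<Longrightarrow> cmod (f g) \<le> A"
  shows "cmod (integral\<^sup>L \<tau> f) \<le> A"
  using norm_integral_split[OF f A, of "{}" 0] by simp

text \<open>Strict convexity of the disc.\<close>

lemma integral_extremal:
  fixes f :: "(rsphere \<Rightarrow> rsphere) \<Rightarrow> complex"
  assumes f: "integrable \<tau> f" and A: "\<And>g. g \<in> supp \<tau> \<Longrightarrow> cmod (f g) \<le> A"
    and eq: "cmod (integral\<^sup>L \<tau> f) = A"
    and cont: "\<And>g e. g \<in> supp \<tau> \<Longrightarrow> e > 0 \<Longrightarrow> \<exists>d>0. \<forall>h\<in>supp \<tau>. kappa g h < d \<longrightarrow> cmod (f g - f h) < e"
    and g: "g \<in> supp \<tau>"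
  shows "f g = integral\<^sup>L \<tau> f"
proof (rule ccontr)
  define I where "I = integral\<^sup>L \<tau> f"
  assume "f g \<noteq> integral\<^sup>L \<tau> f"
  hence ne: "f g - I \<noteq> 0" by (simp add: I_def)
  \<comment> \<open>\<open>h\<close> has the same integral as \<open>f\<close> and the same bound
    \<open>A\<close> on the support. By the parallelogram law it is strictly smaller at
    \<open>g\<close>, and by continuity also on a ball of positive measure, so its integral cannot
    have modulus \<open>A\<close>.\<close>
  define h where "h = (\<lambda>g. (f g + I) / 2)"
  have par: "(cmod (u + v))\<^sup>2 + (cmod (u - v))\<^sup>2 = 2 * (cmod u)\<^sup>2 + 2 * (cmod v)\<^sup>2" for u v
    unfolding cmod_power2 by (simp add: power2_eq_square algebra_simps)
  have A0: "A \<ge> 0" using eq norm_ge_zero by blast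
  have "(cmod (f g + I))\<^sup>2 < (2 * A)\<^sup>2"
  proof -
    have "(cmod (f g))\<^sup>2 \<le> A\<^sup>2" by (intro power_mono A g) simp
    moreover have "(cmod (f g - I))\<^sup>2 > 0" using ne by simp
    moreover have "(cmod I)\<^sup>2 = A\<^sup>2" using eq by (simp add: I_def)
    moreover have "(2 * A)\<^sup>2 = 4 * A\<^sup>2" by (simp add: power_mult_distrib)
    ultimately show ?thesis using par[of "f g" I] by linarith
  qed
  hence "cmod (f g + I) < 2 * A" by (rule power_less_imp_less_base) (use A0 in simp)
  hence hg: "cmod (h g) < A" by (simp add: h_def norm_divide)
  obtain d where d: "d > 0" "\<forall>k\<in>supp \<tau>. kappa g k < d \<longrightarrow> cmod (f g - f k) < A - cmod (h g)"
    using cont[OF g, of "A - cmod (h g)"] hg by auto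
  define B where "B = (A + cmod (h g)) / 2"
  define U where "U = {k \<in> Rat. kappa g k < d}"
  have "cmod (integral\<^sup>L \<tau> h) \<le> measure \<tau> U * B + (1 - measure \<tau> U) * A"
  proof (rule norm_integral_split)
    show "integrable \<tau> h" unfolding h_def using f by simp
    show "U \<in> sets \<tau>" unfolding U_def by (rule ball_in_sets)
    fix k assume k: "k \<in> supp \<tau>"
    have "cmod (f k + I) \<le> cmod (f k) + cmod I" by (rule norm_triangle_ineq)
    thus "cmod (h k) \<le> A" using A[OF k] eq by (simp add: h_def I_def norm_divide)
    assume "k \<in> U"
    hence "cmod (f g - f k) < A - cmod (h g)" using d k by (simp add: U_def)
    moreover have "cmod (h k) \<le> cmod (h g) + cmod (f g - f k) / 2"
    proof -
      have "h k = h g - (f g - f k) / 2" by (simp add: h_def field_simps)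
      thus ?thesis using norm_triangle_ineq4[of "h g" "(f g - f k) / 2"] by (simp add: norm_divide)
    qed
    ultimately show "cmod (h k) \<le> B" by (simp add: B_def field_simps)
  qed
  moreover have "integral\<^sup>L \<tau> h = I" unfolding h_def using f by (simp add: I_def prob_space)
  moreover have "measure \<tau> U * B < measure \<tau> U * A"
    using supp_mass[OF g d(1)] hg by (intro mult_strict_left_mono) (auto simp: B_def U_def)
  ultimately show False using eq by (simp add: I_def algebra_simps)
qed

end

context random_rat
begin

lemma Mop_diff_bound:
  assumes "bm \<phi>" "\<And>g. g \<in> supp \<tau> \<Longrightarrow> cmod (\<phi> (g x) - \<phi> (g y)) \<le> A"
  shows "cmod (Mop \<tau> \<phi> x - Mop \<tau> \<phi> y) \<le> A"
proof -
  have "Mop \<tau> \<phi> x - Mop \<tau> \<phi> y = (\<integral>g. \<phi> (g x) - \<phi> (g y) \<partial>\<tau>)"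
    unfolding Mop_def by (intro Bochner_Integration.integral_diff[symmetric] bm_integrable assms(1))
  also have "cmod \<dots> \<le> A"
    by (intro norm_integral_le Bochner_Integration.integrable_diff bm_integrable assms)
  finally show ?thesis .
qed

lemma Mop_bound:
  assumes "bm \<phi>" "\<And>g. g \<in> supp \<tau> \<Longrightarrow> cmod (\<phi> (g x)) \<le> A"
  shows "cmod (Mop \<tau> \<phi> x) \<le> A"
  unfolding Mop_def by (intro norm_integral_le bm_integrable assms)

lemma Mop_continuous_on:
  assumes K: "closed K" "\<And>g. g \<in> supp \<tau> \<Longrightarrow> g ` K \<subseteq> K"
    and \<phi>: "continuous_on K \<phi>" "bm \<phi>"
  shows "continuous_on K (Mop \<tau> \<phi>)"
  unfolding continuous_on_iff
proof (intro ballI allI impI)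
  fix x and e :: real assume x: "x \<in> K" and e: "e > 0"
  obtain d where d: "d > 0" "\<And>x y. x \<in> K \<Longrightarrow> y \<in> K \<Longrightarrow> dist y x < d \<Longrightarrow> dist (\<phi> y) (\<phi> x) < e/2"
    using compact_uniformly_continuous[OF \<phi>(1) compact_rsphere[OF K(1)]] e
    unfolding uniformly_continuous_on_def by (metis half_gt_zero)
  obtain C where C: "C \<ge> 1" "\<And>g x y. g \<in> supp \<tau> \<Longrightarrow> dist (g x) (g y) \<le> C * dist x y"
    by (rule uniform_Lipschitz) metis
  have "dist (Mop \<tau> \<phi> y) (Mop \<tau> \<phi> x) < e" if y: "y \<in> K" "dist y x < d / C" for y
  proof -
    have "cmod (Mop \<tau> \<phi> y - Mop \<tau> \<phi> x) \<le> e/2"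
    proof (rule Mop_diff_bound[OF \<phi>(2)])
      fix g assume g: "g \<in> supp \<tau>"
      have "dist (g y) (g x) \<le> C * dist y x" by (rule C(2)[OF g])
      also have "\<dots> < d" using y C(1) by (simp add: field_simps)
      finally have "dist (\<phi> (g y)) (\<phi> (g x)) < e/2" using d(2) K(2)[OF g] x y by blast
      thus "cmod (\<phi> (g y) - \<phi> (g x)) \<le> e/2" by (simp add: dist_norm)
    qed
    thus ?thesis using e by (simp add: dist_norm)
  qed
  thus "\<exists>d>0. \<forall>y\<in>K. dist y x < d \<longrightarrow> dist (Mop \<tau> \<phi> y) (Mop \<tau> \<phi> x) < e"
    using d(1) C(1) by (intro exI[of _ "d / C"]) auto
qed

section \<open>Iterates of the transition operator\<close>

abbreviation Mn where "Mn n \<equiv> Mop \<tau> ^^ n"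

lemma Mn_continuous: "continuous_on UNIV \<phi> \<Longrightarrow> continuous_on UNIV (Mn n \<phi>)"
  by (induction n) (auto intro!: Mop_continuous_on continuous_bm)

lemma Mn_bm: "continuous_on UNIV \<phi> \<Longrightarrow> bm (Mn n \<phi>)"
  by (intro continuous_bm Mn_continuous)

lemma Mn_add:
  assumes "continuous_on UNIV \<phi>" "continuous_on UNIV \<psi>"
  shows "Mn n (\<lambda>z. \<phi> z + \<psi> z) = (\<lambda>z. Mn n \<phi> z + Mn n \<psi> z)"
  by (induction n) (auto simp: Mop_add Mn_bm assms)

lemma Mn_diff:
  assumes "continuous_on UNIV \<phi>" "continuous_on UNIV \<psi>"
  shows "Mn n (\<lambda>z. \<phi> z - \<psi> z) = (\<lambda>z. Mn n \<phi> z - Mn n \<psi> z)"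
  by (induction n) (auto simp: Mop_diff Mn_bm assms)

lemma Mn_scale: "Mn n (\<lambda>z. c * \<phi> z) = (\<lambda>z. c * Mn n \<phi> z)"
  by (induction n) (auto simp: Mop_scale)

lemma Mn_bound:
  assumes "continuous_on UNIV \<phi>" "\<And>z. cmod (\<phi> z) \<le> A"
  shows "cmod (Mn n \<phi> z) \<le> A"
  using assms(2) by (induction n arbitrary: z) (auto intro!: Mop_bound Mn_bm assms(1))

lemma Mn_diff_bound:
  assumes "continuous_on UNIV \<phi>" "\<And>w. w \<in> words n \<Longrightarrow> cmod (\<phi> (w x) - \<phi> (w y)) \<le> A"
  shows "cmod (Mn n \<phi> x - Mn n \<phi> y) \<le> A"
  using assms(2)
proof (induction n arbitrary: x y)
  case (Suc n)
  have "cmod (Mop \<tau> (Mn n \<phi>) x - Mop \<tau> (Mn n \<phi>) y) \<le> A"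
  proof (rule Mop_diff_bound[OF Mn_bm[OF assms(1)]])
    fix g assume g: "g \<in> supp \<tau>"
    show "cmod (Mn n \<phi> (g x) - Mn n \<phi> (g y)) \<le> A"
      by (rule Suc.IH) (use Suc.prems[OF words_SucI[OF _ g]] in simp)
  qed
  thus ?case by simp
qed simp

text \<open>\<open>p\<close> bounds from below the probability that \<open>n\<close> random letters
  follow those of \<open>v\<close> so closely that the composed word is within \<epsilon> of
  \<open>v\<close>. It is found by induction, one integral per letter, and depends neither on the
  function nor on the two points.\<close>

lemma word_probability:
  assumes "v \<in> words n" "\<epsilon> > 0"
  obtains p where "0 < p" "p \<le> 1"
    "\<And>\<phi> x y A B. continuous_on UNIV \<phi> \<Longrightarrow> B \<le> A \<Longrightarrow>
       (\<And>w. w \<in> words n \<Longrightarrow> cmod (\<phi> (w x) - \<phi> (w y)) \<le> A) \<Longrightarrow>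
       (\<And>w. w \<in> words n \<Longrightarrow> (\<And>z. dist (v z) (w z) < \<epsilon>) \<Longrightarrow> cmod (\<phi> (w x) - \<phi> (w y)) \<le> B) \<Longrightarrow>
       cmod (Mn n \<phi> x - Mn n \<phi> y) \<le> p * B + (1 - p) * A"
  using assms
proof (induction n arbitrary: v \<epsilon> thesis)
  case 0
  show ?case by (rule "0.prems"(1)[of 1]) (use 0 in auto)
next
  case (Suc n)
  obtain v1 \<gamma> where v: "v = v1 \<circ> \<gamma>" "v1 \<in> words n" "\<gamma> \<in> supp \<tau>"
    using Suc.prems(2) by (rule words_SucE)
  have e2: "\<epsilon>/2 > 0" using Suc.prems by simp
  obtain p where p: "0 < p" "p \<le> 1"
    "\<And>\<phi> x y A B. continuous_on UNIV \<phi> \<Longrightarrow> B \<le> A \<Longrightarrow>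
       (\<And>w. w \<in> words n \<Longrightarrow> cmod (\<phi> (w x) - \<phi> (w y)) \<le> A) \<Longrightarrow>
       (\<And>w. w \<in> words n \<Longrightarrow> (\<And>z. dist (v1 z) (w z) < \<epsilon>/2) \<Longrightarrow> cmod (\<phi> (w x) - \<phi> (w y)) \<le> B) \<Longrightarrow>
       cmod (Mn n \<phi> x - Mn n \<phi> y) \<le> p * B + (1 - p) * A"
    using Suc.IH[OF _ v(2) e2] by metis
  \<comment> \<open>One half of \<epsilon> absorbs the change of the first letter, the other is left
    to the remaining ones.\<close>
  obtain d where d: "d > 0" "\<And>x y. dist x y < d \<Longrightarrow> dist (v1 x) (v1 y) < \<epsilon>/2"
    using rsphere_unif_cont[OF words_cont[OF v(2)] e2] by metis
  define U where "U = {g \<in> Rat. kappa \<gamma> g < d}"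
  define q where "q = measure \<tau> U"
  have q: "0 < q" "q \<le> 1" using supp_mass[OF v(3) d(1)] by (auto simp: q_def U_def)
  show ?case
  proof (rule Suc.prems(1)[of "q * p"])
    show "0 < q * p" "q * p \<le> 1" using p q by (auto intro: mult_le_one)
    fix \<phi> x y A B
    assume \<phi>: "continuous_on UNIV \<phi>" and AB: "(B::real) \<le> A"
      and A: "\<And>w. w \<in> words (Suc n) \<Longrightarrow> cmod (\<phi> (w x) - \<phi> (w y)) \<le> A"
      and B: "\<And>w. w \<in> words (Suc n) \<Longrightarrow> (\<And>z. dist (v z) (w z) < \<epsilon>) \<Longrightarrow> cmod (\<phi> (w x) - \<phi> (w y)) \<le> B"
    have A': "cmod (\<phi> (w (g x)) - \<phi> (w (g y))) \<le> A" if "g \<in> supp \<tau>" "w \<in> words n" for g w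
      using A[OF words_SucI[OF that(2,1)]] by simp
    have "Mn (Suc n) \<phi> x - Mn (Suc n) \<phi> y = (\<integral>g. Mn n \<phi> (g x) - Mn n \<phi> (g y) \<partial>\<tau>)"
      unfolding funpow.simps comp_def Mop_def[of \<tau> "Mn n \<phi>"]
      by (intro Bochner_Integration.integral_diff[symmetric] bm_integrable Mn_bm \<phi>)
    also have "cmod \<dots> \<le> measure \<tau> U * (p * B + (1 - p) * A) + (1 - measure \<tau> U) * A"
    proof (rule norm_integral_split)
      show "integrable \<tau> (\<lambda>g. Mn n \<phi> (g x) - Mn n \<phi> (g y))"
        by (intro Bochner_Integration.integrable_diff bm_integrable Mn_bm \<phi>)
      show "U \<in> sets \<tau>" unfolding U_def by (rule ball_in_sets)
      fix g assume g: "g \<in> supp \<tau>"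
      show "cmod (Mn n \<phi> (g x) - Mn n \<phi> (g y)) \<le> A"
        by (rule Mn_diff_bound[OF \<phi>]) (rule A'[OF g])
      assume gU: "g \<in> U"
      show "cmod (Mn n \<phi> (g x) - Mn n \<phi> (g y)) \<le> p * B + (1 - p) * A"
      proof (rule p(3)[OF \<phi> AB])
        fix w assume w: "w \<in> words n"
        show "cmod (\<phi> (w (g x)) - \<phi> (w (g y))) \<le> A" by (rule A'[OF g w])
        assume near: "\<And>z. dist (v1 z) (w z) < \<epsilon>/2"
        have "cmod (\<phi> ((w \<circ> g) x) - \<phi> ((w \<circ> g) y)) \<le> B"
        proof (rule B[OF words_SucI[OF w g]])
          fix z
          have "dist (\<gamma> z) (g z) < d" using kappa_upper[of \<gamma> z g] gU by (simp add: U_def)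
          hence "dist (v1 (\<gamma> z)) (v1 (g z)) < \<epsilon>/2" by (rule d(2))
          thus "dist (v z) ((w \<circ> g) z) < \<epsilon>"
            using near[of "g z"] dist_triangle[of "v1 (\<gamma> z)" "w (g z)" "v1 (g z)"] by (simp add: v(1))
        qed
        thus "cmod (\<phi> (w (g x)) - \<phi> (w (g y))) \<le> B" by simp
      qed
    qed
    also have "\<dots> = q * p * B + (1 - q * p) * A" by (simp add: q_def algebra_simps)
    finally show "cmod (Mn (Suc n) \<phi> x - Mn (Suc n) \<phi> y) \<le> q * p * B + (1 - q * p) * A" .
  qed
qed

end

section \<open>The Doeblin--Fortet inequality\<close>

definition hl :: "real \<Rightarrow> real \<Rightarrow> (rsphere \<Rightarrow> complex) \<Rightarrow> bool" where
  "hl \<alpha> H \<phi> \<longleftrightarrow> (\<forall>x y. cmod (\<phi> x - \<phi> y) \<le> H * dist x y powr \<alpha>)"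

text \<open>One \<open>d\<close> serves all functions with the constant \<open>H\<close>; this is
  the equicontinuity behind the compactness arguments below. The denominator |H| + 1 is positive
  whatever \<open>H\<close> is.\<close>

lemma hl_modulus:
  assumes "\<alpha> > 0" "e > 0"
  obtains d where "d > 0" "\<And>\<phi> x y. hl \<alpha> H \<phi> \<Longrightarrow> dist x y < d \<Longrightarrow> dist (\<phi> x) (\<phi> y) < e"
proof -
  define d where "d = (e / (\<bar>H\<bar> + 1)) powr (1/\<alpha>)"
  have q: "e / (\<bar>H\<bar> + 1) > 0" using assms(2) by simp
  show ?thesis
  proof (rule that[of d])
    show "d > 0" using q unfolding d_def by (metis powr_gt_zero less_irrefl)
    fix \<phi> and x y :: rsphere assume \<phi>: "hl \<alpha> H \<phi>" and xy: "dist x y < d"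
    have "dist x y powr \<alpha> \<le> d powr \<alpha>" using xy assms(1) by (intro powr_mono2) auto
    also have "d powr \<alpha> = e / (\<bar>H\<bar> + 1)" using q assms by (simp add: d_def powr_powr)
    finally have le: "(\<bar>H\<bar> + 1) * dist x y powr \<alpha> \<le> e"
      by (simp add: field_simps)
    show "dist (\<phi> x) (\<phi> y) < e"
    proof (cases "x = y")
      case False
      have "cmod (\<phi> x - \<phi> y) \<le> H * dist x y powr \<alpha>" using \<phi> by (simp add: hl_def)
      also have "\<dots> < (\<bar>H\<bar> + 1) * dist x y powr \<alpha>"
        using False by (intro mult_strict_right_mono) auto
      finally show ?thesis using le by (simp add: dist_norm)
    qed (use assms in simp)
  qed
qed

lemma hl_continuous:
  assumes "hl \<alpha> H \<phi>" "\<alpha> > 0"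
  shows "continuous_on A \<phi>"
  unfolding continuous_on_iff
proof (intro ballI allI impI)
  fix x and e :: real assume "e > 0"
  then obtain d where "d > 0" "\<And>\<phi> x y. hl \<alpha> H \<phi> \<Longrightarrow> dist x y < d \<Longrightarrow> dist (\<phi> x) (\<phi> y) < e"
    using hl_modulus[OF assms(2)] by metis
  thus "\<exists>d>0. \<forall>y\<in>A. dist y x < d \<longrightarrow> dist (\<phi> y) (\<phi> x) < e" using assms(1) by blast
qed

locale mean_stable = random_rat +
  assumes ker: "kernel_julia (Gtau \<tau>) = {}"
    and J_ne: "julia (Gtau \<tau>) \<noteq> {}"
    and Stau_fatou: "Stau \<tau> \<subseteq> fatou (Gtau \<tau>)"
begin

lemma R: "Rec = {}"
  using Rec_empty ker J_ne by (simp add: Gtau_def)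

lemma SF: "S \<subseteq> F"
  using Stau_fatou by (simp add: Gtau_def Stau_def)

lemmas SC = compact_S[OF SF R]

definition lipC :: real where
  "lipC = (SOME C. C \<ge> 1 \<and> (\<forall>g\<in>supp \<tau>. \<forall>x y. dist (g x) (g y) \<le> C * dist x y))"

lemma lipC: "lipC \<ge> 1" "g \<in> supp \<tau> \<Longrightarrow> dist (g x) (g y) \<le> lipC * dist x y"
proof -
  have "\<exists>C. C \<ge> 1 \<and> (\<forall>g\<in>supp \<tau>. \<forall>x y. dist (g x) (g y) \<le> C * dist x y)"
    using uniform_Lipschitz by metis
  from someI_ex[OF this] show "lipC \<ge> 1" "g \<in> supp \<tau> \<Longrightarrow> dist (g x) (g y) \<le> lipC * dist x y"
    unfolding lipC_def by blast+
qed

lemma words_lip: "w \<in> words n \<Longrightarrow> dist (w x) (w y) \<le> lipC ^ n * dist x y"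
proof (induction n arbitrary: w x y)
  case (Suc n)
  then obtain v g where v: "w = v \<circ> g" "v \<in> words n" "g \<in> supp \<tau>" by (auto elim: words_SucE)
  have "dist (v (g x)) (v (g y)) \<le> lipC ^ n * dist (g x) (g y)" by (rule Suc.IH[OF v(2)])
  also have "\<dots> \<le> lipC ^ n * (lipC * dist x y)"
    using lipC(1) lipC(2)[OF v(3)] by (intro mult_left_mono) auto
  finally show ?case by (simp add: v(1) mult_ac)
qed simp

text \<open>A neighbourhood of the diagonal of the attractor, given by pairs of nearby points and their
  images, on which the semigroup does not expand \<^term>\<open>ds\<close> and contracts it with positive probability.\<close>

lemma attracting_pairs:
  obtains P :: "rsphere \<Rightarrow> rsphere \<Rightarrow> bool" and \<delta> C n p where
    "\<delta> > 0" "C \<ge> 1" "0 < p" "p \<le> 1"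
    "\<And>x y n w. P x y \<Longrightarrow> w \<in> words n \<Longrightarrow> P (w x) (w y)"
    "\<And>x y. P x y \<Longrightarrow> ds x y \<le> C * dist x y"
    "\<And>z x y. z \<in> S \<Longrightarrow> x \<in> ball z \<delta> \<Longrightarrow> y \<in> ball z \<delta> \<Longrightarrow> P x y"
    "\<And>\<phi> x y A B. continuous_on UNIV \<phi> \<Longrightarrow> B \<le> A \<Longrightarrow> P x y \<Longrightarrow>
       (\<And>w. w \<in> words n \<Longrightarrow> cmod (\<phi> (w x) - \<phi> (w y)) \<le> A) \<Longrightarrow>
       (\<And>w. w \<in> words n \<Longrightarrow> ds (w x) (w y) \<le> ds x y / 2 \<Longrightarrow> cmod (\<phi> (w x) - \<phi> (w y)) \<le> B) \<Longrightarrow>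
       cmod (Mn n \<phi> x - Mn n \<phi> y) \<le> p * B + (1 - p) * A"
proof -
  obtain \<delta>1 C where C: "\<delta>1 > 0" "C \<ge> 1"
    "\<And>z y y'. z \<in> S \<Longrightarrow> y \<in> ball z \<delta>1 \<Longrightarrow> y' \<in> ball z \<delta>1 \<Longrightarrow> ds y y' \<le> C * dist y y'"
    by (rule equi_Lipschitz[OF SC SF]) metis
  obtain \<delta>2 where \<delta>2: "\<delta>2 > 0"
    "\<And>\<eta>. \<eta> > 0 \<Longrightarrow> \<exists>n v \<epsilon>. v \<in> words (Suc n) \<and> \<epsilon> > 0 \<and>
       (\<forall>v'. hol v' \<longrightarrow> (\<forall>x. dist (v x) (v' x) < \<epsilon>) \<longrightarrow>
         (\<forall>z\<in>S. \<forall>y\<in>ball z \<delta>2. \<forall>y'\<in>ball z \<delta>2. dist (v' y) (v' y') \<le> \<eta> * dist y y'))"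
    by (rule robust_contraction[OF SC SF S_inv R]) blast+
  define \<delta> where "\<delta> = min \<delta>1 \<delta>2"
  \<comment> \<open>A word sends the ball of radius \<open>\<delta>3\<close> about \<open>z\<close>
    into the ball of radius \<open>C * \<delta>3 < \<delta>\<close> about the image of
    \<open>z\<close>, so pairs starting there never leave the region in which both estimates
    hold.\<close>
  define \<delta>3 where "\<delta>3 = \<delta> / (2 * C)"
  have \<delta>: "\<delta> > 0" "\<delta>3 > 0" "\<delta>3 \<le> \<delta>" "C * \<delta>3 < \<delta>"
  proof -
    show 1: "\<delta> > 0" using C(1) \<delta>2(1) by (simp add: \<delta>_def)
    thus 2: "\<delta>3 > 0" using C(2) by (simp add: \<delta>3_def)
    have e: "C * \<delta>3 = \<delta> / 2" using C(2) by (simp add: \<delta>3_def)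
    thus "C * \<delta>3 < \<delta>" using 1 by simp
    have "1 * \<delta>3 \<le> C * \<delta>3" using C(2) 2 by (intro mult_right_mono) auto
    thus "\<delta>3 \<le> \<delta>" using e 1 by simp
  qed
  \<comment> \<open>Closing up under words makes \<open>P\<close> forward invariant by construction;
    pairs of points in a common small ball about \<open>S\<close> need not have this
    property.\<close>
  define P where "P = (\<lambda>x y. \<exists>z\<in>S. \<exists>x0\<in>ball z \<delta>3. \<exists>y0\<in>ball z \<delta>3. \<exists>n. \<exists>w\<in>words n. x = w x0 \<and> y = w y0)"
  have Pball: "\<exists>z\<in>S. x \<in> ball z \<delta> \<and> y \<in> ball z \<delta>" if Pxy: "P x y" for x y
  proof -
    obtain z x0 y0 n w where 1: "z \<in> S" "x0 \<in> ball z \<delta>3" "y0 \<in> ball z \<delta>3" "w \<in> words n" "x = w x0" "y = w y0"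
      using Pxy unfolding P_def by blast
    have *: "w u \<in> ball (w z) \<delta>" if "u \<in> ball z \<delta>3" for u
    proof -
      have "dist (w z) (w u) \<le> ds z u" by (rule ds_upper[OF 1(4)])
      also have "\<dots> \<le> C * dist z u" using that \<delta> by (intro C(3)[OF 1(1)]) (auto simp: \<delta>_def)
      also have "\<dots> \<le> C * \<delta>3" using that C by (intro mult_left_mono) auto
      finally show ?thesis using \<delta> by simp
    qed
    have "w z \<in> S" by (rule words_inv[OF 1(4,1) S_inv])
    thus ?thesis using *[OF 1(2)] *[OF 1(3)] 1 by blast
  qed
  have PC: "ds x y \<le> C * dist x y" if "P x y" for x y
    using Pball[OF that] C(3) by (auto simp: \<delta>_def)
  have Pw: "P (w x) (w y)" if Pxy: "P x y" and w: "w \<in> words n" for x y n w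
  proof -
    obtain z x0 y0 m u where 1: "z \<in> S" "x0 \<in> ball z \<delta>3" "y0 \<in> ball z \<delta>3" "u \<in> words m" "x = u x0" "y = u y0"
      using Pxy unfolding P_def by blast
    have "w \<circ> u \<in> words (n + m)" by (rule words_add[OF 1(4) w])
    moreover have "w x = (w \<circ> u) x0" "w y = (w \<circ> u) y0" using 1 by simp_all
    ultimately show ?thesis unfolding P_def using 1(1-3) by blast
  qed
  have Pid: "P x y" if "z \<in> S" "x \<in> ball z \<delta>3" "y \<in> ball z \<delta>3" for x y z
    unfolding P_def using that by (intro bexI[of _ z] bexI[of _ x] bexI[of _ y] exI[of _ 0]) auto
  \<comment> \<open>Contraction by 1/(2C) in \<open>dist\<close> becomes the factor 1/2 in
    \<open>ds\<close>, because \<open>ds\<close> is at most \<open>C\<close> times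
    \<open>dist\<close> on \<open>P\<close> and never below \<open>dist\<close>.\<close>
  have half: "1 / (2 * C) > 0" using C by simp
  obtain n v \<epsilon> where v12: "v \<in> words (Suc n)" "\<epsilon> > 0"
    and v0: "\<forall>v'. hol v' \<longrightarrow> (\<forall>x. dist (v x) (v' x) < \<epsilon>) \<longrightarrow>
       (\<forall>z\<in>S. \<forall>y\<in>ball z \<delta>2. \<forall>y'\<in>ball z \<delta>2. dist (v' y) (v' y') \<le> 1 / (2 * C) * dist y y')"
    using \<delta>2(2)[OF half] by (elim exE conjE)
  have v3: "dist (v' y) (v' y') \<le> 1 / (2 * C) * dist y y'"
    if "hol v'" "\<And>x. dist (v x) (v' x) < \<epsilon>" "z \<in> S" "y \<in> ball z \<delta>2" "y' \<in> ball z \<delta>2" for v' z y y'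
    using v0[rule_format, OF that] .
  note v = v12 v3
  obtain p where p: "0 < p" "p \<le> 1"
    "\<And>\<phi> x y A B. continuous_on UNIV \<phi> \<Longrightarrow> B \<le> A \<Longrightarrow>
       (\<And>w. w \<in> words (Suc n) \<Longrightarrow> cmod (\<phi> (w x) - \<phi> (w y)) \<le> A) \<Longrightarrow>
       (\<And>w. w \<in> words (Suc n) \<Longrightarrow> (\<And>z. dist (v z) (w z) < \<epsilon>) \<Longrightarrow> cmod (\<phi> (w x) - \<phi> (w y)) \<le> B) \<Longrightarrow>
       cmod (Mn (Suc n) \<phi> x - Mn (Suc n) \<phi> y) \<le> p * B + (1 - p) * A"
    by (rule word_probability[OF v(1,2)]) metis
  show ?thesis
  proof (rule that[of \<delta>3 C p P "Suc n"])
    show "P (w x) (w y)" if "P x y" "w \<in> words n" for x y n w using Pw that by blast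
    show "ds x y \<le> C * dist x y" if "P x y" for x y using PC that by blast
    show "P x y" if "z \<in> S" "x \<in> ball z \<delta>3" "y \<in> ball z \<delta>3" for z x y using Pid that by blast
    fix \<phi> x y A B
    assume \<phi>: "continuous_on UNIV \<phi>" and AB: "(B::real) \<le> A" and Pxy: "P x y"
      and A: "\<And>w. w \<in> words (Suc n) \<Longrightarrow> cmod (\<phi> (w x) - \<phi> (w y)) \<le> A"
      and B: "\<And>w. w \<in> words (Suc n) \<Longrightarrow> ds (w x) (w y) \<le> ds x y / 2 \<Longrightarrow> cmod (\<phi> (w x) - \<phi> (w y)) \<le> B"
    show "cmod (Mn (Suc n) \<phi> x - Mn (Suc n) \<phi> y) \<le> p * B + (1 - p) * A"
    proof (rule p(3)[OF \<phi> AB A])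
      fix w assume w: "w \<in> words (Suc n)" and near: "\<And>z. dist (v z) (w z) < \<epsilon>"
      obtain z where z: "z \<in> S" "x \<in> ball z \<delta>" "y \<in> ball z \<delta>" using Pball[OF Pxy] by blast
      have "dist (w x) (w y) \<le> 1 / (2 * C) * dist x y"
        using z by (intro v(3)[OF words_hol[OF w] near z(1)]) (auto simp: \<delta>_def)
      hence "C * dist (w x) (w y) \<le> dist x y / 2" using C by (simp add: field_simps)
      hence "ds (w x) (w y) \<le> ds x y / 2"
        using PC[OF Pw[OF Pxy w]] dist_le_ds[of x y] by linarith
      thus "cmod (\<phi> (w x) - \<phi> (w y)) \<le> B" by (rule B[OF w])
    qed
  qed (rule \<delta>(2) C(2) p(1,2))+
qed

text \<open>A word that leads one point near the attractor leads a neighbourhood of it there, and so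
  do nearby words. Compactness of the sphere yields a common probability and radius; forward
  invariance of \<open>P\<close> allows all words to be padded to a common length.\<close>

lemma reach_attracting_pairs:
  fixes P :: "rsphere \<Rightarrow> rsphere \<Rightarrow> bool"
  assumes \<delta>: "\<delta> > 0"
    and Pw: "\<And>x y n w. P x y \<Longrightarrow> w \<in> words n \<Longrightarrow> P (w x) (w y)"
    and Pid: "\<And>z x y. z \<in> S \<Longrightarrow> x \<in> ball z \<delta> \<Longrightarrow> y \<in> ball z \<delta> \<Longrightarrow> P x y"
  obtains n p \<rho> where "n > 0" "0 < p" "p \<le> 1/2" "\<rho> > 0"
    "\<And>\<phi> x y A B. continuous_on UNIV \<phi> \<Longrightarrow> dist x y < \<rho> \<Longrightarrow>
       (\<And>w. w \<in> words n \<Longrightarrow> cmod (\<phi> (w x) - \<phi> (w y)) \<le> A) \<Longrightarrow>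
       (\<And>w. w \<in> words n \<Longrightarrow> P (w x) (w y) \<Longrightarrow> cmod (\<phi> (w x) - \<phi> (w y)) \<le> B) \<Longrightarrow>
       cmod (Mn n \<phi> x - Mn n \<phi> y) \<le> p * B + (1 - p) * A"
proof -
  have "\<exists>m r p. r > 0 \<and> 0 < p \<and> p \<le> 1 \<and> (\<forall>\<phi> A B. \<forall>x\<in>ball x0 r. \<forall>y\<in>ball x0 r.
       continuous_on UNIV \<phi> \<longrightarrow> B \<le> A \<longrightarrow>
       (\<forall>w\<in>words (Suc m). cmod (\<phi> (w x) - \<phi> (w y)) \<le> A) \<longrightarrow>
       (\<forall>w\<in>words (Suc m). P (w x) (w y) \<longrightarrow> cmod (\<phi> (w x) - \<phi> (w y)) \<le> B) \<longrightarrow>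
       cmod (Mn (Suc m) \<phi> x - Mn (Suc m) \<phi> y) \<le> p * B + (1 - p) * A)" for x0
  proof -
    obtain g z where g: "g \<in> G" "z \<in> S" "dist (g x0) z < \<delta>/2"
      using orbit_reaches_S[of "\<delta>/2" x0] \<delta> by auto
    obtain m where m: "g \<in> words (Suc m)" using G_imp_words[OF g(1)] .
    have \<delta>4: "\<delta>/4 > 0" using \<delta> by simp
    obtain r where r: "r > 0" "\<And>x y. dist x y < r \<Longrightarrow> dist (g x) (g y) < \<delta>/4"
      using rsphere_unif_cont[OF G_cont[OF g(1)] \<delta>4] by metis
    obtain p where p: "0 < p" "p \<le> 1"
      "\<And>\<phi> x y A B. continuous_on UNIV \<phi> \<Longrightarrow> B \<le> A \<Longrightarrow>
       (\<And>w. w \<in> words (Suc m) \<Longrightarrow> cmod (\<phi> (w x) - \<phi> (w y)) \<le> A) \<Longrightarrow>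
       (\<And>w. w \<in> words (Suc m) \<Longrightarrow> (\<And>z. dist (g z) (w z) < \<delta>/4) \<Longrightarrow> cmod (\<phi> (w x) - \<phi> (w y)) \<le> B) \<Longrightarrow>
       cmod (Mn (Suc m) \<phi> x - Mn (Suc m) \<phi> y) \<le> p * B + (1 - p) * A"
      by (rule word_probability[OF m \<delta>4]) metis
    have near: "w x \<in> ball z \<delta>" if w: "\<And>z. dist (g z) (w z) < \<delta>/4" and x: "x \<in> ball x0 r" for w x
    proof -
      have "dist (g x0) (g x) < \<delta>/4" using r(2)[of x0 x] x by simp
      thus ?thesis using w[of x] g(3) dist_triangle4[of z "w x" "g x0" "g x"] by (simp add: dist_commute)
    qed
    have "cmod (Mn (Suc m) \<phi> x - Mn (Suc m) \<phi> y) \<le> p * B + (1 - p) * A"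
      if "x \<in> ball x0 r" "y \<in> ball x0 r" "continuous_on UNIV \<phi>" "B \<le> A"
        "\<forall>w\<in>words (Suc m). cmod (\<phi> (w x) - \<phi> (w y)) \<le> A"
        "\<forall>w\<in>words (Suc m). P (w x) (w y) \<longrightarrow> cmod (\<phi> (w x) - \<phi> (w y)) \<le> B" for \<phi> A B x y
      by (rule p(3)[OF that(3,4)]) (use that Pid[OF g(2)] near in auto)
    thus ?thesis using r(1) p(1,2) by blast
  qed
  then obtain m r p where mrp: "\<And>x0. r x0 > 0" "\<And>x0. 0 < p x0" "\<And>x0. p x0 \<le> 1"
    "\<And>x0 \<phi> A B x y. x \<in> ball x0 (r x0) \<Longrightarrow> y \<in> ball x0 (r x0) \<Longrightarrow>
       continuous_on UNIV \<phi> \<Longrightarrow> B \<le> A \<Longrightarrow>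
       (\<forall>w\<in>words (Suc (m x0)). cmod (\<phi> (w x) - \<phi> (w y)) \<le> A) \<Longrightarrow>
       (\<forall>w\<in>words (Suc (m x0)). P (w x) (w y) \<longrightarrow> cmod (\<phi> (w x) - \<phi> (w y)) \<le> B) \<Longrightarrow>
       cmod (Mn (Suc (m x0)) \<phi> x - Mn (Suc (m x0)) \<phi> y) \<le> p x0 * B + (1 - p x0) * A"
    by metis
  have "(UNIV :: rsphere set) \<subseteq> (\<Union>x\<in>UNIV. ball x (r x / 2))" using mrp(1) by fastforce
  then obtain T where T: "finite T" "UNIV \<subseteq> (\<Union>x\<in>T. ball x (r x / 2))"
    using compactE_image[OF compact_UNIV_rsphere, of UNIV "\<lambda>x. ball x (r x / 2)"] by auto
  have Tne: "T \<noteq> {}" using T(2) by auto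
  define n where "n = Suc (Max (m ` T))"
  \<comment> \<open>The cap 1/2 keeps \<open>1 - p\<close> away from 0 in the later choice of the
    Hoelder exponent.\<close>
  define q where "q = Min (insert (1/2) (p ` T))"
  define \<rho> where "\<rho> = Min ((\<lambda>x. r x / 2) ` T)"
  have q: "0 < q" "q \<le> 1/2" "\<And>t. t \<in> T \<Longrightarrow> q \<le> p t"
  proof -
    have fin: "finite (insert (1/2) (p ` T))" using T by simp
    show "0 < q" unfolding q_def using fin mrp(2) by (subst Min_gr_iff) auto
    show "q \<le> 1/2" "\<And>t. t \<in> T \<Longrightarrow> q \<le> p t" unfolding q_def by (intro Min_le fin; simp)+
  qed
  have \<rho>: "\<rho> > 0" "\<And>t. t \<in> T \<Longrightarrow> \<rho> \<le> r t / 2"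
  proof -
    have fin: "finite ((\<lambda>x. r x / 2) ` T)" using T by simp
    show "\<rho> > 0" unfolding \<rho>_def using fin Tne mrp(1) by (subst Min_gr_iff) auto
    show "\<And>t. t \<in> T \<Longrightarrow> \<rho> \<le> r t / 2" unfolding \<rho>_def by (intro Min_le fin; simp)
  qed
  show ?thesis
  proof (rule that[OF _ q(1,2) \<rho>(1), of n])
    show "n > 0" by (simp add: n_def)
    fix \<phi> x y A B
    assume \<phi>: "continuous_on UNIV \<phi>" and xy: "dist x y < \<rho>"
      and A: "\<And>w. w \<in> words n \<Longrightarrow> cmod (\<phi> (w x) - \<phi> (w y)) \<le> (A::real)"
      and B: "\<And>w. w \<in> words n \<Longrightarrow> P (w x) (w y) \<Longrightarrow> cmod (\<phi> (w x) - \<phi> (w y)) \<le> B"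
    have leA: "cmod (Mn n \<phi> x - Mn n \<phi> y) \<le> A" by (rule Mn_diff_bound[OF \<phi> A])
    show "cmod (Mn n \<phi> x - Mn n \<phi> y) \<le> q * B + (1 - q) * A"
    proof (cases "B \<le> A")
      \<comment> \<open>If \<open>B\<close> exceeds \<open>A\<close>, the trivial bound
        \<open>A\<close> is already below the convex combination.\<close>
      case False
      hence "q * A \<le> q * B" using q by (intro mult_left_mono) auto
      thus ?thesis using leA by (simp add: algebra_simps)
    next
      case AB: True
      obtain t where t: "t \<in> T" "dist t x < r t / 2" using subsetD[OF T(2) UNIV_I, of x] by auto
      have xt: "x \<in> ball t (r t)" using t mrp(1)[of t] by simp
      have yt: "y \<in> ball t (r t)" using t \<rho>(2)[OF t(1)] xy dist_triangle[of t y x] by simp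
      have "m t \<le> Max (m ` T)" using T(1) t(1) by simp
      then obtain k where k: "n = k + Suc (m t)" unfolding n_def
        by (metis add.commute add_Suc_right le_iff_add)
      \<comment> \<open>The surplus \<open>k\<close> letters are drawn after the word of length
        \<open>Suc (m t)\<close>; a pair that has entered \<open>P\<close> stays there.\<close>
      define \<psi> where "\<psi> = Mn k \<phi>"
      have \<psi>: "continuous_on UNIV \<psi>" unfolding \<psi>_def by (rule Mn_continuous[OF \<phi>])
      have MM: "Mn n \<phi> = Mn (Suc (m t)) \<psi>"
        unfolding k \<psi>_def add.commute[of k] funpow_add comp_apply ..
      have "cmod (Mn (Suc (m t)) \<psi> x - Mn (Suc (m t)) \<psi> y) \<le> p t * B + (1 - p t) * A"
      proof (rule mrp(4)[OF xt yt \<psi> AB]; intro ballI impI)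
        fix w assume w: "w \<in> words (Suc (m t))"
        have uw: "u \<circ> w \<in> words n" if "u \<in> words k" for u unfolding k by (rule words_add[OF w that])
        show "cmod (\<psi> (w x) - \<psi> (w y)) \<le> A"
          unfolding \<psi>_def by (rule Mn_diff_bound[OF \<phi>]) (use A[OF uw] in simp)
        assume Pwxy: "P (w x) (w y)"
        show "cmod (\<psi> (w x) - \<psi> (w y)) \<le> B"
          unfolding \<psi>_def
        proof (rule Mn_diff_bound[OF \<phi>])
          fix u assume u: "u \<in> words k"
          show "cmod (\<phi> (u (w x)) - \<phi> (u (w y))) \<le> B" using B[OF uw[OF u]] Pw[OF Pwxy u] by simp
        qed
      qed
      also have "\<dots> \<le> q * B + (1 - q) * A"
        using mult_right_mono[OF q(3)[OF t(1)], of "A - B"] AB by (simp add: algebra_simps)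
      finally show ?thesis unfolding MM .
    qed
  qed
qed

end

lemma hl_weaken: "hl \<alpha> H \<phi> \<Longrightarrow> H \<le> H' \<Longrightarrow> hl \<alpha> H' \<phi>"
  unfolding hl_def by (meson mult_right_mono order_trans powr_ge_zero)

context mean_stable
begin

text \<open>Two constants are followed: \<open>H\<close> for all pairs, and \<open>Q\<close> for
  pairs in \<open>P\<close>, measured in \<open>ds\<close>. The second contracts by itself; the
  first contracts up to multiples of \<open>Q\<close> and of the supremum norm. This triangular
  structure gives power boundedness, and then the two constants are made small one after the
  other.\<close>

theorem doeblin_fortet:
  obtains \<alpha> C D where "0 < \<alpha>" "\<alpha> < 1" "C \<ge> 1" "D \<ge> 0"
    "\<And>\<phi> A j. hl \<alpha> A \<phi> \<Longrightarrow> (\<And>x. cmod (\<phi> x) \<le> A) \<Longrightarrow> hl \<alpha> (C * A) (Mn j \<phi>)"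
    "\<And>\<eta>. \<eta> > 0 \<Longrightarrow> \<exists>N. \<forall>\<phi> A s. hl \<alpha> A \<phi> \<longrightarrow> (\<forall>x. cmod (\<phi> x) \<le> A) \<longrightarrow>
       (\<forall>x. cmod (\<phi> x) \<le> s) \<longrightarrow> hl \<alpha> (\<eta> * A + D * s) (Mn N \<phi>)"
proof -
  show ?thesis
  proof (rule attracting_pairs)
  fix P :: "rsphere \<Rightarrow> rsphere \<Rightarrow> bool" and \<delta> C2 n1 p1
  assume \<delta>: "\<delta> > 0" and C2: "C2 \<ge> 1" and p1: "0 < p1" "p1 \<le> 1"
    and Pw: "\<And>x y n w. P x y \<Longrightarrow> w \<in> words n \<Longrightarrow> P (w x) (w y)"
    and PC: "\<And>x y. P x y \<Longrightarrow> ds x y \<le> C2 * dist x y"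
    and Pid: "\<And>z x y. z \<in> S \<Longrightarrow> x \<in> ball z \<delta> \<Longrightarrow> y \<in> ball z \<delta> \<Longrightarrow> P x y"
    and contr: "\<And>\<phi> x y A B. continuous_on UNIV \<phi> \<Longrightarrow> B \<le> A \<Longrightarrow> P x y \<Longrightarrow>
       (\<And>w. w \<in> words n1 \<Longrightarrow> cmod (\<phi> (w x) - \<phi> (w y)) \<le> A) \<Longrightarrow>
       (\<And>w. w \<in> words n1 \<Longrightarrow> ds (w x) (w y) \<le> ds x y / 2 \<Longrightarrow> cmod (\<phi> (w x) - \<phi> (w y)) \<le> B) \<Longrightarrow>
       cmod (Mn n1 \<phi> x - Mn n1 \<phi> y) \<le> p1 * B + (1 - p1) * A"
  show ?thesis
  proof (rule reach_attracting_pairs[of \<delta> P])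
  show "\<delta> > 0" by (rule \<delta>)
  show "P (w x) (w y)" if "P x y" "w \<in> words n" for x y n w using Pw that by blast
  show "P x y" if "z \<in> S" "x \<in> ball z \<delta>" "y \<in> ball z \<delta>" for z x y using Pid that by blast
  fix n p \<rho> assume n: "n > 0" and p: "0 < p" "p \<le> 1/2" and \<rho>: "\<rho> > 0"
    and reach: "\<And>\<phi> x y A B. continuous_on UNIV \<phi> \<Longrightarrow> dist x y < \<rho> \<Longrightarrow>
       (\<And>w. w \<in> words n \<Longrightarrow> cmod (\<phi> (w x) - \<phi> (w y)) \<le> A) \<Longrightarrow>
       (\<And>w. w \<in> words n \<Longrightarrow> P (w x) (w y) \<Longrightarrow> cmod (\<phi> (w x) - \<phi> (w y)) \<le> B) \<Longrightarrow>
       cmod (Mn n \<phi> x - Mn n \<phi> y) \<le> p * B + (1 - p) * A"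
  define K where "K = lipC ^ n"
  have K: "K \<ge> 1" unfolding K_def using lipC(1) by simp
  \<comment> \<open>The aim is \<open>K powr \<alpha> \<le> t\<close>: then expansion by
    \<open>K\<close> with weight \<open>1 - p\<close> still leaves the factor
    \<open>1 - p/2\<close>. The summand 1 beside \<open>ln K\<close> covers \<open>K = 1\<close>,
    and the cap 1/2 gives \<open>\<alpha> < 1\<close>.\<close>
  define t where "t = (1 - p/2) / (1 - p)"
  have t: "t > 1" using p by (simp add: t_def field_simps)
  define \<alpha> where "\<alpha> = min (1/2) (ln t / (ln K + 1))"
  have lnK: "ln K \<ge> 0" using K by simp
  have \<alpha>: "0 < \<alpha>" "\<alpha> < 1" using t lnK by (auto simp: \<alpha>_def)
  have K\<alpha>: "K powr \<alpha> \<le> t"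
  proof -
    have "\<alpha> * ln K \<le> ln t / (ln K + 1) * ln K" using lnK by (intro mult_right_mono) (auto simp: \<alpha>_def)
    also have "\<dots> \<le> ln t" using lnK t by (simp add: field_simps)
    finally have "exp (\<alpha> * ln K) \<le> exp (ln t)" by simp
    thus ?thesis using K t by (simp add: powr_def)
  qed
  define \<theta> where "\<theta> = 1 - p/2"
  have \<theta>: "0 < \<theta>" "\<theta> < 1" using p by (auto simp: \<theta>_def)
  have pK: "(1 - p) * K powr \<alpha> \<le> \<theta>"
  proof -
    have "(1 - p) * K powr \<alpha> \<le> (1 - p) * t" using K\<alpha> p by (intro mult_left_mono) auto
    thus ?thesis using p by (simp add: t_def \<theta>_def)
  qed
  define h where "h = (1/2::real) powr \<alpha>"
  have h: "0 < h" "h < 1"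
    using powr_less_mono2[of \<alpha> "1/2" 1] \<alpha> by (auto simp: h_def)
  define \<theta>1 where "\<theta>1 = p1 * h + (1 - p1)"
  have \<theta>1: "0 \<le> \<theta>1" "\<theta>1 < 1"
  proof -
    have "p1 * h < p1 * 1" using h p1 by (intro mult_strict_left_mono) auto
    thus "\<theta>1 < 1" by (simp add: \<theta>1_def)
    show "0 \<le> \<theta>1" using h p1 by (simp add: \<theta>1_def)
  qed
  define hp where "hp = (\<lambda>Q (\<phi> :: rsphere \<Rightarrow> complex). \<forall>x y. P x y \<longrightarrow> cmod (\<phi> x - \<phi> y) \<le> Q * ds x y powr \<alpha>)"
  have hl_hp: "hp H \<phi>" if "hl \<alpha> H \<phi>" "H \<ge> 0" for H \<phi>
    unfolding hp_def
  proof (intro allI impI)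
    fix x y assume "P x y"
    have "cmod (\<phi> x - \<phi> y) \<le> H * dist x y powr \<alpha>" using that(1) by (simp add: hl_def)
    also have "\<dots> \<le> H * ds x y powr \<alpha>"
      using that(2) \<alpha> dist_le_ds by (intro mult_left_mono powr_mono2) auto
    finally show "cmod (\<phi> x - \<phi> y) \<le> H * ds x y powr \<alpha>" .
  qed
  have hp_mono: "hp Q (Mn k \<phi>)" if \<phi>: "continuous_on UNIV \<phi>" "hp Q \<phi>" "Q \<ge> 0" for Q k \<phi>
    unfolding hp_def
  proof (intro allI impI, rule Mn_diff_bound[OF \<phi>(1)])
    fix x y w assume Pxy: "P x y" and w: "w \<in> words k"
    have "cmod (\<phi> (w x) - \<phi> (w y)) \<le> Q * ds (w x) (w y) powr \<alpha>"
      using \<phi>(2) Pw[OF Pxy w] by (simp add: hp_def)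
    also have "\<dots> \<le> Q * ds x y powr \<alpha>"
      using \<phi>(3) \<alpha> ds_mono[OF w] by (intro mult_left_mono powr_mono2) auto
    finally show "cmod (\<phi> (w x) - \<phi> (w y)) \<le> Q * ds x y powr \<alpha>" .
  qed
  have hp_contr: "hp (\<theta>1 * Q) (Mn n1 \<phi>)" if \<phi>: "continuous_on UNIV \<phi>" "hp Q \<phi>" "Q \<ge> 0" for Q \<phi>
    unfolding hp_def
  proof (intro allI impI)
    fix x y assume Pxy: "P x y"
    define A where "A = Q * ds x y powr \<alpha>"
    have A0: "A \<ge> 0" using \<phi>(3) by (simp add: A_def)
    have "cmod (Mn n1 \<phi> x - Mn n1 \<phi> y) \<le> p1 * (h * A) + (1 - p1) * A"
    proof (rule contr[OF \<phi>(1) _ Pxy])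
      show "h * A \<le> A" using h A0 by (simp add: mult_left_le_one_le)
      fix w assume w: "w \<in> words n1"
      have 1: "cmod (\<phi> (w x) - \<phi> (w y)) \<le> Q * ds (w x) (w y) powr \<alpha>"
        using \<phi>(2) Pw[OF Pxy w] by (simp add: hp_def)
      also have "\<dots> \<le> A" unfolding A_def
        using \<phi>(3) \<alpha> ds_mono[OF w] by (intro mult_left_mono powr_mono2) auto
      finally show "cmod (\<phi> (w x) - \<phi> (w y)) \<le> A" .
      assume half: "ds (w x) (w y) \<le> ds x y / 2"
      have "Q * ds (w x) (w y) powr \<alpha> \<le> Q * (1/2 * ds x y) powr \<alpha>"
        using \<phi>(3) \<alpha> half by (intro mult_left_mono powr_mono2) auto
      also have "\<dots> = h * A" by (simp add: A_def h_def powr_mult powr_divide)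
      finally show "cmod (\<phi> (w x) - \<phi> (w y)) \<le> h * A" using 1 by linarith
    qed
    also have "\<dots> = \<theta>1 * Q * ds x y powr \<alpha>" by (simp add: A_def \<theta>1_def algebra_simps)
    finally show "cmod (Mn n1 \<phi> x - Mn n1 \<phi> y) \<le> \<theta>1 * Q * ds x y powr \<alpha>" .
  qed
  have hp_iter: "hp (\<theta>1 ^ m * Q) (Mn (n1 * m) \<phi>)"
    if \<phi>: "continuous_on UNIV \<phi>" "hp Q \<phi>" "Q \<ge> 0" for Q \<phi> m
  proof (induction m)
    case (Suc m)
    have "hp (\<theta>1 * (\<theta>1 ^ m * Q)) (Mn n1 (Mn (n1 * m) \<phi>))"
      by (rule hp_contr[OF Mn_continuous[OF \<phi>(1)] Suc.IH]) (use \<theta>1 \<phi>(3) in simp)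
    moreover have "Mn n1 (Mn (n1 * m) \<phi>) = Mn (n1 * Suc m) \<phi>"
      by (simp only: mult_Suc_right funpow_add comp_apply)
    ultimately show ?case by (simp add: mult.assoc)
  qed (use \<phi> in simp)
  \<comment> \<open>\<open>C3\<close> converts a bound in \<open>ds\<close> on \<open>P\<close>,
    after \<open>n\<close> letters, into one in \<open>dist\<close> at the start. \<open>C4\<close>
    handles pairs at distance at least \<rho>, for which only the supremum norm is used.\<close>
  define C3 where "C3 = (C2 * K) powr \<alpha>"
  define C4 where "C4 = 2 / \<rho> powr \<alpha>"
  have C34: "C3 \<ge> 0" "C4 \<ge> 0" by (simp_all add: C3_def C4_def)
  have hl_step: "hl \<alpha> (\<theta> * H + (C3 * Q + C4 * s)) (Mn n \<phi>)"
    if \<phi>: "hl \<alpha> H \<phi>" "hp Q \<phi>" "\<And>x. cmod (\<phi> x) \<le> s" "H \<ge> 0" "Q \<ge> 0" for H Q s \<phi>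
    unfolding hl_def
  proof (intro allI)
    fix x y :: rsphere
    have cont: "continuous_on UNIV \<phi>" by (rule hl_continuous[OF \<phi>(1) \<alpha>(1)])
    have s0: "s \<ge> 0" using \<phi>(3)[of undefined] norm_ge_zero order_trans by blast
    define u where "u = dist x y powr \<alpha>"
    have u0: "u \<ge> 0" by (simp add: u_def)
    show "cmod (Mn n \<phi> x - Mn n \<phi> y) \<le> (\<theta> * H + (C3 * Q + C4 * s)) * dist x y powr \<alpha>"
    proof (cases "dist x y < \<rho>")
      case True
      have "cmod (Mn n \<phi> x - Mn n \<phi> y) \<le> p * (Q * (C3 * u)) + (1 - p) * (H * (K powr \<alpha> * u))"
      proof (rule reach[OF cont True])
        fix w assume w: "w \<in> words n"
        have lip: "dist (w x) (w y) \<le> K * dist x y" unfolding K_def by (rule words_lip[OF w])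
        have "cmod (\<phi> (w x) - \<phi> (w y)) \<le> H * dist (w x) (w y) powr \<alpha>" using \<phi>(1) by (simp add: hl_def)
        also have "\<dots> \<le> H * (K * dist x y) powr \<alpha>"
          using \<phi>(4) \<alpha> lip by (intro mult_left_mono powr_mono2) auto
        also have "(K * dist x y) powr \<alpha> = K powr \<alpha> * u" using K by (simp add: powr_mult u_def)
        finally show "cmod (\<phi> (w x) - \<phi> (w y)) \<le> H * (K powr \<alpha> * u)" .
        assume Pwxy: "P (w x) (w y)"
        have "ds (w x) (w y) \<le> C2 * dist (w x) (w y)" by (rule PC[OF Pwxy])
        also have "\<dots> \<le> C2 * (K * dist x y)" using C2 lip by (intro mult_left_mono) auto
        finally have dd: "ds (w x) (w y) \<le> C2 * K * dist x y" by simp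
        have "cmod (\<phi> (w x) - \<phi> (w y)) \<le> Q * ds (w x) (w y) powr \<alpha>" using \<phi>(2) Pwxy by (simp add: hp_def)
        also have "\<dots> \<le> Q * (C2 * K * dist x y) powr \<alpha>"
          using \<phi>(5) \<alpha> dd by (intro mult_left_mono powr_mono2) auto
        also have "(C2 * K * dist x y) powr \<alpha> = C3 * u" unfolding C3_def u_def
          using C2 K by (simp add: powr_mult)
        finally show "cmod (\<phi> (w x) - \<phi> (w y)) \<le> Q * (C3 * u)" .
      qed
      also have "\<dots> \<le> 1 * (Q * (C3 * u)) + \<theta> * (H * u)"
      proof (rule add_mono)
        show "p * (Q * (C3 * u)) \<le> 1 * (Q * (C3 * u))"
          using p \<phi>(5) C34 u0 by (intro mult_right_mono) auto
        have "(1 - p) * (H * (K powr \<alpha> * u)) = ((1 - p) * K powr \<alpha>) * (H * u)" by simp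
        also have "\<dots> \<le> \<theta> * (H * u)" using pK \<phi>(4) u0 by (intro mult_right_mono) auto
        finally show "(1 - p) * (H * (K powr \<alpha> * u)) \<le> \<theta> * (H * u)" .
      qed
      also have "\<dots> \<le> (\<theta> * H + (C3 * Q + C4 * s)) * u"
        using C34 s0 u0 by (simp add: algebra_simps)
      finally show ?thesis by (simp add: u_def)
    next
      case False
      have "\<rho> powr \<alpha> \<le> u" unfolding u_def using False \<rho> \<alpha> by (intro powr_mono2) auto
      hence 1: "1 \<le> u / \<rho> powr \<alpha>" using \<rho> by simp
      have "cmod (Mn n \<phi> x - Mn n \<phi> y) \<le> cmod (Mn n \<phi> x) + cmod (Mn n \<phi> y)" by (rule norm_triangle_ineq4)
      also have "\<dots> \<le> 2 * s" using Mn_bound[OF cont \<phi>(3)] by (smt (verit))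
      also have "\<dots> = 2 * s * 1" by simp
      also have "\<dots> \<le> 2 * s * (u / \<rho> powr \<alpha>)" using 1 s0 by (intro mult_left_mono) auto
      also have "\<dots> = C4 * s * u" by (simp add: C4_def)
      also have "\<dots> \<le> (\<theta> * H + (C3 * Q + C4 * s)) * u"
        using C34 \<theta> \<phi>(4,5) u0 by (intro mult_right_mono) auto
      finally show ?thesis by (simp add: u_def)
    qed
  qed
  \<comment> \<open>This is the fixed point of
    \<open>H \<mapsto> \<theta> * H + (C3 * Q + C4 * s)\<close>, the recursion of
    \<open>hl_step\<close>.\<close>
  define E where "E = (\<lambda>Q s. (C3 * Q + C4 * s) / (1 - \<theta>))"
  have hl_iter: "hl \<alpha> (\<theta> ^ k * H + E Q s) (Mn (n * k) \<phi>)"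
    if \<phi>: "hl \<alpha> H \<phi>" "hp Q \<phi>" "\<And>x. cmod (\<phi> x) \<le> s" "H \<ge> 0" "Q \<ge> 0" for H Q s \<phi> k
  proof (induction k)
    have s0: "s \<ge> 0" using \<phi>(3)[of undefined] norm_ge_zero order_trans by blast
    have E0: "E Q s \<ge> 0" using C34 \<theta> \<phi>(5) s0 by (simp add: E_def)
    { case 0
      show ?case using hl_weaken[OF \<phi>(1)] E0 by simp }
    { case (Suc k)
      have cont: "continuous_on UNIV \<phi>" by (rule hl_continuous[OF \<phi>(1) \<alpha>(1)])
      have "hl \<alpha> (\<theta> * (\<theta> ^ k * H + E Q s) + (C3 * Q + C4 * s)) (Mn n (Mn (n * k) \<phi>))"
        by (rule hl_step[OF Suc.IH hp_mono[OF cont \<phi>(2,5)]])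
          (use Mn_bound[OF cont \<phi>(3)] \<phi> \<theta> E0 in auto)
      moreover have "\<theta> * (\<theta> ^ k * H + E Q s) + (C3 * Q + C4 * s) = \<theta> ^ Suc k * H + E Q s"
      proof -
        have "C3 * Q + C4 * s = (1 - \<theta>) * E Q s" using \<theta> by (simp add: E_def)
        thus ?thesis by (simp add: algebra_simps)
      qed
      moreover have "Mn n (Mn (n * k) \<phi>) = Mn (n * Suc k) \<phi>"
        by (simp only: mult_Suc_right funpow_add comp_apply)
      ultimately show ?case by simp }
  qed
  have hl_words: "hl \<alpha> (K powr \<alpha> * H) (Mn i \<phi>)" if \<phi>: "hl \<alpha> H \<phi>" "H \<ge> 0" and i: "i \<le> n" for H \<phi> i
    unfolding hl_def
  proof (intro allI, rule Mn_diff_bound[OF hl_continuous[OF \<phi>(1) \<alpha>(1)]])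
    fix x y w assume w: "w \<in> words i"
    have "dist (w x) (w y) \<le> lipC ^ i * dist x y" by (rule words_lip[OF w])
    also have "\<dots> \<le> K * dist x y" unfolding K_def
      using lipC(1) i by (intro mult_right_mono power_increasing) auto
    finally have lip: "dist (w x) (w y) \<le> K * dist x y" .
    have "cmod (\<phi> (w x) - \<phi> (w y)) \<le> H * dist (w x) (w y) powr \<alpha>" using \<phi>(1) by (simp add: hl_def)
    also have "\<dots> \<le> H * (K * dist x y) powr \<alpha>"
      using \<phi>(2) \<alpha> lip by (intro mult_left_mono powr_mono2) auto
    also have "\<dots> = K powr \<alpha> * H * dist x y powr \<alpha>" using K by (simp add: powr_mult)
    finally show "cmod (\<phi> (w x) - \<phi> (w y)) \<le> K powr \<alpha> * H * dist x y powr \<alpha>" .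
  qed
  define C where "C = K powr \<alpha> * (1 + E 1 1)"
  define D where "D = C4 / (1 - \<theta>)"
  have E1: "E 1 1 \<ge> 0" using C34 \<theta> by (simp add: E_def)
  have Ka1: "K powr \<alpha> \<ge> 1" using K \<alpha> by (simp add: ge_one_powr_ge_zero)
  have C: "C \<ge> 1" unfolding C_def using E1 Ka1 mult_mono[of 1 "K powr \<alpha>" 1 "1 + E 1 1"] by simp
  have D: "D \<ge> 0" using C34 \<theta> by (simp add: D_def)
  have power_bounded: "hl \<alpha> (C * A) (Mn j \<phi>)" if \<phi>: "hl \<alpha> A \<phi>" "\<And>x. cmod (\<phi> x) \<le> A" for \<phi> A j
  proof -
    have A0: "A \<ge> 0" using \<phi>(2)[of undefined] norm_ge_zero order_trans by blast
    define k i where "k = j div n" and "i = j mod n"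
    have "hl \<alpha> (\<theta> ^ k * A + E A A) (Mn (n * k) \<phi>)"
      by (rule hl_iter[OF \<phi>(1) hl_hp[OF \<phi>(1) A0] \<phi>(2) A0 A0])
    hence "hl \<alpha> (K powr \<alpha> * (\<theta> ^ k * A + E A A)) (Mn i (Mn (n * k) \<phi>))"
      by (rule hl_words) (use \<theta> A0 C34 n in \<open>auto simp: E_def i_def less_imp_le\<close>)
    moreover have "Mn i (Mn (n * k) \<phi>) = Mn j \<phi>"
    proof -
      have "j = i + n * k" by (simp add: i_def k_def)
      thus ?thesis by (simp only: funpow_add comp_apply)
    qed
    moreover have "K powr \<alpha> * (\<theta> ^ k * A + E A A) \<le> C * A"
    proof -
      have "\<theta> ^ k \<le> 1" using \<theta> by (simp add: power_le_one)
      hence "\<theta> ^ k * A \<le> 1 * A" using A0 by (intro mult_right_mono)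
      moreover have "E A A = E 1 1 * A" by (simp add: E_def algebra_simps add_divide_distrib)
      ultimately have "\<theta> ^ k * A + E A A \<le> (1 + E 1 1) * A" by (simp add: algebra_simps)
      hence "K powr \<alpha> * (\<theta> ^ k * A + E A A) \<le> K powr \<alpha> * ((1 + E 1 1) * A)" by (intro mult_left_mono) auto
      thus ?thesis by (simp add: C_def mult.assoc)
    qed
    ultimately show ?thesis using hl_weaken by metis
  qed
  have DF: "\<exists>N. \<forall>\<phi> A s. hl \<alpha> A \<phi> \<longrightarrow> (\<forall>x. cmod (\<phi> x) \<le> A) \<longrightarrow>
       (\<forall>x. cmod (\<phi> x) \<le> s) \<longrightarrow> hl \<alpha> (\<eta> * A + D * s) (Mn N \<phi>)" if \<eta>: "\<eta> > 0" for \<eta>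
  proof -
    obtain k where k: "\<theta> ^ k < \<eta> / (2 * C)"
      using real_arch_pow_inv[of "\<eta> / (2 * C)" \<theta>] \<eta> C \<theta> by auto
    obtain m where m: "\<theta>1 ^ m < \<eta> * (1 - \<theta>) / (2 * (C3 + 1))"
      using real_arch_pow_inv[of "\<eta> * (1 - \<theta>) / (2 * (C3 + 1))" \<theta>1] \<eta> C34 \<theta> \<theta>1 by auto
    have "hl \<alpha> (\<eta> * A + D * s) (Mn (n * k + n1 * m) \<phi>)"
      if \<phi>: "hl \<alpha> A \<phi>" "\<forall>x. cmod (\<phi> x) \<le> A" "\<forall>x. cmod (\<phi> x) \<le> s" for \<phi> A s
    proof -
      have A0: "A \<ge> 0" using \<phi>(2)[rule_format, of undefined] norm_ge_zero order_trans by blast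
      have cont: "continuous_on UNIV \<phi>" by (rule hl_continuous[OF \<phi>(1) \<alpha>(1)])
      \<comment> \<open>The first \<open>n1 * m\<close> applications of the operator shrink the
        constant on \<open>P\<close>, while power boundedness keeps the global one below
        \<open>C * A\<close>; the next \<open>n * k\<close> applications shrink the global
        one.\<close>
      define \<psi> where "\<psi> = Mn (n1 * m) \<phi>"
      have 1: "hl \<alpha> (C * A) \<psi>" unfolding \<psi>_def by (rule power_bounded) (use \<phi> in auto)
      have 2: "hp (\<theta>1 ^ m * A) \<psi>" unfolding \<psi>_def by (rule hp_iter[OF cont hl_hp[OF \<phi>(1) A0] A0])
      have 3: "cmod (\<psi> x) \<le> s" for x unfolding \<psi>_def by (rule Mn_bound[OF cont]) (use \<phi> in auto)
      have "hl \<alpha> (\<theta> ^ k * (C * A) + E (\<theta>1 ^ m * A) s) (Mn (n * k) \<psi>)"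
        by (rule hl_iter[OF 1 2 3]) (use A0 C \<theta>1 in auto)
      moreover have "Mn (n * k) \<psi> = Mn (n * k + n1 * m) \<phi>"
        unfolding \<psi>_def by (simp only: funpow_add comp_apply)
      moreover have "\<theta> ^ k * (C * A) + E (\<theta>1 ^ m * A) s \<le> \<eta> * A + D * s"
      proof -
        have "\<theta> ^ k * C \<le> \<eta> / 2" using k C by (simp add: field_simps)
        from mult_right_mono[OF this A0] have a: "\<theta> ^ k * (C * A) \<le> \<eta> / 2 * A"
          unfolding mult.assoc .
        have "C3 * \<theta>1 ^ m \<le> (C3 + 1) * \<theta>1 ^ m" using \<theta>1 by (intro mult_right_mono) auto
        also have "\<dots> \<le> \<eta> * (1 - \<theta>) / 2" using m C34 by (simp add: field_simps)
        finally have "C3 * \<theta>1 ^ m / (1 - \<theta>) \<le> \<eta> / 2" using \<theta> by (simp add: field_simps)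
        hence "C3 * \<theta>1 ^ m / (1 - \<theta>) * A \<le> \<eta> / 2 * A" using A0 by (intro mult_right_mono)
        moreover have "E (\<theta>1 ^ m * A) s = C3 * \<theta>1 ^ m / (1 - \<theta>) * A + D * s"
          by (simp add: E_def D_def add_divide_distrib)
        ultimately show ?thesis using a by linarith
      qed
      ultimately show ?thesis using hl_weaken by metis
    qed
    thus ?thesis by blast
  qed
  show ?thesis
    by (rule that[OF \<alpha> C D power_bounded DF])
  qed
  qed
qed

end

section \<open>Unimodular eigenfunctions\<close>

interpretation fs: vector_space fscale
  by standard (auto simp: fscale_def plus_fun_def algebra_simps)

lemma sum_fun_eval: "(\<Sum>i\<in>A. (f i :: rsphere \<Rightarrow> complex)) z = (\<Sum>i\<in>A. f i z)"
  by (induction A rule: infinite_finite_induct) auto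

lemma primitive_root:
  assumes "r > 0"
  obtains w :: complex where "cmod w = 1" "w ^ r = 1" "\<And>k. w ^ k = 1 \<longleftrightarrow> r dvd k"
proof -
  define w where "w = exp (2 * of_real pi * \<i> * of_nat 1 / of_nat r)"
  have wk: "w ^ k = exp (2 * of_real pi * \<i> * of_nat k / of_nat r)" for k
    unfolding w_def by (simp add: exp_of_nat_mult[symmetric] mult_ac)
  have *: "w ^ k = 1 \<longleftrightarrow> r dvd k" for k
    unfolding wk using assms by (intro complex_root_unity_eq_1) simp
  have "w ^ r = 1" using * by simp
  moreover have "cmod w = 1" by (simp add: w_def norm_exp_eq_Re)
  ultimately show ?thesis using that * by blast
qed

context random_rat
begin

definition CK :: "rsphere set \<Rightarrow> (rsphere \<Rightarrow> complex) \<Rightarrow> bool" where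
  "CK K \<phi> \<longleftrightarrow> continuous_on K \<phi> \<and> (\<forall>z. z \<notin> K \<longrightarrow> \<phi> z = 0)"

definition invK :: "rsphere set \<Rightarrow> bool" where
  "invK K \<longleftrightarrow> closed K \<and> (\<forall>g\<in>supp \<tau>. g ` K \<subseteq> K)"

text \<open>Elements of \<open>C(K)\<close> are extended by 0 outside \<open>K\<close>.\<close>

definition NK :: "rsphere set \<Rightarrow> (rsphere \<Rightarrow> complex) \<Rightarrow> (rsphere \<Rightarrow> complex)" where
  "NK K \<phi> = (\<lambda>z. if z \<in> K then Mop \<tau> \<phi> z else 0)"

lemma NK_UNIV: "NK UNIV = Mop \<tau>"
  by (simp add: NK_def fun_eq_iff)

lemma CK_bm: "CK K \<phi> \<Longrightarrow> invK K \<Longrightarrow> bm \<phi>"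
  unfolding CK_def invK_def by (blast intro: continuous_on_closed_bm)

lemma CK_NK: "CK K \<phi> \<Longrightarrow> invK K \<Longrightarrow> CK K (NK K \<phi>)"
proof -
  assume C: "CK K \<phi>" and I: "invK K"
  have "continuous_on K (Mop \<tau> \<phi>)"
    using C I CK_bm[OF C I] by (intro Mop_continuous_on) (auto simp: CK_def invK_def)
  hence "continuous_on K (NK K \<phi>)" by (rule continuous_on_eq) (simp add: NK_def)
  thus ?thesis by (simp add: CK_def NK_def)
qed

lemma CK_NK_iter: "CK K \<phi> \<Longrightarrow> invK K \<Longrightarrow> CK K ((NK K ^^ n) \<phi>)"
  by (induction n) (auto intro: CK_NK)

lemma Mop_sum:
  assumes "finite A" "\<And>i. i \<in> A \<Longrightarrow> bm (\<phi> i)"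
  shows "Mop \<tau> (\<lambda>z. \<Sum>i\<in>A. c i * \<phi> i z) x = (\<Sum>i\<in>A. c i * Mop \<tau> (\<phi> i) x)"
proof -
  have "Mop \<tau> (\<lambda>z. \<Sum>i\<in>A. c i * \<phi> i z) x = (\<Sum>i\<in>A. \<integral>g. c i * \<phi> i (g x) \<partial>\<tau>)"
    unfolding Mop_def using assms
    by (intro Bochner_Integration.integral_sum integrable_mult_right bm_integrable)
  thus ?thesis by (simp add: Mop_def)
qed

lemma CK_sum:
  assumes "finite A" "\<And>i. i \<in> A \<Longrightarrow> CK K (\<phi> i)"
  shows "CK K (\<lambda>z. \<Sum>i\<in>A. c i * \<phi> i z)"
  using assms unfolding CK_def by (auto intro!: continuous_intros)

text \<open>Discrete Fourier transform over the \<open>r\<close>-th roots of unity.\<close>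

lemma periodic_in_LS:
  assumes I: "invK K" and C: "CK K \<psi>" and r: "r > 0" and per: "(NK K ^^ r) \<psi> = \<psi>"
  shows "\<psi> \<in> LS (Ufun \<tau> K)"
proof -
  obtain w :: complex where w: "cmod w = 1" "w ^ r = 1" "\<And>k. w ^ k = 1 \<longleftrightarrow> r dvd k"
    using primitive_root[OF r] by metis
  \<comment> \<open>These are the Fourier components of the periodic orbit of \<psi>:
    \<open>\<phi> l\<close> has eigenvalue \<open>inverse (w ^ l)\<close>, and in the average over
    \<open>l\<close> all terms with \<open>k \<noteq> 0\<close> cancel.\<close>
  define \<phi> where "\<phi> = (\<lambda>l z. \<Sum>k<r. (w ^ l) ^ k * (NK K ^^ k) \<psi> z)"
  have CN: "CK K ((NK K ^^ k) \<psi>)" for k by (rule CK_NK_iter[OF C I])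
  have C\<phi>: "CK K (\<phi> l)" for l unfolding \<phi>_def by (intro CK_sum CN) simp
  have eig: "Mop \<tau> (\<phi> l) z = inverse (w ^ l) * \<phi> l z" if z: "z \<in> K" for l z
  proof -
    define c where "c = w ^ l"
    have "c ^ r = (w ^ r) ^ l" by (simp add: c_def power_mult[symmetric] mult.commute)
    hence c: "c \<noteq> 0" "c ^ r = 1" using w(1,2) by (auto simp: c_def)
    have "c * Mop \<tau> (\<phi> l) z = c * (\<Sum>k<r. c ^ k * Mop \<tau> ((NK K ^^ k) \<psi>) z)"
      unfolding \<phi>_def c_def[symmetric] by (subst Mop_sum) (use CK_bm[OF CN I] in auto)
    also have "\<dots> = (\<Sum>k<r. c ^ Suc k * (NK K ^^ Suc k) \<psi> z)"
      using z by (simp add: sum_distrib_left NK_def mult.assoc)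
    also have "\<dots> = (\<Sum>k<r. c ^ k * (NK K ^^ k) \<psi> z)"
    proof -
      have "(\<Sum>k<Suc r. c ^ k * (NK K ^^ k) \<psi> z) = c ^ 0 * (NK K ^^ 0) \<psi> z + (\<Sum>k<r. c ^ Suc k * (NK K ^^ Suc k) \<psi> z)"
        by (rule sum.lessThan_Suc_shift)
      moreover have "(\<Sum>k<Suc r. c ^ k * (NK K ^^ k) \<psi> z) = (\<Sum>k<r. c ^ k * (NK K ^^ k) \<psi> z) + \<psi> z"
        using c per by simp
      ultimately show ?thesis by simp
    qed
    finally have "c * Mop \<tau> (\<phi> l) z = \<phi> l z" by (simp add: \<phi>_def c_def)
    thus ?thesis using c(1) by (simp add: c_def[symmetric] field_simps)
  qed
  have "\<phi> l \<in> LS (Ufun \<tau> K)" for l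
  proof (cases "\<exists>z\<in>K. \<phi> l z \<noteq> 0")
    case True
    hence "\<phi> l \<in> Ufun \<tau> K"
      using C\<phi>[of l] eig w(1) unfolding Ufun_def CK_def
      by (auto intro!: exI[of _ "inverse (w ^ l)"] simp: norm_inverse norm_power)
    thus ?thesis unfolding LS_def by (rule fs.span_base)
  next
    \<comment> \<open>A vanishing component is not an eigenfunction, but 0 lies in every
      span.\<close>
    case False
    hence "\<phi> l = 0" using C\<phi>[of l] by (auto simp: CK_def fun_eq_iff)
    thus ?thesis unfolding LS_def using fs.span_zero by simp
  qed
  hence "fscale (1 / of_nat r) (\<Sum>l<r. \<phi> l) \<in> LS (Ufun \<tau> K)"
    unfolding LS_def by (intro fs.span_scale fs.span_sum)
  moreover have "fscale (1 / of_nat r) (\<Sum>l<r. \<phi> l) = \<psi>"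
  proof
    fix z
    have "(\<Sum>l<r. \<phi> l z) = (\<Sum>k<r. \<Sum>l<r. (w ^ l) ^ k * (NK K ^^ k) \<psi> z)"
      unfolding \<phi>_def by (rule sum.swap)
    also have "\<dots> = (\<Sum>k<r. (if k = 0 then of_nat r * \<psi> z else 0))"
    proof (rule sum.cong[OF refl])
      fix k assume k: "k \<in> {..<r}"
      show "(\<Sum>l<r. (w ^ l) ^ k * (NK K ^^ k) \<psi> z) = (if k = 0 then of_nat r * \<psi> z else 0)"
      proof (cases "k = 0")
        case False
        have "w ^ k \<noteq> 1" using w(3) False k by (auto dest: dvd_imp_le)
        hence "(\<Sum>l<r. (w ^ k) ^ l) = ((w ^ k) ^ r - 1) / (w ^ k - 1)" by (rule geometric_sum)
        also have "(w ^ k) ^ r = 1" by (metis mult.commute power_mult power_one w(2))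
        finally have "(\<Sum>l<r. (w ^ l) ^ k) = 0" by (simp add: power_mult[symmetric] mult.commute)
        thus ?thesis using False by (simp add: sum_distrib_right[symmetric])
      qed simp
    qed
    also have "\<dots> = of_nat r * \<psi> z" using r by (simp add: sum.delta)
    finally show "fscale (1 / of_nat r) (\<Sum>l<r. \<phi> l) z = \<psi> z"
      using r by (simp add: fscale_def sum_fun_eval)
  qed
  ultimately show ?thesis by simp
qed

lemma kappa_continuous:
  assumes I: "invK K" and C: "continuous_on K \<phi>" and x: "x \<in> K" and g: "g \<in> supp \<tau>" and e: "e > 0"
  shows "\<exists>d>0. \<forall>h\<in>supp \<tau>. kappa g h < d \<longrightarrow> cmod (\<phi> (g x) - \<phi> (h x)) < e"
proof -
  have K: "g x \<in> K" "\<And>h. h \<in> supp \<tau> \<Longrightarrow> h x \<in> K" using I x g by (auto simp: invK_def)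
  obtain d where d: "d > 0" "\<forall>y\<in>K. dist y (g x) < d \<longrightarrow> dist (\<phi> y) (\<phi> (g x)) < e"
    using C K(1) e unfolding continuous_on_iff by blast
  have "cmod (\<phi> (g x) - \<phi> (h x)) < e" if h: "h \<in> supp \<tau>" "kappa g h < d" for h
  proof -
    have "dist (h x) (g x) < d" using kappa_upper[of g x h] h by (simp add: dist_commute)
    hence "dist (\<phi> (h x)) (\<phi> (g x)) < e" using d K(2)[OF h(1)] by blast
    thus ?thesis by (simp add: dist_norm norm_minus_commute)
  qed
  thus ?thesis using d(1) by blast
qed

text \<open>The values of \<phi> at the images of \<open>x\<close> lie in a disc about
  \<open>c\<close> and their average lies on its boundary, so they all equal the average. The centre
  is kept free because it will also be a value of a limit function.\<close>

lemma Mop_extremal: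
  assumes I: "invK K" and C: "continuous_on K \<phi>" "bm \<phi>" and x: "x \<in> K"
    and A: "\<And>g. g \<in> supp \<tau> \<Longrightarrow> cmod (\<phi> (g x) - c) \<le> A" and eq: "cmod (Mop \<tau> \<phi> x - c) = A"
    and g: "g \<in> supp \<tau>"
  shows "\<phi> (g x) = Mop \<tau> \<phi> x"
proof -
  have int: "integrable \<tau> (\<lambda>g. \<phi> (g x))" by (rule bm_integrable[OF C(2)])
  have i: "(\<integral>g. \<phi> (g x) - c \<partial>\<tau>) = Mop \<tau> \<phi> x - c"
    using int by (simp add: Mop_def prob_space)
  have "\<phi> (g x) - c = (\<integral>g. \<phi> (g x) - c \<partial>\<tau>)"
  proof (rule integral_extremal[OF _ A _ _ g])
    show "integrable \<tau> (\<lambda>g. \<phi> (g x) - c)" using int by simp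
    show "cmod (\<integral>g. \<phi> (g x) - c \<partial>\<tau>) = A" unfolding i by (rule eq)
    show "\<exists>d>0. \<forall>h\<in>supp \<tau>. kappa g h < d \<longrightarrow> cmod (\<phi> (g x) - c - (\<phi> (h x) - c)) < e"
      if "g \<in> supp \<tau>" "e > 0" for g e
      using kappa_continuous[OF I C(1) x that] by simp
  qed
  thus ?thesis unfolding i by simp
qed

lemma supp_inv_imp_G:
  assumes "\<And>g. g \<in> supp \<tau> \<Longrightarrow> g ` K \<subseteq> K" "g \<in> G"
  shows "g ` K \<subseteq> K"
  using assms(2)
proof (induction rule: gen_semigroup.induct)
  case (comp g h)
  thus ?case using assms(1)[OF comp.hyps(2)] unfolding image_comp[symmetric] by blast
qed (rule assms(1))

lemma Min_set_invK: "L \<in> Min_sets G \<Longrightarrow> invK L"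
  using Min_setD gen_semigroup.base unfolding invK_def by blast

section \<open>A maximum principle for unimodular eigenfunctions\<close>

lemma eigen_max:
  assumes I: "invK K" and C: "continuous_on K \<phi>" "bm \<phi>"
    and e: "\<And>z. z \<in> K \<Longrightarrow> Mop \<tau> \<phi> z = a * \<phi> z" "cmod a = 1"
    and c: "\<And>z. z \<in> K \<Longrightarrow> cmod (\<phi> z) \<le> c" and z: "z \<in> K" "cmod (\<phi> z) = c" and g: "g \<in> supp \<tau>"
  shows "\<phi> (g z) = a * \<phi> z"
proof -
  have "h z \<in> K" if "h \<in> supp \<tau>" for h using I z(1) that by (auto simp: invK_def)
  hence "\<phi> (g z) = Mop \<tau> \<phi> z"
    by (intro Mop_extremal[OF I C z(1) _ _ g, of 0 c]) (use z c e in \<open>auto simp: norm_mult\<close>)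
  thus ?thesis using e(1)[OF z(1)] by simp
qed

text \<open>At a point of maximal modulus the extremal case gives the same modulus at all images.
  The invariant set so obtained contains a minimal set, through which eigenvalues on larger sets are
  controlled.\<close>

lemma eigen_max_set:
  assumes I: "invK K" "K \<noteq> {}" and C: "continuous_on K \<phi>" "bm \<phi>"
    and e: "\<And>z. z \<in> K \<Longrightarrow> Mop \<tau> \<phi> z = a * \<phi> z" "cmod a = 1"
  obtains c where "\<And>z. z \<in> K \<Longrightarrow> cmod (\<phi> z) \<le> c" "fwd_inv G {z\<in>K. cmod (\<phi> z) = c}"
proof -
  have cK: "compact K" using I by (simp add: invK_def compact_rsphere)
  have cn: "continuous_on K (\<lambda>z. cmod (\<phi> z))" using C by (intro continuous_intros)
  obtain z0 where z0: "z0 \<in> K" "\<forall>z\<in>K. cmod (\<phi> z) \<le> cmod (\<phi> z0)"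
    using continuous_attains_sup[OF cK I(2) cn] by blast
  define c where "c = cmod (\<phi> z0)"
  define E where "E = {z\<in>K. cmod (\<phi> z) = c}"
  have "closed E"
  proof -
    have "closedin (top_of_set K) (K \<inter> (\<lambda>z. cmod (\<phi> z)) -` {c})"
      by (rule continuous_closedin_preimage[OF cn]) simp
    moreover have "K \<inter> (\<lambda>z. cmod (\<phi> z)) -` {c} = E" by (auto simp: E_def)
    ultimately show ?thesis using I(1) by (metis closedin_closed_eq invK_def)
  qed
  moreover have "E \<noteq> {}" using z0 by (auto simp: E_def c_def)
  moreover have "g ` E \<subseteq> E" if g: "g \<in> supp \<tau>" for g
  proof
    fix y assume "y \<in> g ` E"
    then obtain z where z: "z \<in> K" "cmod (\<phi> z) = c" "y = g z" by (auto simp: E_def)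
    have "\<phi> (g z) = a * \<phi> z"
      by (rule eigen_max[OF I(1) C e _ z(1,2) g]) (use z0 in \<open>auto simp: c_def\<close>)
    thus "y \<in> E" using z e(2) I(1) g by (auto simp: E_def norm_mult invK_def)
  qed
  ultimately have "fwd_inv G E"
    unfolding fwd_inv_def using supp_inv_imp_G by (simp add: compact_rsphere)
  thus ?thesis using that[of c] z0 by (simp add: E_def c_def)
qed

lemma eigen_on_Min_set:
  assumes L: "L \<in> Min_sets G" and C: "continuous_on L \<phi>" "bm \<phi>"
    and e: "\<And>z. z \<in> L \<Longrightarrow> Mop \<tau> \<phi> z = a * \<phi> z" "cmod a = 1"
  obtains c where "\<And>z. z \<in> L \<Longrightarrow> cmod (\<phi> z) = c"
    "\<And>n w z. w \<in> words n \<Longrightarrow> z \<in> L \<Longrightarrow> \<phi> (w z) = a ^ n * \<phi> z"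
proof -
  have I: "invK L" by (rule Min_set_invK[OF L])
  obtain c where c: "\<And>z. z \<in> L \<Longrightarrow> cmod (\<phi> z) \<le> c" "fwd_inv G {z\<in>L. cmod (\<phi> z) = c}"
    by (rule eigen_max_set[OF I Min_setD(3)[OF L] C e]) metis+
  have "{z\<in>L. cmod (\<phi> z) = c} = L" by (rule Min_setD(5)[OF L c(2)]) blast
  hence cc: "cmod (\<phi> z) = c" if "z \<in> L" for z using that by blast
  have "\<phi> (w z) = a ^ n * \<phi> z" if "w \<in> words n" "z \<in> L" for n w z
    using that
  proof (induction n arbitrary: w z)
    case (Suc n)
    then obtain v g where v: "w = v \<circ> g" "v \<in> words n" "g \<in> supp \<tau>" by (auto elim: words_SucE)
    have "g z \<in> L" using I v Suc.prems by (auto simp: invK_def)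
    moreover have "\<phi> (g z) = a * \<phi> z"
      using eigen_max[OF I C e c(1) Suc.prems(2) cc[OF Suc.prems(2)] v(3)] .
    ultimately show ?case using Suc.IH[OF v(2)] by (simp add: v(1))
  qed simp
  thus ?thesis using that cc by blast
qed

end

context mean_stable
begin

section \<open>Eigenfunctions and cyclic classes\<close>

lemma Min_set_F: "L \<in> Min_sets G \<Longrightarrow> L \<subseteq> F"
  using SF by blast

lemma ae_constant: "bm \<psi> \<Longrightarrow> (\<And>g. g \<in> supp \<tau> \<Longrightarrow> \<psi> (g z) = c) \<Longrightarrow> Mop \<tau> \<psi> z = c"
proof -
  assume b: "bm \<psi>" and c: "\<And>g. g \<in> supp \<tau> \<Longrightarrow> \<psi> (g z) = c"
  have "Mop \<tau> \<psi> z = (\<integral>g. c \<partial>\<tau>)"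
    unfolding Mop_def
  proof (rule integral_cong_AE)
    show "(\<lambda>g. \<psi> (g z)) \<in> borel_measurable \<tau>" by (rule borel_measurable_integrable[OF bm_integrable[OF b]])
    show "AE g in \<tau>. \<psi> (g z) = c" using AE_supp by eventually_elim (rule c)
  qed simp
  thus ?thesis by (simp add: prob_space)
qed

text \<open>All generators send \<open>z\<close> into the same class, so the average is over a
  constant.\<close>

lemma Mop_class_function:
  assumes L: "L \<in> Min_sets G" and b: "bm \<psi>"
    and cl: "\<And>x y. x \<in> L \<Longrightarrow> y \<in> L \<Longrightarrow> sim x y \<Longrightarrow> \<psi> x = \<psi> y" and \<gamma>: "\<gamma> \<in> supp \<tau>" and z: "z \<in> L"
  shows "Mop \<tau> \<psi> z = \<psi> (\<gamma> z)"
proof (rule ae_constant[OF b])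
  fix g assume g: "g \<in> supp \<tau>"
  have "sim (g z) (\<gamma> z)" by (rule sim_star[OF L Min_set_F[OF L] z words_1[OF g] words_1[OF \<gamma>]])
  moreover have "g z \<in> L" "\<gamma> z \<in> L" using Min_set_invK[OF L] g \<gamma> z by (auto simp: invK_def)
  ultimately show "\<psi> (g z) = \<psi> (\<gamma> z)" by (intro cl)
qed

text \<open>Words of length \<open>k\<close> multiply both values by the same \<open>a ^ k\<close>
  of modulus 1. The difference thus keeps its modulus while the two points come together, against
  uniform continuity.\<close>

lemma eigen_class_function:
  assumes L: "L \<in> Min_sets G" and C: "continuous_on L \<phi>" "bm \<phi>"
    and e: "\<And>z. z \<in> L \<Longrightarrow> Mop \<tau> \<phi> z = a * \<phi> z" "cmod a = 1"
    and xy: "x \<in> L" "y \<in> L" "sim x y"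
  shows "\<phi> x = \<phi> y"
proof (rule ccontr)
  assume "\<phi> x \<noteq> \<phi> y"
  hence e0: "cmod (\<phi> x - \<phi> y) > 0" by simp
  obtain d where d: "d > 0" "\<And>u v. u \<in> L \<Longrightarrow> v \<in> L \<Longrightarrow> dist u v < d \<Longrightarrow> dist (\<phi> u) (\<phi> v) < cmod (\<phi> x - \<phi> y)"
    using compact_uniformly_continuous[OF C(1) Min_setD(1)[OF L]] e0
    unfolding uniformly_continuous_on_def by metis
  obtain k g h where g: "g \<in> words k" "h \<in> words k" "ds (g x) (h y) < d" using simD[OF xy(3) d(1)] .
  obtain c where "\<And>n w z. w \<in> words n \<Longrightarrow> z \<in> L \<Longrightarrow> \<phi> (w z) = a ^ n * \<phi> z"
    by (rule eigen_on_Min_set[OF L C e]) metis+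
  hence "\<phi> (g x) - \<phi> (h y) = a ^ k * (\<phi> x - \<phi> y)" using g xy by (simp add: algebra_simps)
  hence "cmod (\<phi> (g x) - \<phi> (h y)) = cmod (\<phi> x - \<phi> y)" using e(2) by (simp add: norm_mult norm_power)
  moreover have "dist (\<phi> (g x)) (\<phi> (h y)) < cmod (\<phi> x - \<phi> y)"
    using g dist_le_ds[of "g x" "h y"] words_inv[OF _ _ Min_setD(4)[OF L]] xy by (intro d(2)) auto
  ultimately show False by (simp add: dist_norm)
qed

text \<open>The indicator functions of the classes form a basis of the span. They are continuous
  because classes are open in \<open>L\<close>, and they belong to the span because the operator
  moves them with period \<open>d\<close>. Conversely, every unimodular eigenfunction is a function
  of the class.\<close>

lemma Min_set_period:
  assumes L: "L \<in> Min_sets G"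
  obtains d where "d > 0" "cdim (LS (Ufun \<tau> L)) = d"
    "\<And>\<phi> a. continuous_on L \<phi> \<Longrightarrow> bm \<phi> \<Longrightarrow> (\<And>z. z \<in> L \<Longrightarrow> Mop \<tau> \<phi> z = a * \<phi> z) \<Longrightarrow> cmod a = 1 \<Longrightarrow>
       (\<exists>z\<in>L. \<phi> z \<noteq> 0) \<Longrightarrow> a ^ d = 1"
    "\<And>z \<gamma>. z \<in> L \<Longrightarrow> \<gamma> \<in> supp \<tau> \<Longrightarrow> sim ((\<gamma> ^^ d) z) z"
proof -
  note LF = Min_set_F[OF L]
  obtain \<gamma> where \<gamma>: "\<gamma> \<in> supp \<tau>" using supp_ne by blast
  obtain x0 where x0: "x0 \<in> L" using Min_setD(3)[OF L] by blast
  obtain d where d: "d > 0" "sim ((\<gamma> ^^ d) x0) x0"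
    "\<And>i j. i < d \<Longrightarrow> j < d \<Longrightarrow> sim ((\<gamma> ^^ i) x0) ((\<gamma> ^^ j) x0) \<Longrightarrow> i = j"
    "\<And>y. y \<in> L \<Longrightarrow> \<exists>i<d. sim y ((\<gamma> ^^ i) x0)"
    by (rule cyclic_classes[OF L LF R x0 \<gamma>]) blast
  define x where "x = (\<lambda>i. (\<gamma> ^^ i) x0)"
  have w: "\<gamma> ^^ n \<in> words n" for n by (rule funpow_words[OF \<gamma>])
  have wL: "u z \<in> L" if "u \<in> words n" "z \<in> L" for u n z
    by (rule words_inv[OF that Min_setD(4)[OF L]])
  have xL: "x i \<in> L" for i unfolding x_def by (rule wL[OF w x0])
  have per\<gamma>: "sim ((\<gamma> ^^ d) z) z" if z: "z \<in> L" for z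
  proof -
    obtain i where i: "sim z (x i)" using d(4)[OF z] by (auto simp: x_def)
    have 1: "sim ((\<gamma> ^^ d) z) ((\<gamma> ^^ d) (x i))" by (rule sim_words[OF L LF z xL i w w])
    have "(\<gamma> ^^ d) (x i) = (\<gamma> ^^ i) (x d)" unfolding x_def by (metis add.commute comp_apply funpow_add)
    moreover have "sim ((\<gamma> ^^ i) (x d)) ((\<gamma> ^^ i) x0)"
      by (rule sim_words[OF L LF xL x0 _ w w]) (use d(2) in \<open>simp add: x_def\<close>)
    ultimately have 2: "sim ((\<gamma> ^^ d) (x i)) (x i)" by (simp add: x_def)
    show ?thesis
      by (rule sim_trans[OF L LF _ 1 sim_trans[OF L LF xL 2 sim_sym[OF i]]]) (rule wL[OF w xL])
  qed
  have per: "sim ((\<gamma>' ^^ d) z) z" if z: "z \<in> L" and \<gamma>': "\<gamma>' \<in> supp \<tau>" for z \<gamma>'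
    by (rule sim_trans[OF L LF wL[OF w z] sim_star[OF L LF z funpow_words[OF \<gamma>'] w] per\<gamma>[OF z]])
  have root: "a ^ d = 1"
    if C: "continuous_on L \<phi>" "bm \<phi>" and e: "\<And>z. z \<in> L \<Longrightarrow> Mop \<tau> \<phi> z = a * \<phi> z" "cmod a = 1"
      and nz: "\<exists>z\<in>L. \<phi> z \<noteq> 0" for \<phi> a
  proof -
    obtain c where c: "\<And>n w z. w \<in> words n \<Longrightarrow> z \<in> L \<Longrightarrow> \<phi> (w z) = a ^ n * \<phi> z"
      by (rule eigen_on_Min_set[OF L C e]) metis+
    obtain z where z: "z \<in> L" "\<phi> z \<noteq> 0" using nz by blast
    have "\<phi> ((\<gamma> ^^ d) z) = \<phi> z" by (rule eigen_class_function[OF L C e wL[OF w z(1)] z(1) per\<gamma>[OF z(1)]])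
    thus ?thesis using c[OF w z(1), of d] z(2) by simp
  qed
  define ind where "ind = (\<lambda>i z. if z \<in> L \<and> sim z (x i) then 1 else 0 :: complex)"
  have I: "invK L" by (rule Min_set_invK[OF L])
  have ind_class: "ind i u = ind i v" if "u \<in> L" "v \<in> L" "sim u v" for i u v
    using that sim_trans[OF L LF that(1), of v "x i"] sim_trans[OF L LF that(2), of u "x i"] sim_sym[OF that(3)]
    by (auto simp: ind_def)
  obtain \<rho> where \<rho>: "\<rho> > 0" "\<And>x y. x \<in> L \<Longrightarrow> dist x y < \<rho> \<Longrightarrow> sim x y"
    by (rule sim_near[OF L LF R]) blast
  have indC: "CK L (ind i)" for i
    unfolding CK_def continuous_on_iff
  proof (intro conjI ballI allI impI)
    fix u and e :: real assume u: "u \<in> L" and e: "e > 0"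
    show "\<exists>d>0. \<forall>v\<in>L. dist v u < d \<longrightarrow> dist (ind i v) (ind i u) < e"
      using \<rho> ind_class u e by (intro exI[of _ \<rho>]) (metis dist_self)
  qed (simp add: ind_def)
  have NKcl: "(NK L ^^ k) (ind i) z = ind i ((\<gamma> ^^ k) z)" if "z \<in> L" for k i z
    using that
  proof (induction k arbitrary: z)
    case (Suc k)
    have cl: "(NK L ^^ k) (ind i) u = (NK L ^^ k) (ind i) v" if "u \<in> L" "v \<in> L" "sim u v" for u v
      unfolding Suc.IH[OF that(1)] Suc.IH[OF that(2)]
      by (rule ind_class[OF wL[OF w that(1)] wL[OF w that(2)] sim_words[OF L LF that w w]])
    have \<gamma>z: "\<gamma> z \<in> L" using I \<gamma> Suc.prems by (auto simp: invK_def)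
    have "(NK L ^^ Suc k) (ind i) z = Mop \<tau> ((NK L ^^ k) (ind i)) z" using Suc.prems by (simp add: NK_def)
    also have "\<dots> = (NK L ^^ k) (ind i) (\<gamma> z)"
      by (rule Mop_class_function[OF L CK_bm[OF CK_NK_iter[OF indC I] I] cl \<gamma> Suc.prems])
    also have "\<dots> = ind i ((\<gamma> ^^ k) (\<gamma> z))" by (rule Suc.IH[OF \<gamma>z])
    finally show ?case by (simp add: funpow_swap1)
  qed simp
  have ind_LS: "ind i \<in> LS (Ufun \<tau> L)" for i
  proof (rule periodic_in_LS[OF I indC d(1)], rule ext)
    fix z
    show "(NK L ^^ d) (ind i) z = ind i z"
    proof (cases "z \<in> L")
      case True
      thus ?thesis using NKcl[OF True] ind_class[OF wL[OF w True] True per\<gamma>[OF True]] by simp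
    next
      case False
      thus ?thesis using CK_NK_iter[OF indC I, of d i] by (simp add: CK_def ind_def)
    qed
  qed
  define B where "B = ind ` {..<d}"
  have ind_x: "ind i (x j) = (if i = j then 1 else 0)" if "i < d" "j < d" for i j
    using d(3)[of j i] that xL by (auto simp: ind_def x_def)
  have inj: "inj_on ind {..<d}"
  proof
    fix i j assume ij: "i \<in> {..<d}" "j \<in> {..<d}" "ind i = ind j"
    have "ind i (x i) = ind j (x i)" using ij(3) by simp
    thus "i = j" using ind_x[of i i] ind_x[of j i] ij by (auto split: if_splits)
  qed
  have "Ufun \<tau> L \<subseteq> fs.span B"
  proof
    fix \<phi> assume "\<phi> \<in> Ufun \<tau> L"
    then obtain a where \<phi>: "continuous_on L \<phi>" "\<forall>z. z \<notin> L \<longrightarrow> \<phi> z = 0" "cmod a = 1"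
      "\<And>z. z \<in> L \<Longrightarrow> Mop \<tau> \<phi> z = a * \<phi> z"
      unfolding Ufun_def by blast
    have bm: "bm \<phi>" using \<phi> I by (intro CK_bm[of L]) (auto simp: CK_def)
    have "\<phi> = (\<Sum>i<d. fscale (\<phi> (x i)) (ind i))"
    proof
      fix z
      show "\<phi> z = (\<Sum>i<d. fscale (\<phi> (x i)) (ind i)) z"
      proof (cases "z \<in> L")
        case True
        obtain j where j: "j < d" "sim z (x j)" using d(4)[OF True] by (auto simp: x_def)
        have "fscale (\<phi> (x i)) (ind i) z = (if i = j then \<phi> z else 0)" if "i < d" for i
        proof -
          have "ind i z = ind i (x j)" by (rule ind_class[OF True xL j(2)])
          moreover have "\<phi> z = \<phi> (x j)"
            by (rule eigen_class_function[OF L \<phi>(1) bm \<phi>(4,3) True xL j(2)])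
          ultimately show ?thesis using ind_x[OF that j(1)] by (simp add: fscale_def)
        qed
        hence "(\<Sum>i<d. fscale (\<phi> (x i)) (ind i) z) = (\<Sum>i<d. if i = j then \<phi> z else 0)"
          by (intro sum.cong) auto
        thus ?thesis using j(1) by (simp add: sum_fun_eval)
      next
        case False
        thus ?thesis using \<phi>(2) by (simp add: sum_fun_eval fscale_def ind_def)
      qed
    qed
    also have "\<dots> \<in> fs.span B"
      by (intro fs.span_sum fs.span_scale fs.span_base) (auto simp: B_def)
    finally show "\<phi> \<in> fs.span B" .
  qed
  moreover have "B \<subseteq> fs.span (Ufun \<tau> L)" using ind_LS by (auto simp: B_def LS_def)
  ultimately have span: "fs.span (Ufun \<tau> L) = fs.span B" by (metis fs.span_eq)
  have "fs.independent B"
  proof (rule fs.independent_if_scalars_zero)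
    show "finite B" by (simp add: B_def)
    fix f b assume s: "(\<Sum>b\<in>B. fscale (f b) b) = 0" and b: "b \<in> B"
    obtain j where j: "j < d" "b = ind j" using b by (auto simp: B_def)
    have "0 = (\<Sum>b\<in>B. fscale (f b) b) (x j)" by (simp add: s)
    also have "\<dots> = (\<Sum>i<d. f (ind i) * ind i (x j))"
      by (simp add: sum_fun_eval B_def sum.reindex[OF inj] fscale_def)
    also have "\<dots> = (\<Sum>i<d. if i = j then f (ind i) else 0)"
      using ind_x j(1) by (intro sum.cong) auto
    also have "\<dots> = f b" using j by simp
    finally show "f b = 0" by simp
  qed
  hence "fs.dim (fs.span B) = card B" by (simp add: fs.dim_span fs.dim_eq_card_independent)
  hence "cdim (LS (Ufun \<tau> L)) = d"
    unfolding cdim_def LS_def span by (simp add: B_def card_image[OF inj])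
  thus ?thesis using that[OF d(1)] root per by blast
qed

end

section \<open>Limit functions\<close>

lemma Arzela_Ascoli_hl:
  assumes \<alpha>: "\<alpha> > 0" and hl: "\<And>k::nat. hl \<alpha> H (f k)" and bd: "\<And>k x. cmod (f k x) \<le> s"
  obtains r \<psi> where "strict_mono (r :: nat \<Rightarrow> nat)"
    "\<And>e. e > 0 \<Longrightarrow> \<exists>N. \<forall>n\<ge>N. \<forall>x. cmod (f (r n) x - \<psi> x) < e"
proof (rule Arzela_Ascoli[of "sphere 0 1" "\<lambda>n p. f n (Abs_rsphere p)" s])
  show "compact (sphere (0 :: complex \<times> real) 1)" by simp
  show "cmod (f n (Abs_rsphere p)) \<le> s" for n p by (rule bd)
  show "\<exists>d. 0 < d \<and> (\<forall>n q. q \<in> sphere 0 1 \<and> norm (p - q) < d \<longrightarrow>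
      cmod (f n (Abs_rsphere p) - f n (Abs_rsphere q)) < e)"
    if p: "p \<in> sphere 0 1" and e: "e > 0" for p :: "complex \<times> real" and e :: real
  proof -
    obtain d where d: "d > 0" "\<And>\<phi> x y. hl \<alpha> H \<phi> \<Longrightarrow> dist x y < d \<Longrightarrow> dist (\<phi> x) (\<phi> y) < e"
      using hl_modulus[OF \<alpha> e] by metis
    have "dist (Abs_rsphere p) (Abs_rsphere q) = norm (p - q)" if "q \<in> sphere 0 1" for q
      using p that unfolding range_Rep[symmetric]
      by (auto simp: dist_rsphere_def Rep_rsphere_inverse dist_norm)
    thus ?thesis using d hl by (metis dist_norm)
  qed
next
  fix g k assume k: "strict_mono (k :: nat \<Rightarrow> nat)"
    and lim: "\<And>e. 0 < e \<Longrightarrow> \<exists>N. \<forall>n p. N \<le> n \<and> p \<in> sphere (0 :: complex \<times> real) 1 \<longrightarrow>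
        cmod (f (k n) (Abs_rsphere p) - g p) < e"
  show thesis
  proof (rule that[OF k, of "\<lambda>x. g (Rep_rsphere x)"])
    fix e :: real assume "e > 0"
    then obtain N where N: "\<forall>n p. N \<le> n \<and> p \<in> sphere 0 1 \<longrightarrow> cmod (f (k n) (Abs_rsphere p) - g p) < e"
      using lim by blast
    have "Rep_rsphere x \<in> sphere 0 1" for x unfolding range_Rep[symmetric] by simp
    thus "\<exists>N. \<forall>n\<ge>N. \<forall>x. cmod (f (k n) x - g (Rep_rsphere x)) < e"
      using N by (metis Rep_rsphere_inverse)
  qed
qed

text \<open>The first conclusion of \<open>doeblin_fortet\<close> governs the analysis of limit
  functions; the second enters in the final decay estimate.\<close>

locale power_bounded = mean_stable +
  fixes \<alpha> C :: real
  assumes \<alpha>: "0 < \<alpha>" "\<alpha> < 1" and C: "C \<ge> 1"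
    and power_bounded: "\<And>\<phi> A j. hl \<alpha> A \<phi> \<Longrightarrow> (\<And>x. cmod (\<phi> x) \<le> A) \<Longrightarrow> hl \<alpha> (C * A) (Mn j \<phi>)"
begin

lemma Mn_dist:
  assumes "continuous_on UNIV \<phi>" "continuous_on UNIV \<psi>" "\<And>z. cmod (\<phi> z - \<psi> z) \<le> A"
  shows "cmod (Mn n \<phi> z - Mn n \<psi> z) \<le> A"
proof -
  have "cmod (Mn n (\<lambda>z. \<phi> z - \<psi> z) z) \<le> A"
    using assms by (intro Mn_bound continuous_intros)
  thus ?thesis by (simp add: Mn_diff[OF assms(1,2)])
qed

text \<open>The omega-limit set of \<phi> under the iterates, in the supremum norm.\<close>

definition Om :: "(rsphere \<Rightarrow> complex) \<Rightarrow> (rsphere \<Rightarrow> complex) set" where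
  "Om \<phi> = {\<psi>. \<forall>\<epsilon>>0. \<forall>n. \<exists>k\<ge>n. \<forall>x. cmod (Mn k \<phi> x - \<psi> x) < \<epsilon>}"

definition rr :: nat where
  "rr = (\<Prod>L\<in>Min_sets G. cdim (LS (Ufun \<tau> L)))"

lemma rr_pos: "rr > 0"
proof -
  have "cdim (LS (Ufun \<tau> L)) > 0" if "L \<in> Min_sets G" for L
    by (rule Min_set_period[OF that]) simp
  thus ?thesis unfolding rr_def by (intro prod_pos)
qed

lemma dvd_rr: "L \<in> Min_sets G \<Longrightarrow> cdim (LS (Ufun \<tau> L)) dvd rr"
  unfolding rr_def using finite_Min_sets[OF SF R] by (intro dvd_prodI)

text \<open>The maximum set of the modulus contains a minimal set \<open>L\<close>, on which the
  eigenfunction does not vanish. There the order of \<open>a\<close> divides the period of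
  \<open>L\<close>, which divides \<open>rr\<close>.\<close>

lemma eigenvalue_root_of_unity:
  assumes \<phi>: "continuous_on UNIV \<phi>" and e: "\<And>z. Mop \<tau> \<phi> z = a * \<phi> z" "cmod a = 1" and nz: "\<exists>z. \<phi> z \<noteq> 0"
  shows "a ^ rr = 1"
proof -
  have I: "invK UNIV" by (simp add: invK_def)
  have bm: "bm \<phi>" by (rule continuous_bm[OF \<phi>])
  obtain c where c: "\<And>z. cmod (\<phi> z) \<le> c" "fwd_inv G {z\<in>UNIV. cmod (\<phi> z) = c}"
    by (rule eigen_max_set[OF I UNIV_not_empty \<phi> bm e]) auto
  obtain L where L: "L \<in> Min_sets G" "L \<subseteq> {z. cmod (\<phi> z) = c}"
    using Min_sets_exist[OF c(2)] by auto
  obtain z0 where "\<phi> z0 \<noteq> 0" using nz by blast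
  hence "c > 0" using c(1)[of z0] by (meson less_le_trans zero_less_norm_iff)
  hence nzL: "\<exists>z\<in>L. \<phi> z \<noteq> 0" using L(2) Min_setD(3)[OF L(1)] by fastforce
  have cL: "continuous_on L \<phi>" using \<phi> continuous_on_subset by blast
  obtain d where d: "cdim (LS (Ufun \<tau> L)) = d" "a ^ d = 1"
  proof (rule Min_set_period[OF L(1)])
    fix d assume "cdim (LS (Ufun \<tau> L)) = d"
      "\<And>\<phi> a. continuous_on L \<phi> \<Longrightarrow> bm \<phi> \<Longrightarrow> (\<And>z. z \<in> L \<Longrightarrow> Mop \<tau> \<phi> z = a * \<phi> z) \<Longrightarrow> cmod a = 1 \<Longrightarrow>
       (\<exists>z\<in>L. \<phi> z \<noteq> 0) \<Longrightarrow> a ^ d = 1"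
    thus thesis using that cL bm e nzL by blast
  qed
  then obtain q where "rr = d * q" using dvd_rr[OF L(1)] by (auto simp: dvd_def)
  thus ?thesis using d by (simp add: power_mult)
qed

lemma LS_Ufun_UNIV:
  assumes "\<psi> \<in> LS (Ufun \<tau> UNIV)"
  shows "continuous_on UNIV \<psi>" "Mn rr \<psi> = \<psi>"
proof -
  have "continuous_on UNIV \<psi> \<and> Mn rr \<psi> = \<psi>"
    using assms unfolding LS_def
  proof (induction rule: fs.span_induct_alt)
    case base
    have "Mn n (\<lambda>z. 0) = (\<lambda>z. 0)" for n by (induction n) (auto simp: Mop_def)
    thus ?case by (simp add: zero_fun_def)
  next
    case (step c u y)
    then obtain a where u: "continuous_on UNIV u" "\<exists>z. u z \<noteq> 0" "cmod a = 1" "\<And>z. Mop \<tau> u z = a * u z"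
      unfolding Ufun_def by auto
    have "Mn n u = (\<lambda>z. a ^ n * u z)" for n
    proof (induction n)
      case (Suc n)
      show ?case unfolding funpow.simps comp_apply Suc.IH
        by (rule ext) (simp add: Mop_scale u(4))
    qed simp
    hence Mu: "Mn rr u = u" using eigenvalue_root_of_unity[OF u(1,4,3,2)] by simp
    have cu: "continuous_on UNIV (\<lambda>z. c * u z)" using u(1) by (intro continuous_intros)
    have e: "fscale c u + y = (\<lambda>z. c * u z + y z)" by (simp add: fscale_def plus_fun_def)
    have "Mn rr (fscale c u + y) = (\<lambda>z. Mn rr (\<lambda>z. c * u z) z + Mn rr y z)"
      unfolding e using Mn_add[OF cu] step by blast
    also have "\<dots> = fscale c u + y" unfolding Mn_scale Mu e using step by simp
    finally show ?case unfolding e using cu step by (auto intro!: continuous_intros)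
  qed
  thus "continuous_on UNIV \<psi>" "Mn rr \<psi> = \<psi>" by auto
qed

context
  fixes \<phi> A assumes \<phi>: "hl \<alpha> A \<phi>" "\<And>x. cmod (\<phi> x) \<le> A"
begin

lemma \<phi>_cont: "continuous_on UNIV \<phi>"
  by (rule hl_continuous[OF \<phi>(1) \<alpha>(1)])

lemma Om_bounds:
  assumes "\<psi> \<in> Om \<phi>"
  shows "hl \<alpha> (C * A) \<psi>" "cmod (\<psi> x) \<le> A"
proof -
  have near: "\<exists>k. \<forall>x. cmod (Mn k \<phi> x - \<psi> x) < \<epsilon>" if "\<epsilon> > 0" for \<epsilon>
    using assms that unfolding Om_def by blast
  show "cmod (\<psi> x) \<le> A"
  proof (rule field_le_epsilon)
    fix \<epsilon> :: real assume "\<epsilon> > 0"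
    then obtain k where "\<forall>x. cmod (Mn k \<phi> x - \<psi> x) < \<epsilon>" using near by blast
    hence "cmod (Mn k \<phi> x - \<psi> x) < \<epsilon>" by blast
    moreover have "cmod (Mn k \<phi> x) \<le> A" by (rule Mn_bound[OF \<phi>_cont \<phi>(2)])
    ultimately show "cmod (\<psi> x) \<le> A + \<epsilon>" using norm_triangle_sub[of "\<psi> x" "Mn k \<phi> x"]
      by (simp add: norm_minus_commute)
  qed
  show "hl \<alpha> (C * A) \<psi>"
    unfolding hl_def
  proof (intro allI, rule field_le_epsilon)
    fix x y and \<epsilon> :: real assume "\<epsilon> > 0"
    then obtain k where k: "\<forall>x. cmod (Mn k \<phi> x - \<psi> x) < \<epsilon>/2" using near[of "\<epsilon>/2"] by auto
    have "hl \<alpha> (C * A) (Mn k \<phi>)" by (rule power_bounded[OF \<phi>])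
    hence "dist (Mn k \<phi> x) (Mn k \<phi> y) \<le> C * A * dist x y powr \<alpha>" by (simp add: hl_def dist_norm)
    moreover have "dist (\<psi> x) (\<psi> y) \<le> dist (\<psi> x) (Mn k \<phi> x) + dist (Mn k \<phi> x) (Mn k \<phi> y) + dist (Mn k \<phi> y) (\<psi> y)"
      by (rule dist_triangle4)
    moreover have "dist (\<psi> x) (Mn k \<phi> x) < \<epsilon>/2" "dist (Mn k \<phi> y) (\<psi> y) < \<epsilon>/2"
      using k by (auto simp: dist_norm norm_minus_commute)
    ultimately show "cmod (\<psi> x - \<psi> y) \<le> C * A * dist x y powr \<alpha> + \<epsilon>" by (simp add: dist_norm)
  qed
qed

lemma Om_cont: "\<psi> \<in> Om \<phi> \<Longrightarrow> continuous_on T \<psi>"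
  by (rule hl_continuous[OF Om_bounds(1) \<alpha>(1)])

lemma Om_closed:
  assumes "\<And>\<epsilon>. \<epsilon> > 0 \<Longrightarrow> \<exists>\<psi>'\<in>Om \<phi>. \<forall>x. cmod (\<psi>' x - \<psi> x) < \<epsilon>"
  shows "\<psi> \<in> Om \<phi>"
  unfolding Om_def
proof (intro CollectI allI impI)
  fix \<epsilon> :: real and n assume "\<epsilon> > 0"
  then obtain \<psi>' where \<psi>': "\<psi>' \<in> Om \<phi>" "\<forall>x. cmod (\<psi>' x - \<psi> x) < \<epsilon>/2" using assms[of "\<epsilon>/2"] by auto
  then obtain k where k: "k \<ge> n" "\<forall>x. cmod (Mn k \<phi> x - \<psi>' x) < \<epsilon>/2"
  proof -
    have "\<forall>\<epsilon>>0. \<forall>n. \<exists>k\<ge>n. \<forall>x. cmod (Mn k \<phi> x - \<psi>' x) < \<epsilon>" using \<psi>'(1) by (simp add: Om_def)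
    from this[rule_format, of "\<epsilon>/2" n] show ?thesis using that \<open>\<epsilon> > 0\<close> by auto
  qed
  have "cmod (Mn k \<phi> x - \<psi> x) < \<epsilon>" for x
  proof -
    have "dist (Mn k \<phi> x) (\<psi>' x) < \<epsilon>/2" "dist (\<psi>' x) (\<psi> x) < \<epsilon>/2"
      using k \<psi>' by (auto simp: dist_norm)
    thus ?thesis using dist_triangle[of "Mn k \<phi> x" "\<psi> x" "\<psi>' x"] by (simp add: dist_norm)
  qed
  thus "\<exists>k\<ge>n. \<forall>x. cmod (Mn k \<phi> x - \<psi> x) < \<epsilon>" using k(1) by blast
qed

lemma limit_in_Om:
  assumes k: "\<And>i. k i \<ge> i" and lim: "\<And>e. e > 0 \<Longrightarrow> \<exists>N. \<forall>n\<ge>N. \<forall>x. cmod (Mn (k n) \<phi> x - \<psi> x) < e"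
  shows "\<psi> \<in> Om \<phi>"
  unfolding Om_def
proof (intro CollectI allI impI)
  fix \<epsilon> :: real and n assume "\<epsilon> > 0"
  then obtain N where N: "\<forall>n\<ge>N. \<forall>x. cmod (Mn (k n) \<phi> x - \<psi> x) < \<epsilon>" using lim by blast
  have "k (max N n) \<ge> n" using k[of "max N n"] by simp
  thus "\<exists>k\<ge>n. \<forall>x. cmod (Mn k \<phi> x - \<psi> x) < \<epsilon>" using N max.cobounded1 by blast
qed

text \<open>The iterates one step earlier converge along a subsequence. With this surjectivity the
  maximum principle can be run for any number of letters: an extremal limit function comes from
  another limit function observed after one more letter.\<close>

lemma Om_preimage:
  assumes "\<psi> \<in> Om \<phi>"
  obtains \<psi>' where "\<psi>' \<in> Om \<phi>" "Mop \<tau> \<psi>' = \<psi>"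
proof -
  have "\<forall>j. \<exists>k\<ge>Suc j. \<forall>x. cmod (Mn k \<phi> x - \<psi> x) < inverse (real (Suc j))"
    using assms unfolding Om_def by auto
  then obtain k where k: "\<And>j. k j \<ge> Suc j" "\<And>j x. cmod (Mn (k j) \<phi> x - \<psi> x) < inverse (real (Suc j))"
    by metis
  define f where "f = (\<lambda>j. Mn (k j - 1) \<phi>)"
  obtain r \<psi>' where r: "strict_mono (r :: nat \<Rightarrow> nat)"
    "\<And>e. e > 0 \<Longrightarrow> \<exists>N. \<forall>n\<ge>N. \<forall>x. cmod (f (r n) x - \<psi>' x) < e"
  proof (rule Arzela_Ascoli_hl[OF \<alpha>(1), of "C * A" f A])
    show "hl \<alpha> (C * A) (f k)" for k unfolding f_def by (rule power_bounded[OF \<phi>])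
    show "cmod (f k x) \<le> A" for k x unfolding f_def by (rule Mn_bound[OF \<phi>_cont \<phi>(2)])
  qed metis
  have \<psi>': "\<psi>' \<in> Om \<phi>"
  proof (rule limit_in_Om[of "\<lambda>n. k (r n) - 1"])
    show "i \<le> k (r i) - 1" for i using k(1)[of "r i"] seq_suble[OF r(1), of i] by simp
  qed (use r(2) in \<open>simp add: f_def\<close>)
  have "cmod (Mop \<tau> \<psi>' x - \<psi> x) \<le> 0" for x
  proof (rule field_le_epsilon)
    fix \<epsilon> :: real assume e: "\<epsilon> > 0"
    obtain N where N: "\<forall>n\<ge>N. \<forall>x. cmod (f (r n) x - \<psi>' x) < \<epsilon>/2" using r(2)[of "\<epsilon>/2"] e by auto
    obtain M where M: "inverse (real (Suc M)) < \<epsilon>/2" using reals_Archimedean[of "\<epsilon>/2"] e by auto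
    define n where "n = max N M"
    have "cmod (Mn 1 (f (r n)) x - Mn 1 \<psi>' x) \<le> \<epsilon>/2"
    proof (rule Mn_dist)
      show "continuous_on UNIV (f (r n))" unfolding f_def by (rule Mn_continuous[OF \<phi>_cont])
      show "continuous_on UNIV \<psi>'" by (rule Om_cont[OF \<psi>'])
      show "cmod (f (r n) z - \<psi>' z) \<le> \<epsilon>/2" for z using N by (simp add: n_def less_imp_le)
    qed
    moreover have "Mn 1 (f (r n)) = Mn (k (r n)) \<phi>"
    proof -
      have "k (r n) = Suc (k (r n) - 1)" using k(1)[of "r n"] by simp
      thus ?thesis unfolding f_def by (metis One_nat_def comp_apply funpow.simps(2) funpow_0)
    qed
    moreover have "cmod (Mn (k (r n)) \<phi> x - \<psi> x) < \<epsilon>/2"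
    proof -
      have "M \<le> r n" using seq_suble[OF r(1), of n] by (simp add: n_def)
      hence "inverse (real (Suc (r n))) \<le> inverse (real (Suc M))" by (intro le_imp_inverse_le) auto
      thus ?thesis using k(2)[of "r n" x] M by linarith
    qed
    ultimately have "dist (Mn (k (r n)) \<phi> x) (Mop \<tau> \<psi>' x) \<le> \<epsilon>/2" "dist (Mn (k (r n)) \<phi> x) (\<psi> x) < \<epsilon>/2"
      by (simp_all add: dist_norm)
    thus "cmod (Mop \<tau> \<psi>' x - \<psi> x) \<le> 0 + \<epsilon>"
      using dist_triangle3[of "Mop \<tau> \<psi>' x" "\<psi> x" "Mn (k (r n)) \<phi> x"] by (simp add: dist_norm)
  qed
  hence "Mop \<tau> \<psi>' = \<psi>" by (auto simp: fun_eq_iff)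
  thus ?thesis using that \<psi>' by blast
qed

lemma Om_in_bcontfun: "\<psi> \<in> Om \<phi> \<Longrightarrow> \<psi> \<in> bcontfun"
  using Om_cont[of \<psi> UNIV] Om_bounds(2)[of \<psi>]
  by (auto simp: bcontfun_def bounded_iff)

text \<open>The limit set as a subset of a Banach space, so that maxima over limit functions and
  points jointly are attained.\<close>

definition OmB :: "(rsphere \<Rightarrow>\<^sub>C complex) set" where
  "OmB = {b. apply_bcontfun b \<in> Om \<phi>}"

lemma compact_OmB: "compact OmB"
  unfolding compact_eq_seq_compact_metric seq_compact_def
proof (intro allI impI)
  fix b :: "nat \<Rightarrow> (rsphere \<Rightarrow>\<^sub>C complex)" assume b: "\<forall>n. b n \<in> OmB"
  hence bO: "apply_bcontfun (b n) \<in> Om \<phi>" for n by (simp add: OmB_def)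
  obtain r \<psi> where r: "strict_mono (r :: nat \<Rightarrow> nat)"
    "\<And>e. e > 0 \<Longrightarrow> \<exists>N. \<forall>n\<ge>N. \<forall>x. cmod (apply_bcontfun (b (r n)) x - \<psi> x) < e"
    by (rule Arzela_Ascoli_hl[OF \<alpha>(1), of "C * A" "\<lambda>n. apply_bcontfun (b n)" A]) (use Om_bounds[OF bO] in auto)
  have \<psi>: "\<psi> \<in> Om \<phi>" by (rule Om_closed) (use r(2) bO in blast)
  define l where "l = Bcontfun \<psi>"
  have l: "apply_bcontfun l = \<psi>" unfolding l_def by (rule Bcontfun_inverse[OF Om_in_bcontfun[OF \<psi>]])
  have "(b \<circ> r) \<longlonglongrightarrow> l"
  proof (rule metric_LIMSEQ_I)
    fix e :: real assume e: "e > 0"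
    then obtain N where N: "\<forall>n\<ge>N. \<forall>x. cmod (apply_bcontfun (b (r n)) x - \<psi> x) < e/2" using r(2)[of "e/2"] by auto
    have "dist ((b \<circ> r) n) l < e" if "n \<ge> N" for n
    proof -
      have "dist ((b \<circ> r) n) l \<le> e/2"
        by (rule dist_bound) (use N that in \<open>simp add: l dist_norm less_imp_le\<close>)
      thus ?thesis using e by simp
    qed
    thus "\<exists>N. \<forall>n\<ge>N. dist ((b \<circ> r) n) l < e" by blast
  qed
  moreover have "l \<in> OmB" using \<psi> l by (simp add: OmB_def)
  ultimately show "\<exists>l\<in>OmB. \<exists>r. strict_mono r \<and> (b \<circ> r) \<longlonglongrightarrow> l" using r(1) by blast
qed

lemma Om_ne: "Om \<phi> \<noteq> {}" and Om_multiple: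
  "q > 0 \<Longrightarrow> \<exists>\<psi>\<in>Om \<phi>. \<forall>\<epsilon>>0. \<exists>k. \<forall>x. cmod (Mn (k * q) \<phi> x - \<psi> x) < \<epsilon>"
proof -
  have *: "\<exists>\<psi>\<in>Om \<phi>. \<forall>\<epsilon>>0. \<exists>k. \<forall>x. cmod (Mn (k * q) \<phi> x - \<psi> x) < \<epsilon>" if q: "q > 0" for q
  proof -
    obtain r \<psi> where r: "strict_mono (r :: nat \<Rightarrow> nat)"
      "\<And>e. e > 0 \<Longrightarrow> \<exists>N. \<forall>n\<ge>N. \<forall>x. cmod (Mn (r n * q) \<phi> x - \<psi> x) < e"
      by (rule Arzela_Ascoli_hl[OF \<alpha>(1), of "C * A" "\<lambda>n. Mn (n * q) \<phi>" A])
        (use power_bounded[OF \<phi>] Mn_bound[OF \<phi>_cont \<phi>(2)] in auto)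
    have "\<psi> \<in> Om \<phi>"
    proof (rule limit_in_Om[of "\<lambda>n. r n * q"])
      show "i \<le> r i * q" for i
        using seq_suble[OF r(1), of i] q mult_le_mono[of i "r i" 1 q] by simp
    qed (use r(2) in blast)
    thus ?thesis using r(2) by blast
  qed
  show "q > 0 \<Longrightarrow> \<exists>\<psi>\<in>Om \<phi>. \<forall>\<epsilon>>0. \<exists>k. \<forall>x. cmod (Mn (k * q) \<phi> x - \<psi> x) < \<epsilon>" by (rule *)
  show "Om \<phi> \<noteq> {}" using *[of 1] by auto
qed

lemma OmB_ne: "OmB \<noteq> {}"
proof -
  obtain \<psi> where \<psi>: "\<psi> \<in> Om \<phi>" using Om_ne by blast
  have "Bcontfun \<psi> \<in> OmB" by (simp add: OmB_def Bcontfun_inverse[OF Om_in_bcontfun[OF \<psi>]] \<psi>)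
  thus ?thesis by blast
qed

lemma Om_obtain_B:
  assumes "\<psi> \<in> Om \<phi>"
  obtains b where "b \<in> OmB" "apply_bcontfun b = \<psi>"
  using that[of "Bcontfun \<psi>"] Bcontfun_inverse[OF Om_in_bcontfun[OF assms]] assms
  by (simp add: OmB_def)

lemma continuous_Mn_eval:
  "continuous_on UNIV (\<lambda>(b, z). Mn n (apply_bcontfun b) z)"
  unfolding continuous_on_iff
proof (intro ballI allI impI)
  fix p :: "(rsphere \<Rightarrow>\<^sub>C complex) \<times> rsphere" and e :: real assume e: "e > 0"
  obtain b z where p: "p = (b, z)" by (cases p)
  have cont: "continuous_on UNIV (apply_bcontfun b)" for b :: "rsphere \<Rightarrow>\<^sub>C complex"
    using apply_bcontfun[of b] by (simp add: bcontfun_def)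
  obtain d where d: "d > 0" "\<forall>z'. dist z' z < d \<longrightarrow> dist (Mn n (apply_bcontfun b) z') (Mn n (apply_bcontfun b) z) < e/2"
    using Mn_continuous[OF cont[of b], of n] e unfolding continuous_on_iff by (metis UNIV_I half_gt_zero)
  have "dist (Mn n (apply_bcontfun b') z') (Mn n (apply_bcontfun b) z) < e"
    if "dist b' b < e/2" "dist z' z < d" for b' z'
  proof -
    have "cmod (Mn n (apply_bcontfun b') z' - Mn n (apply_bcontfun b) z') \<le> dist b' b"
      by (rule Mn_dist[OF cont cont]) (metis dist_norm dist_bounded)
    hence "dist (Mn n (apply_bcontfun b') z') (Mn n (apply_bcontfun b) z') < e/2" using that(1) by (simp add: dist_norm)
    moreover have "dist (Mn n (apply_bcontfun b) z') (Mn n (apply_bcontfun b) z) < e/2" using d that(2) by blast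
    ultimately show ?thesis
      using dist_triangle[of "Mn n (apply_bcontfun b') z'" "Mn n (apply_bcontfun b) z" "Mn n (apply_bcontfun b) z'"] by simp
  qed
  moreover have "dist b' b < min d (e/2) \<and> dist z' z < min d (e/2)" if "dist (b', z') (b, z) < min d (e/2)" for b' z'
    using that dist_fst_le[of "(b', z')" "(b, z)"] dist_snd_le[of "(b', z')" "(b, z)"] by simp
  ultimately show "\<exists>d>0. \<forall>q\<in>UNIV. dist q p < d \<longrightarrow>
      dist (case q of (b, z) \<Rightarrow> Mn n (apply_bcontfun b) z) (case p of (b, z) \<Rightarrow> Mn n (apply_bcontfun b) z) < e"
    unfolding p using d(1) e by (intro exI[of _ "min d (e/2)"]) auto
qed

lemma continuous_Mn_eval_compose:
  assumes "continuous_on T f" "continuous_on T g"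
  shows "continuous_on T (\<lambda>x. Mn n (apply_bcontfun (f x)) (g x))"
  using continuous_on_compose2[OF continuous_Mn_eval continuous_on_Pair[OF assms]] by simp

end

end

context power_bounded
begin

context
  fixes \<phi> A assumes \<phi>: "hl \<alpha> A \<phi>" "\<And>x. cmod (\<phi> x) \<le> A"
begin

lemmas Om_bounds' = Om_bounds[OF \<phi>]
lemmas Om_cont' = Om_cont[OF \<phi>]

text \<open>A difference \<open>\<kappa>\<close> of largest modulus, over all limit functions and
  equivalent pairs in \<open>L\<close>, is attained. By extremality it passes to preimages under the
  operator: for each \<open>k\<close> some limit function has difference \<open>\<kappa>\<close>
  between any two images of \<open>x0\<close> and \<open>y0\<close> under words of length
  \<open>k\<close>. Such images come arbitrarily close, and all limit functions share one Hoelder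
  constant; so \<open>\<kappa> = 0\<close>.\<close>

lemma limit_class_function:
  assumes L: "L \<in> Min_sets G" and \<psi>: "\<psi> \<in> Om \<phi>" and xy: "x \<in> L" "y \<in> L" "sim x y"
  shows "\<psi> x = \<psi> y"
proof -
  note LF = Min_set_F[OF L]
  define Q where "Q = {p \<in> L \<times> L. sim (fst p) (snd p)}"
  have "closure Q \<subseteq> Q"
  proof
    fix p assume p: "p \<in> closure Q"
    obtain u v where uv: "p = (u, v)" by (cases p)
    have "closed (L \<times> L)" using Min_setD(2)[OF L] by (intro closed_Times)
    hence "closure Q \<subseteq> L \<times> L" by (intro closure_minimal) (auto simp: Q_def)
    hence uvL: "u \<in> L" "v \<in> L" using p uv by auto
    have "sim u v"
    proof (rule sim_limit)
      fix \<epsilon> :: real assume "\<epsilon> > 0"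
      then obtain d where d: "d > 0" "\<And>x y. x \<in> L \<Longrightarrow> dist x y < d \<Longrightarrow> ds x y < \<epsilon>"
        using ds_small[OF Min_setD(1)[OF L] LF] by metis
      obtain q where q: "q \<in> Q" "dist q p < d" using p d(1) unfolding closure_approachable by blast
      have "dist u (fst q) < d" "dist v (snd q) < d"
        using q(2) dist_fst_le[of q p] dist_snd_le[of q p] by (simp_all add: uv dist_commute)
      hence "ds u (fst q) < \<epsilon>" "ds v (snd q) < \<epsilon>" using d(2) uvL by blast+
      thus "\<exists>x' y'. ds u x' < \<epsilon> \<and> ds v y' < \<epsilon> \<and> sim x' y'" using q(1) by (auto simp: Q_def)
    qed
    thus "p \<in> Q" using uvL by (simp add: Q_def uv)
  qed
  hence "closed Q" by (simp add: closure_subset_eq)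
  moreover have "Q = (L \<times> L) \<inter> Q" by (auto simp: Q_def)
  ultimately have cQ: "compact Q"
    using compact_Int_closed[OF compact_Times[OF Min_setD(1)[OF L] Min_setD(1)[OF L]]] by metis
  have xyQ: "(x, y) \<in> Q" using xy by (simp add: Q_def)
  have cont: "continuous_on (OmB \<phi> \<times> Q) (\<lambda>p. cmod (apply_bcontfun (fst p) (fst (snd p)) - apply_bcontfun (fst p) (snd (snd p))))"
  proof -
    have "continuous_on T fst" "continuous_on T (\<lambda>p. fst (snd p))" "continuous_on T (\<lambda>p. snd (snd p))"
      for T :: "((rsphere \<Rightarrow>\<^sub>C complex) \<times> rsphere \<times> rsphere) set"
      by (intro continuous_intros)+
    from continuous_Mn_eval_compose[OF \<phi> this(1,2), where n = 0]
      continuous_Mn_eval_compose[OF \<phi> this(1,3), where n = 0]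
    show ?thesis by (auto intro!: continuous_intros)
  qed
  obtain q where q: "q \<in> OmB \<phi> \<times> Q" "\<And>p. p \<in> OmB \<phi> \<times> Q \<Longrightarrow>
      cmod (apply_bcontfun (fst p) (fst (snd p)) - apply_bcontfun (fst p) (snd (snd p)))
      \<le> cmod (apply_bcontfun (fst q) (fst (snd q)) - apply_bcontfun (fst q) (snd (snd q)))"
    using continuous_attains_sup[OF compact_Times[OF compact_OmB[OF \<phi>] cQ] _ cont] OmB_ne[OF \<phi>] xyQ by blast
  obtain b x0 y0 where bq: "q = (b, x0, y0)" by (metis prod.collapse)
  define \<kappa> where "\<kappa> = apply_bcontfun b x0 - apply_bcontfun b y0"
  have b: "apply_bcontfun b \<in> Om \<phi>" and x0: "x0 \<in> L" "y0 \<in> L" "sim x0 y0"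
    using q(1) by (auto simp: bq OmB_def[OF \<phi>] Q_def)
  have max: "cmod (\<psi>' u - \<psi>' v) \<le> cmod \<kappa>" if o: "\<psi>' \<in> Om \<phi>" and uv: "u \<in> L" "v \<in> L" "sim u v" for \<psi>' u v
  proof -
    obtain b' where "b' \<in> OmB \<phi>" "apply_bcontfun b' = \<psi>'" by (rule Om_obtain_B[OF \<phi> o])
    thus ?thesis using q(2)[of "(b', u, v)"] uv by (simp add: bq \<kappa>_def Q_def)
  qed
  have I: "invK L" "invK UNIV" using Min_set_invK[OF L] by (auto simp: invK_def)
  have wL: "w z \<in> L" if "w \<in> words n" "z \<in> L" for w n z by (rule words_inv[OF that Min_setD(4)[OF L]])
  have "\<exists>\<psi>'\<in>Om \<phi>. \<forall>g\<in>words k. \<forall>h\<in>words k. \<psi>' (g x0) - \<psi>' (h y0) = \<kappa>" for k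
  proof (induction k)
    case 0
    show ?case using b by (auto simp: \<kappa>_def)
  next
    case (Suc k)
    then obtain \<psi>1 where \<psi>1: "\<psi>1 \<in> Om \<phi>" "\<forall>g\<in>words k. \<forall>h\<in>words k. \<psi>1 (g x0) - \<psi>1 (h y0) = \<kappa>" by blast
    obtain \<psi>2 where \<psi>2: "\<psi>2 \<in> Om \<phi>" "Mop \<tau> \<psi>2 = \<psi>1" by (rule Om_preimage[OF \<phi> \<psi>1(1)])
    have c2: "continuous_on UNIV \<psi>2" by (rule Om_cont'[OF \<psi>2(1)])
    note bm2 = continuous_bm[OF c2]
    have step: "\<psi>2 (\<gamma> (g x0)) - \<psi>2 (\<gamma>' (h y0)) = \<kappa>"
      if g: "g \<in> words k" "h \<in> words k" and \<gamma>: "\<gamma> \<in> supp \<tau>" "\<gamma>' \<in> supp \<tau>" for g h \<gamma> \<gamma>'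
    proof -
      define u v where "u = g x0" and "v = h y0"
      have uv: "u \<in> L" "v \<in> L" "sim u v"
        unfolding u_def v_def using wL g x0 sim_words[OF L LF x0 g] by auto
      have le: "cmod (\<psi>2 (\<gamma> u) - \<psi>2 (\<gamma>' v)) \<le> cmod \<kappa>" if "\<gamma> \<in> supp \<tau>" "\<gamma>' \<in> supp \<tau>" for \<gamma> \<gamma>'
        using that by (intro max \<psi>2 wL[OF words_1 uv(1)] wL[OF words_1 uv(2)]
            sim_words[OF L LF uv words_1 words_1])
      have k1: "\<psi>1 u - \<psi>1 v = \<kappa>" using \<psi>1(2) g by (simp add: u_def v_def)
      \<comment> \<open>Extremality is used once for each average: first with centre
        \<open>\<psi>1 v\<close> while the image of \<open>u\<close> varies, then with the value at
        that image as centre while the image of \<open>v\<close> varies.\<close>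
      have le2: "cmod (\<psi>2 (\<gamma> u) - \<psi>1 v) \<le> cmod \<kappa>" if "\<gamma> \<in> supp \<tau>" for \<gamma>
      proof -
        have "\<psi>1 v - \<psi>2 (\<gamma> u) = (\<integral>g. \<psi>2 (g v) - \<psi>2 (\<gamma> u) \<partial>\<tau>)"
          unfolding \<psi>2(2)[symmetric] Mop_def using bm_integrable[OF bm2] by (simp add: prob_space)
        also have "cmod \<dots> \<le> cmod \<kappa>"
        proof (rule norm_integral_le)
          show "integrable \<tau> (\<lambda>g. \<psi>2 (g v) - \<psi>2 (\<gamma> u))" using bm_integrable[OF bm2] by simp
        qed (use le[OF that] in \<open>simp add: norm_minus_commute\<close>)
        finally show ?thesis by (simp add: norm_minus_commute)
      qed
      have "\<psi>2 (\<gamma> u) = Mop \<tau> \<psi>2 u"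
        by (rule Mop_extremal[OF I(2) c2 bm2 UNIV_I _ _ \<gamma>(1), where c = "\<psi>1 v" and A = "cmod \<kappa>"])
          (use le2 k1 \<psi>2 in auto)
      hence 1: "\<psi>2 (\<gamma> u) - \<psi>1 v = \<kappa>" using k1 \<psi>2(2) by simp
      have "\<psi>2 (\<gamma>' v) = Mop \<tau> \<psi>2 v"
        by (rule Mop_extremal[OF I(2) c2 bm2 UNIV_I _ _ \<gamma>(2), where c = "\<psi>2 (\<gamma> u)" and A = "cmod \<kappa>"])
          (use le[OF \<gamma>(1)] 1 \<psi>2 in \<open>auto simp: norm_minus_commute\<close>)
      thus ?thesis using 1 \<psi>2(2) by (simp add: u_def v_def)
    qed
    have "\<psi>2 (g' x0) - \<psi>2 (h' y0) = \<kappa>" if "g' \<in> words (Suc k)" "h' \<in> words (Suc k)" for g' h'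
    proof -
      have w1: "\<gamma> \<in> supp \<tau>" if "\<gamma> \<in> words 1" for \<gamma>
        using that words_SucE[of \<gamma> 0] by (metis One_nat_def id_o singletonD words.simps(1))
      obtain \<gamma> g where 1: "\<gamma> \<in> words 1" "g \<in> words k" "g' = \<gamma> \<circ> g"
        using words_split[of g' 1 k] \<open>g' \<in> words (Suc k)\<close> by auto
      obtain \<gamma>' h where 2: "\<gamma>' \<in> words 1" "h \<in> words k" "h' = \<gamma>' \<circ> h"
        using words_split[of h' 1 k] \<open>h' \<in> words (Suc k)\<close> by auto
      show ?thesis using step[OF 1(2) 2(2) w1[OF 1(1)] w1[OF 2(1)]] by (simp add: 1 2)
    qed
    thus ?case using \<psi>2(1) by blast
  qed
  note coupled = this
  have "\<kappa> = 0"
  proof (rule ccontr)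
    assume "\<kappa> \<noteq> 0"
    hence "cmod \<kappa> > 0" by simp
    then obtain d where d: "d > 0" "\<And>\<psi> u v. hl \<alpha> (C * A) \<psi> \<Longrightarrow> dist u v < d \<Longrightarrow> dist (\<psi> u) (\<psi> v) < cmod \<kappa>"
      using hl_modulus[OF \<alpha>(1)] by metis
    obtain k g h where g: "g \<in> words k" "h \<in> words k" "ds (g x0) (h y0) < d" using simD[OF x0(3) d(1)] .
    obtain \<psi>' where \<psi>': "\<psi>' \<in> Om \<phi>" "\<forall>g\<in>words k. \<forall>h\<in>words k. \<psi>' (g x0) - \<psi>' (h y0) = \<kappa>"
      using coupled by blast
    have "dist (\<psi>' (g x0)) (\<psi>' (h y0)) < cmod \<kappa>"
      using g dist_le_ds[of "g x0" "h y0"] by (intro d(2) Om_bounds'(1)[OF \<psi>'(1)]) simp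
    thus False using \<psi>'(2) g by (simp add: dist_norm)
  qed
  thus ?thesis using max[OF \<psi> xy] by simp
qed

lemma limit_periodic_on_Min_set:
  assumes L: "L \<in> Min_sets G" and \<psi>: "\<psi> \<in> Om \<phi>" and z: "z \<in> L"
  shows "Mn rr \<psi> z = \<psi> z"
proof -
  note LF = Min_set_F[OF L]
  obtain \<gamma> where \<gamma>: "\<gamma> \<in> supp \<tau>" using supp_ne by blast
  have w: "\<gamma> ^^ n \<in> words n" for n by (rule funpow_words[OF \<gamma>])
  have wL: "u z \<in> L" if "u \<in> words n" "z \<in> L" for u n z
    by (rule words_inv[OF that Min_setD(4)[OF L]])
  have M: "Mn k \<psi> z = \<psi> ((\<gamma> ^^ k) z)" if "z \<in> L" for k z
    using that
  proof (induction k arbitrary: z)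
    case (Suc k)
    have cl: "Mn k \<psi> u = Mn k \<psi> v" if "u \<in> L" "v \<in> L" "sim u v" for u v
      unfolding Suc.IH[OF that(1)] Suc.IH[OF that(2)]
      by (rule limit_class_function[OF L \<psi> wL[OF w that(1)] wL[OF w that(2)] sim_words[OF L LF that w w]])
    have "Mn (Suc k) \<psi> z = Mn k \<psi> (\<gamma> z)"
      using Mop_class_function[OF L Mn_bm[OF Om_cont'[OF \<psi>]] cl \<gamma> Suc.prems] by simp
    also have "\<dots> = \<psi> ((\<gamma> ^^ k) (\<gamma> z))" by (rule Suc.IH[OF wL[OF words_1[OF \<gamma>] Suc.prems]])
    finally show ?case by (simp add: funpow_swap1)
  qed simp
  obtain d where d: "cdim (LS (Ufun \<tau> L)) = d" "\<And>z. z \<in> L \<Longrightarrow> sim ((\<gamma> ^^ d) z) z"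
    by (rule Min_set_period[OF L]) (use \<gamma> in blast)
  obtain q where q: "rr = d * q" using dvd_rr[OF L] d(1) by (auto simp: dvd_def)
  have "sim ((\<gamma> ^^ (d * q)) z) z"
  proof (induction q)
    case (Suc q)
    have "(\<gamma> ^^ (d * Suc q)) z = (\<gamma> ^^ d) ((\<gamma> ^^ (d * q)) z)"
      by (simp only: mult_Suc_right funpow_add comp_apply)
    thus ?case using sim_trans[OF L LF wL[OF w z] d(2)[OF wL[OF w z]] Suc.IH] by simp
  qed simp
  hence "\<psi> ((\<gamma> ^^ rr) z) = \<psi> z" unfolding q by (rule limit_class_function[OF L \<psi> wL[OF w z] z])
  thus ?thesis using M[OF z] by simp
qed

text \<open>The defect of \<open>rr\<close>-periodicity is maximised over all limit functions and
  points. The points at which some limit function attains the maximum form a compact forward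
  invariant set, hence contain a minimal set, and on minimal sets the defect is 0.\<close>

lemma limit_periodic:
  assumes \<psi>: "\<psi> \<in> Om \<phi>"
  shows "Mn rr \<psi> = \<psi>"
proof -
  define f where "f = (\<lambda>p. cmod (Mn rr (apply_bcontfun (fst p)) (snd p) - apply_bcontfun (fst p) (snd p)))"
  have cf: "continuous_on (OmB \<phi> \<times> UNIV) f" unfolding f_def
  proof -
    have "continuous_on T fst" "continuous_on T snd" for T :: "((rsphere \<Rightarrow>\<^sub>C complex) \<times> rsphere) set"
      by (intro continuous_intros)+
    from continuous_Mn_eval_compose[OF \<phi> this, where n = rr]
      continuous_Mn_eval_compose[OF \<phi> this, where n = 0]
    show "continuous_on (OmB \<phi> \<times> UNIV) (\<lambda>p. cmod (Mn rr (apply_bcontfun (fst p)) (snd p) - apply_bcontfun (fst p) (snd p)))"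
      by (auto intro!: continuous_intros)
  qed
  have cB: "compact (OmB \<phi> \<times> (UNIV :: rsphere set))"
    by (rule compact_Times[OF compact_OmB[OF \<phi>] compact_UNIV_rsphere])
  obtain q where q: "q \<in> OmB \<phi> \<times> UNIV" "\<And>p. p \<in> OmB \<phi> \<times> UNIV \<Longrightarrow> f p \<le> f q"
    using continuous_attains_sup[OF cB _ cf] OmB_ne[OF \<phi>] by blast
  define c where "c = f q"
  have max: "cmod (Mn rr \<psi>' z - \<psi>' z) \<le> c" if o: "\<psi>' \<in> Om \<phi>" for \<psi>' z
  proof -
    obtain b' where "b' \<in> OmB \<phi>" "apply_bcontfun b' = \<psi>'" by (rule Om_obtain_B[OF \<phi> o])
    thus ?thesis using q(2)[of "(b', z)"] by (simp add: c_def f_def)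
  qed
  define E where "E = {z. \<exists>\<psi>'\<in>Om \<phi>. cmod (Mn rr \<psi>' z - \<psi>' z) = c}"
  \<comment> \<open>The quantifier over limit functions becomes a projection from a product of
    compact spaces, which shows that \<open>E\<close> is compact.\<close>
  have Eimg: "E = snd ` ((OmB \<phi> \<times> UNIV) \<inter> f -` {c})"
  proof (intro equalityI subsetI)
    fix z assume "z \<in> E"
    then obtain \<psi>' where \<psi>': "\<psi>' \<in> Om \<phi>" "cmod (Mn rr \<psi>' z - \<psi>' z) = c" by (auto simp: E_def)
    obtain b' where "b' \<in> OmB \<phi>" "apply_bcontfun b' = \<psi>'" by (rule Om_obtain_B[OF \<phi> \<psi>'(1)])
    thus "z \<in> snd ` ((OmB \<phi> \<times> UNIV) \<inter> f -` {c})" using \<psi>' by (intro image_eqI[of _ _ "(b', z)"]) (auto simp: f_def)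
  next
    fix z assume "z \<in> snd ` ((OmB \<phi> \<times> UNIV) \<inter> f -` {c})"
    then obtain b' where "b' \<in> OmB \<phi>" "f (b', z) = c" by auto
    thus "z \<in> E" by (auto simp: E_def f_def OmB_def[OF \<phi>])
  qed
  have "compact ((OmB \<phi> \<times> UNIV) \<inter> f -` {c})"
  proof -
    have "closed (OmB \<phi> \<times> (UNIV :: rsphere set))" by (rule compact_imp_closed[OF cB])
    hence "closed ((OmB \<phi> \<times> UNIV) \<inter> f -` {c})"
      using continuous_closed_preimage[OF cf] by (metis closed_singleton)
    thus ?thesis using compact_Int_closed[OF cB] by (metis inf.left_idem)
  qed
  hence cE: "compact E" unfolding Eimg by (rule compact_continuous_image[OF continuous_on_snd[OF continuous_on_id]])
  have "E \<noteq> {}" unfolding Eimg using q(1) by (auto simp: c_def)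
  moreover have "g ` E \<subseteq> E" if g: "g \<in> supp \<tau>" for g
  proof
    fix y assume "y \<in> g ` E"
    then obtain z \<psi>1 where z: "y = g z" "\<psi>1 \<in> Om \<phi>" "cmod (Mn rr \<psi>1 z - \<psi>1 z) = c" by (auto simp: E_def)
    obtain \<psi>2 where \<psi>2: "\<psi>2 \<in> Om \<phi>" "Mop \<tau> \<psi>2 = \<psi>1" by (rule Om_preimage[OF \<phi> z(2)])
    define \<xi> where "\<xi> = (\<lambda>z. Mn rr \<psi>2 z - \<psi>2 z)"
    note c2 = Om_cont'[OF \<psi>2(1), of UNIV]
    have c\<xi>: "continuous_on UNIV \<xi>" unfolding \<xi>_def by (intro continuous_intros Mn_continuous c2)
    have "Mop \<tau> (Mn rr \<psi>2) = Mn rr \<psi>1" unfolding \<psi>2(2)[symmetric] by (simp add: funpow_swap1)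
    hence M\<xi>: "Mop \<tau> \<xi> z = Mn rr \<psi>1 z - \<psi>1 z"
      unfolding \<xi>_def using Mop_diff[OF Mn_bm[OF c2] continuous_bm[OF c2]] \<psi>2(2) by simp
    have "\<xi> (g z) = Mop \<tau> \<xi> z"
      by (rule Mop_extremal[OF _ c\<xi> continuous_bm[OF c\<xi>] UNIV_I _ _ g, where c = 0 and A = c])
        (use max[OF \<psi>2(1)] M\<xi> z in \<open>auto simp: invK_def \<xi>_def\<close>)
    hence "cmod (\<xi> (g z)) = c" using M\<xi> z by simp
    thus "y \<in> E" unfolding E_def z(1) using \<psi>2(1) by (auto simp: \<xi>_def)
  qed
  ultimately have "fwd_inv G E" unfolding fwd_inv_def using cE supp_inv_imp_G by blast
  then obtain L where L: "L \<in> Min_sets G" "L \<subseteq> E" by (rule Min_sets_exist)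
  obtain z where z: "z \<in> L" using Min_setD(3)[OF L(1)] by blast
  then obtain \<psi>' where "\<psi>' \<in> Om \<phi>" "cmod (Mn rr \<psi>' z - \<psi>' z) = c" using L(2) by (auto simp: E_def)
  hence "c = 0" using limit_periodic_on_Min_set[OF L(1) _ z] by simp
  hence "Mn rr \<psi> z = \<psi> z" for z using max[OF \<psi>, of z] by simp
  thus ?thesis by (rule ext)
qed

end

section \<open>The projection and the decaying functions\<close>

lemma Mn_periodic: "Mn rr \<psi> = \<psi> \<Longrightarrow> Mn (k * rr) \<psi> = \<psi>"
  by (induction k) (simp_all only: mult_Suc funpow_add comp_apply mult_0 funpow_0)

lemma sup_norm_upper:
  assumes "continuous_on UNIV f"
  shows "cmod (f z) \<le> sup_norm f"
proof -
  obtain B where "\<forall>z. cmod (f z) \<le> B" using continuous_bm[OF assms] by (auto simp: bm_def)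
  thus ?thesis unfolding sup_norm_def by (intro cSUP_upper bdd_aboveI2[of _ _ B]) auto
qed

lemma sup_norm_least: "(\<And>z. cmod (f z) \<le> c) \<Longrightarrow> sup_norm f \<le> c"
  unfolding sup_norm_def by (intro cSUP_least) auto

lemma decayingD:
  assumes "\<phi> \<in> decaying \<tau>" "\<epsilon> > 0"
  shows "\<exists>N. \<forall>n\<ge>N. \<forall>z. cmod (Mn n \<phi> z) < \<epsilon>"
proof -
  have c: "continuous_on UNIV \<phi>" and l: "(\<lambda>n. sup_norm (Mn n \<phi>)) \<longlonglongrightarrow> 0"
    using assms(1) by (auto simp: decaying_def)
  obtain N where N: "\<forall>n\<ge>N. \<bar>sup_norm (Mn n \<phi>)\<bar> < \<epsilon>" using LIMSEQ_D[OF l assms(2)] by auto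
  have "cmod (Mn n \<phi> z) < \<epsilon>" if "n \<ge> N" for n z
    using N that sup_norm_upper[OF Mn_continuous[OF c, of n], of z] by (meson abs_ge_self le_less_trans order_trans)
  thus ?thesis by blast
qed

text \<open>One small iterate suffices because the operator does not increase the supremum
  norm.\<close>

lemma decayingI:
  assumes c: "continuous_on UNIV \<phi>" and n: "\<And>\<epsilon>. \<epsilon> > 0 \<Longrightarrow> \<exists>n. \<forall>z. cmod (Mn n \<phi> z) \<le> \<epsilon>"
  shows "\<phi> \<in> decaying \<tau>"
  unfolding decaying_def
proof (intro CollectI conjI c LIMSEQ_I)
  fix \<epsilon> :: real assume e: "\<epsilon> > 0"
  obtain N where N: "\<forall>z. cmod (Mn N \<phi> z) \<le> \<epsilon>/2" using n[of "\<epsilon>/2"] e by auto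
  have "norm (sup_norm (Mn k \<phi>) - 0) < \<epsilon>" if "k \<ge> N" for k
  proof -
    have "Mn k \<phi> = Mn (k - N) (Mn N \<phi>)" using that by (metis comp_apply funpow_add le_add_diff_inverse2)
    hence "cmod (Mn k \<phi> z) \<le> \<epsilon>/2" for z using Mn_bound[OF Mn_continuous[OF c]] N by metis
    hence "sup_norm (Mn k \<phi>) \<le> \<epsilon>/2" by (rule sup_norm_least)
    moreover have "sup_norm (Mn k \<phi>) \<ge> 0"
      using sup_norm_upper[OF Mn_continuous[OF c, of k], of undefined] norm_ge_zero order_trans by blast
    ultimately show ?thesis using e by simp
  qed
  thus "\<exists>N. \<forall>k\<ge>N. norm (sup_norm (Mn k \<phi>) - 0) < \<epsilon>" by blast
qed

text \<open>A limit function along multiples of \<open>rr\<close> is fixed by the corresponding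
  iterates, so the remainder has arbitrarily small iterates and decays. Two candidates for the
  projection are both \<open>rr\<close>-periodic and differ by a decaying function, hence agree;
  this gives \<open>THE\<close> its meaning.\<close>

lemma proj_properties:
  assumes \<phi>: "hl \<alpha> A \<phi>" "\<And>x. cmod (\<phi> x) \<le> A"
  shows "hl \<alpha> (C * A) (proj \<tau> \<phi>)" "\<And>x. cmod (proj \<tau> \<phi> x) \<le> A" "Mn rr (proj \<tau> \<phi>) = proj \<tau> \<phi>"
    "(\<lambda>z. \<phi> z - proj \<tau> \<phi> z) \<in> decaying \<tau>"
proof -
  have c\<phi>: "continuous_on UNIV \<phi>" by (rule hl_continuous[OF \<phi>(1) \<alpha>(1)])
  obtain \<psi> where \<psi>: "\<psi> \<in> Om \<phi>" "\<And>\<epsilon>. \<epsilon> > 0 \<Longrightarrow> \<exists>k. \<forall>x. cmod (Mn (k * rr) \<phi> x - \<psi> x) < \<epsilon>"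
    using Om_multiple[OF \<phi> rr_pos] by blast
  have c\<psi>: "continuous_on UNIV \<psi>" by (rule Om_cont[OF \<phi> \<psi>(1)])
  have per: "Mn rr \<psi> = \<psi>" by (rule limit_periodic[OF \<phi> \<psi>(1)])
  have LS: "\<psi> \<in> LS (Ufun \<tau> UNIV)"
    by (rule periodic_in_LS[OF _ _ rr_pos]) (use c\<psi> per in \<open>auto simp: invK_def CK_def NK_UNIV\<close>)
  have dec: "(\<lambda>z. \<phi> z - \<psi> z) \<in> decaying \<tau>"
  proof (rule decayingI)
    show "continuous_on UNIV (\<lambda>z. \<phi> z - \<psi> z)" by (intro continuous_intros c\<phi> c\<psi>)
    fix \<epsilon> :: real assume "\<epsilon> > 0"
    then obtain k where "\<forall>x. cmod (Mn (k * rr) \<phi> x - \<psi> x) < \<epsilon>" using \<psi>(2) by blast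
    thus "\<exists>n. \<forall>z. cmod (Mn n (\<lambda>z. \<phi> z - \<psi> z) z) \<le> \<epsilon>"
      by (intro exI[of _ "k * rr"]) (simp add: Mn_diff[OF c\<phi> c\<psi>] Mn_periodic[OF per] less_imp_le)
  qed
  have "proj \<tau> \<phi> = \<psi>"
    unfolding proj_def
  proof (rule the_equality)
    show "\<psi> \<in> LS (Ufun \<tau> UNIV) \<and> (\<lambda>z. \<phi> z - \<psi> z) \<in> decaying \<tau>" using LS dec by blast
    fix \<psi>' assume \<psi>': "\<psi>' \<in> LS (Ufun \<tau> UNIV) \<and> (\<lambda>z. \<phi> z - \<psi>' z) \<in> decaying \<tau>"
    have c': "continuous_on UNIV \<psi>'" and per': "Mn rr \<psi>' = \<psi>'" using LS_Ufun_UNIV \<psi>' by blast+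
    have "cmod (\<psi>' z - \<psi> z) \<le> 0" for z
    proof (rule field_le_epsilon)
      fix \<epsilon> :: real assume e: "\<epsilon> > 0"
      obtain N1 where N1: "\<forall>n\<ge>N1. \<forall>z. cmod (Mn n (\<lambda>z. \<phi> z - \<psi> z) z) < \<epsilon>/2"
        using decayingD[OF dec, of "\<epsilon>/2"] e by auto
      obtain N2 where N2: "\<forall>n\<ge>N2. \<forall>z. cmod (Mn n (\<lambda>z. \<phi> z - \<psi>' z) z) < \<epsilon>/2"
        using decayingD[of "\<lambda>z. \<phi> z - \<psi>' z" "\<epsilon>/2"] \<psi>' e by auto
      \<comment> \<open>A multiple of \<open>rr\<close> beyond both thresholds, where both
        candidates are reproduced.\<close>
      define n where "n = max N1 N2 * rr"
      have n: "n \<ge> N1" "n \<ge> N2" using rr_pos by (auto simp: n_def intro: le_trans[OF _ mult_le_mono2[of 1 rr]])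
      have "cmod (Mn n \<phi> z - \<psi> z) < \<epsilon>/2" "cmod (Mn n \<phi> z - \<psi>' z) < \<epsilon>/2"
        using N1 N2 n by (auto simp: Mn_diff[OF c\<phi> c\<psi>] Mn_diff[OF c\<phi> c'] Mn_periodic[OF per, of "max N1 N2", folded n_def]
            Mn_periodic[OF per', of "max N1 N2", folded n_def])
      hence "dist (Mn n \<phi> z) (\<psi> z) < \<epsilon>/2" "dist (Mn n \<phi> z) (\<psi>' z) < \<epsilon>/2" by (auto simp: dist_norm)
      thus "cmod (\<psi>' z - \<psi> z) \<le> 0 + \<epsilon>"
        using dist_triangle3[of "\<psi>' z" "\<psi> z" "Mn n \<phi> z"] by (simp add: dist_norm)
    qed
    thus "\<psi>' = \<psi>" by (auto simp: fun_eq_iff)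
  qed
  thus "hl \<alpha> (C * A) (proj \<tau> \<phi>)" "\<And>x. cmod (proj \<tau> \<phi> x) \<le> A" "Mn rr (proj \<tau> \<phi>) = proj \<tau> \<phi>"
    "(\<lambda>z. \<phi> z - proj \<tau> \<phi> z) \<in> decaying \<tau>"
    using Om_bounds[OF \<phi> \<psi>(1)] per dec by auto
qed

end

section \<open>Exponential decay\<close>

context power_bounded
begin

lemma decaying_Mn: "\<phi> \<in> decaying \<tau> \<Longrightarrow> Mn k \<phi> \<in> decaying \<tau>"
proof (rule decayingI)
  assume \<phi>: "\<phi> \<in> decaying \<tau>"
  thus "continuous_on UNIV (Mn k \<phi>)" by (intro Mn_continuous) (simp add: decaying_def)
  fix \<epsilon> :: real assume "\<epsilon> > 0"
  then obtain N where "\<forall>n\<ge>N. \<forall>z. cmod (Mn n \<phi> z) < \<epsilon>" using decayingD[OF \<phi>] by blast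
  moreover have "Mn N (Mn k \<phi>) = Mn (N + k) \<phi>" by (simp only: funpow_add comp_apply)
  ultimately show "\<exists>n. \<forall>z. cmod (Mn n (Mn k \<phi>) z) \<le> \<epsilon>"
    by (intro exI[of _ N]) (simp add: less_imp_le)
qed

text \<open>The decaying functions of Hoelder norm at most 1 are precompact in the supremum norm, on which
  the transition operator is a contraction; hence the decay is uniform.\<close>

lemma uniform_decay:
  assumes e: "\<epsilon> > 0"
  obtains n where "\<And>\<phi> x. hl \<alpha> 1 \<phi> \<Longrightarrow> (\<And>x. cmod (\<phi> x) \<le> 1) \<Longrightarrow> \<phi> \<in> decaying \<tau> \<Longrightarrow> cmod (Mn n \<phi> x) \<le> \<epsilon>"
proof (rule ccontr)
  assume "\<not> thesis"
  hence "\<forall>n. \<exists>\<phi>. hl \<alpha> 1 \<phi> \<and> (\<forall>x. cmod (\<phi> x) \<le> 1) \<and> \<phi> \<in> decaying \<tau> \<and> (\<exists>x. cmod (Mn n \<phi> x) > \<epsilon>)"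
    using that by (meson not_le)
  then obtain f where f: "\<And>n. hl \<alpha> 1 (f n)" "\<And>n x. cmod (f n x) \<le> 1" "\<And>n. f n \<in> decaying \<tau>"
    "\<And>n. \<exists>x. cmod (Mn n (f n) x) > \<epsilon>" by metis
  have cf: "continuous_on UNIV (f n)" for n by (rule hl_continuous[OF f(1) \<alpha>(1)])
  obtain r \<psi> where r: "strict_mono (r :: nat \<Rightarrow> nat)"
    "\<And>e. e > 0 \<Longrightarrow> \<exists>N. \<forall>n\<ge>N. \<forall>x. cmod (f (r n) x - \<psi> x) < e"
    using Arzela_Ascoli_hl[of \<alpha> 1 f 1, OF \<alpha>(1) f(1,2)] by metis
  obtain N where N: "\<forall>n\<ge>N. \<forall>x. cmod (f (r n) x - \<psi> x) < \<epsilon>/4" using r(2)[of "\<epsilon>/4"] e by auto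
  obtain M where M: "\<forall>n\<ge>M. \<forall>z. cmod (Mn n (f (r N)) z) < \<epsilon>/2"
    using decayingD[OF f(3), of "\<epsilon>/2"] e by auto
  \<comment> \<open>\<open>f (r N)\<close> is one fixed decaying function, and the later
    \<open>f (r i)\<close> stay within \<epsilon>/2 of it; a time \<open>M\<close> at which it is
    small therefore serves them too.\<close>
  define i where "i = max N M"
  have "cmod (f (r i) z - f (r N) z) \<le> \<epsilon>/2" for z
  proof -
    have "dist (f (r i) z) (\<psi> z) < \<epsilon>/4" "dist (f (r N) z) (\<psi> z) < \<epsilon>/4"
      using N by (auto simp: dist_norm i_def)
    thus ?thesis using dist_triangle2[of "f (r i) z" "f (r N) z" "\<psi> z"] by (simp add: dist_norm)
  qed
  hence "cmod (Mn M (f (r i)) z - Mn M (f (r N)) z) \<le> \<epsilon>/2" for z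
    by (rule Mn_dist[OF cf cf])
  moreover have "cmod (Mn M (f (r N)) z) < \<epsilon>/2" for z using M by blast
  ultimately have le: "cmod (Mn M (f (r i)) z) \<le> \<epsilon>" for z
    using norm_triangle_sub[of "Mn M (f (r i)) z" "Mn M (f (r N)) z"] by (smt (verit) field_sum_of_halves)
  have "r i \<ge> M" using seq_suble[OF r(1), of i] by (simp add: i_def)
  hence "Mn (r i) (f (r i)) = Mn (r i - M) (Mn M (f (r i)))"
    by (metis comp_apply funpow_add le_add_diff_inverse2)
  hence "cmod (Mn (r i) (f (r i)) z) \<le> \<epsilon>" for z using Mn_bound[OF Mn_continuous[OF cf] le] by simp
  thus False using f(4)[of "r i"] by (meson not_le)
qed

context
  fixes D :: real
  assumes D: "D \<ge> 0" "\<And>\<eta>. \<eta> > 0 \<Longrightarrow> \<exists>N. \<forall>\<phi> A s. hl \<alpha> A \<phi> \<longrightarrow> (\<forall>x. cmod (\<phi> x) \<le> A) \<longrightarrow>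
       (\<forall>x. cmod (\<phi> x) \<le> s) \<longrightarrow> hl \<alpha> (\<eta> * A + D * s) (Mn N \<phi>)"
begin

text \<open>Uniform decay makes the supremum norm small while the Hoelder constant stays below
  \<open>C\<close>; the Doeblin-Fortet inequality then makes the Hoelder constant small as
  well.\<close>

lemma halving:
  obtains m where "m > 0" "\<And>\<phi> A. hl \<alpha> A \<phi> \<Longrightarrow> (\<And>x. cmod (\<phi> x) \<le> A) \<Longrightarrow> \<phi> \<in> decaying \<tau> \<Longrightarrow>
     hl \<alpha> (A / 2) (Mn m \<phi>) \<and> (\<forall>x. cmod (Mn m \<phi> x) \<le> A / 2)"
proof -
  \<comment> \<open>With this choice both terms of the Doeblin-Fortet bound,
    \<open>1 / (4 * C) * C\<close> and \<open>D * \<epsilon>\<close>, are at most 1/4.\<close>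
  define \<epsilon> where "\<epsilon> = 1 / (4 * (D + 1))"
  have \<epsilon>: "\<epsilon> > 0" "\<epsilon> \<le> 1/4" "D * \<epsilon> \<le> 1/4" using D(1) by (auto simp: \<epsilon>_def field_simps)
  obtain n where n: "\<And>\<phi> x. hl \<alpha> 1 \<phi> \<Longrightarrow> (\<And>x. cmod (\<phi> x) \<le> 1) \<Longrightarrow> \<phi> \<in> decaying \<tau> \<Longrightarrow> cmod (Mn n \<phi> x) \<le> \<epsilon>"
    using uniform_decay[OF \<epsilon>(1)] by metis
  have C0: "1 / (4 * C) > 0" using C by simp
  obtain N where N: "\<And>\<phi> A s. hl \<alpha> A \<phi> \<Longrightarrow> (\<And>x. cmod (\<phi> x) \<le> A) \<Longrightarrow>
       (\<And>x. cmod (\<phi> x) \<le> s) \<Longrightarrow> hl \<alpha> (1 / (4 * C) * A + D * s) (Mn N \<phi>)"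
    using D(2)[OF C0] by metis
  have unit: "hl \<alpha> (1/2) (Mn (N + Suc n) \<phi>) \<and> (\<forall>x. cmod (Mn (N + Suc n) \<phi> x) \<le> 1/2)"
    if \<phi>: "hl \<alpha> 1 \<phi>" "\<And>x. cmod (\<phi> x) \<le> 1" "\<phi> \<in> decaying \<tau>" for \<phi>
  proof -
    have c: "continuous_on UNIV \<phi>" by (rule hl_continuous[OF \<phi>(1) \<alpha>(1)])
    \<comment> \<open>\<open>Suc n\<close> keeps the block length positive, so that a root of that
      order can be taken.\<close>
    define \<psi> where "\<psi> = Mn (Suc n) \<phi>"
    have c\<psi>: "continuous_on UNIV \<psi>" unfolding \<psi>_def by (rule Mn_continuous[OF c])
    have 1: "hl \<alpha> C \<psi>" unfolding \<psi>_def using power_bounded[OF \<phi>(1,2), of "Suc n"] by simp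
    have 2: "cmod (\<psi> x) \<le> \<epsilon>" for x
    proof -
      show ?thesis using Mn_bound[OF Mn_continuous[OF c] n[OF \<phi>], of 1 x] by (simp add: \<psi>_def)
    qed
    have "hl \<alpha> (1 / (4 * C) * C + D * \<epsilon>) (Mn N \<psi>)"
    proof (rule N[OF 1 _ 2])
      show "cmod (\<psi> x) \<le> C" for x using 2[of x] \<epsilon>(2) C by linarith
    qed
    hence "hl \<alpha> (1/2) (Mn N \<psi>)" by (rule hl_weaken) (use C \<epsilon> in simp)
    moreover have "cmod (Mn N \<psi> x) \<le> 1/2" for x
      using Mn_bound[OF c\<psi> 2, of N x] \<epsilon>(2) by linarith
    moreover have "Mn N \<psi> = Mn (N + Suc n) \<phi>" unfolding \<psi>_def by (simp only: funpow_add comp_apply)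
    ultimately show ?thesis by simp
  qed
  show ?thesis
  proof (rule that[of "N + Suc n"])
    fix \<phi> A assume \<phi>: "hl \<alpha> A \<phi>" "\<And>x. cmod (\<phi> x) \<le> A" "\<phi> \<in> decaying \<tau>"
    have A0: "A \<ge> 0" using \<phi>(2)[of undefined] norm_ge_zero order_trans by blast
    have c: "continuous_on UNIV \<phi>" by (rule hl_continuous[OF \<phi>(1) \<alpha>(1)])
    show "hl \<alpha> (A / 2) (Mn (N + Suc n) \<phi>) \<and> (\<forall>x. cmod (Mn (N + Suc n) \<phi> x) \<le> A / 2)"
    proof (cases "A = 0")
      case True
      hence "Mn (N + Suc n) \<phi> x = 0" for x using Mn_bound[OF c \<phi>(2), of "N + Suc n" x] by simp
      thus ?thesis using True by (simp only: hl_def) simp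
    next
      case False
      hence A: "A > 0" using A0 by simp
      define \<psi> where "\<psi> = (\<lambda>z. of_real (1 / A) * \<phi> z)"
      have diff: "cmod (\<psi> x - \<psi> y) = cmod (\<phi> x - \<phi> y) / A" for x y
        unfolding \<psi>_def right_diff_distrib[symmetric] using A by (simp add: norm_mult norm_divide)
      have 1: "hl \<alpha> 1 \<psi>" unfolding hl_def diff using \<phi>(1) A by (simp add: hl_def field_simps)
      have 2: "cmod (\<psi> x) \<le> 1" for x unfolding \<psi>_def using \<phi>(2)[of x] A by (simp add: norm_mult norm_divide)
      have M\<psi>: "Mn k \<psi> = (\<lambda>z. of_real (1 / A) * Mn k \<phi> z)" for k unfolding \<psi>_def by (rule Mn_scale)
      have 3: "\<psi> \<in> decaying \<tau>"
      proof (rule decayingI)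
        show "continuous_on UNIV \<psi>" by (rule hl_continuous[OF 1 \<alpha>(1)])
        fix \<epsilon> :: real assume "\<epsilon> > 0"
        hence "\<epsilon> * A > 0" using A by simp
        then obtain N where "\<forall>n\<ge>N. \<forall>z. cmod (Mn n \<phi> z) < \<epsilon> * A" using decayingD[OF \<phi>(3)] by blast
        thus "\<exists>n. \<forall>z. cmod (Mn n \<psi> z) \<le> \<epsilon>"
          using A by (intro exI[of _ N]) (simp add: M\<psi> norm_mult norm_divide field_simps less_imp_le)
      qed
      have M\<phi>: "Mn k \<phi> z = of_real A * Mn k \<psi> z" for k z using A by (simp add: M\<psi>)
      have u: "hl \<alpha> (1/2) (Mn (N + Suc n) \<psi>)" "\<forall>x. cmod (Mn (N + Suc n) \<psi> x) \<le> 1/2"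
        using unit[OF 1 2 3] by auto
      have "cmod (Mn (N + Suc n) \<phi> x - Mn (N + Suc n) \<phi> y) = A * cmod (Mn (N + Suc n) \<psi> x - Mn (N + Suc n) \<psi> y)" for x y
        unfolding M\<phi> right_diff_distrib[symmetric] using A by (simp add: norm_mult norm_divide)
      moreover have "A * cmod (Mn (N + Suc n) \<psi> x - Mn (N + Suc n) \<psi> y) \<le> A * (1/2 * dist x y powr \<alpha>)" for x y
        using u(1) A by (intro mult_left_mono) (auto simp: hl_def)
      ultimately have "hl \<alpha> (A/2) (Mn (N + Suc n) \<phi>)" by (simp add: hl_def)
      moreover have "cmod (Mn (N + Suc n) \<phi> x) \<le> A / 2" for x
      proof -
        have "cmod (Mn (N + Suc n) \<phi> x) = A * cmod (Mn (N + Suc n) \<psi> x)" unfolding M\<phi> using A by (simp add: norm_mult norm_divide)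
        also have "\<dots> \<le> A * (1/2)" using u(2) A by (intro mult_left_mono) auto
        finally show ?thesis by simp
      qed
      ultimately show ?thesis by blast
    qed
  qed simp
qed

text \<open>Halving in blocks of \<open>m\<close> steps gives the \<open>m\<close>-th root of 1/2 as
  rate. An incomplete last block costs the factor \<open>C\<close> of power boundedness, and 2
  because \<open>n\<close> is less than \<open>m * (k + 1)\<close>.\<close>

lemma exponential_decay:
  obtains lam where "0 < lam" "lam < 1"
    "\<And>\<phi> A n. hl \<alpha> A \<phi> \<Longrightarrow> (\<And>x. cmod (\<phi> x) \<le> A) \<Longrightarrow> \<phi> \<in> decaying \<tau> \<Longrightarrow>
       hl \<alpha> (2 * C * A * lam ^ n) (Mn n \<phi>) \<and> (\<forall>x. cmod (Mn n \<phi> x) \<le> 2 * C * A * lam ^ n)"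
proof -
  obtain m where m: "m > 0" "\<And>\<phi> A. hl \<alpha> A \<phi> \<Longrightarrow> (\<And>x. cmod (\<phi> x) \<le> A) \<Longrightarrow> \<phi> \<in> decaying \<tau> \<Longrightarrow>
     hl \<alpha> (A / 2) (Mn m \<phi>) \<and> (\<forall>x. cmod (Mn m \<phi> x) \<le> A / 2)"
    using halving by metis
  define lam :: real where "lam = root m (1/2)"
  have lam: "0 < lam" "lam < 1" "lam ^ m = 1/2"
    using m(1) by (auto simp: lam_def real_root_pow_pos2)
  show ?thesis
  proof (rule that[OF lam(1,2)])
    fix \<phi> A n assume \<phi>: "hl \<alpha> A \<phi>" "\<And>x. cmod (\<phi> x) \<le> A" "\<phi> \<in> decaying \<tau>"
    have A0: "A \<ge> 0" using \<phi>(2)[of undefined] norm_ge_zero order_trans by blast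
    have iter: "hl \<alpha> (A * (1/2) ^ k) (Mn (m * k) \<phi>) \<and> (\<forall>x. cmod (Mn (m * k) \<phi> x) \<le> A * (1/2) ^ k)" for k
    proof (induction k)
      case (Suc k)
      have "hl \<alpha> (A * (1/2) ^ k / 2) (Mn m (Mn (m * k) \<phi>)) \<and> (\<forall>x. cmod (Mn m (Mn (m * k) \<phi>) x) \<le> A * (1/2) ^ k / 2)"
        by (rule m(2)) (use Suc.IH decaying_Mn[OF \<phi>(3)] in auto)
      moreover have "Mn m (Mn (m * k) \<phi>) = Mn (m * Suc k) \<phi>" by (simp only: mult_Suc_right funpow_add comp_apply)
      ultimately show ?case by (simp add: field_simps)
    qed (use \<phi> in simp)
    define k i where "k = n div m" and "i = n mod m"
    have ni: "n = i + m * k" "i < m" using m(1) by (auto simp: k_def i_def)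
    define B where "B = A * (1/2) ^ k"
    have B0: "B \<ge> 0" using A0 by (simp add: B_def)
    have M: "Mn n \<phi> = Mn i (Mn (m * k) \<phi>)" unfolding ni(1) by (simp only: funpow_add comp_apply)
    have "hl \<alpha> (C * B) (Mn n \<phi>)" unfolding M
      by (rule power_bounded) (use iter[of k] in \<open>auto simp: B_def\<close>)
    moreover have "cmod (Mn n \<phi> x) \<le> B" for x unfolding M
      by (rule Mn_bound[OF Mn_continuous[OF hl_continuous[OF \<phi>(1) \<alpha>(1)]]]) (use iter[of k] in \<open>auto simp: B_def\<close>)
    moreover have le: "C * B \<le> 2 * C * A * lam ^ n"
    proof -
      have "(1/2) ^ k * (1/2) = lam ^ (m * k) * lam ^ m" by (simp add: power_mult lam(3))
      also have "\<dots> = lam ^ (m * k + m)" by (simp add: power_add)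
      also have "\<dots> \<le> lam ^ n" using lam ni by (intro power_decreasing) auto
      finally have "(1/2) ^ k \<le> 2 * lam ^ n" by simp
      hence "C * A * (1/2) ^ k \<le> C * A * (2 * lam ^ n)" using C A0 by (intro mult_left_mono) auto
      thus ?thesis by (simp add: B_def mult_ac)
    qed
    moreover have "B \<le> C * B" using C B0 mult_right_mono[of 1 C B] by simp
    ultimately show "hl \<alpha> (2 * C * A * lam ^ n) (Mn n \<phi>) \<and> (\<forall>x. cmod (Mn n \<phi> x) \<le> 2 * C * A * lam ^ n)"
      using hl_weaken order_trans by meson
  qed
qed

end

end

section \<open>The main theorem\<close>

lemma holder_norm_upper:
  assumes "hl \<alpha> A f" "\<And>x. cmod (f x) \<le> A"
  shows "holder_norm \<alpha> f \<le> ennreal (2 * A)"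
proof -
  have A0: "A \<ge> 0" using assms(2)[of undefined] norm_ge_zero order_trans by blast
  have "(SUP z. ennreal (cmod (f z))) \<le> ennreal A"
    by (intro SUP_least ennreal_leI assms(2))
  moreover have "(SUP xy\<in>{(x, y). x \<noteq> y}. ennreal (cmod (f (fst xy) - f (snd xy)) / dist (fst xy) (snd xy) powr \<alpha>)) \<le> ennreal A"
  proof (intro SUP_least ennreal_leI)
    fix xy :: "rsphere \<times> rsphere" assume "xy \<in> {(x, y). x \<noteq> y}"
    hence "dist (fst xy) (snd xy) powr \<alpha> > 0" by auto
    thus "cmod (f (fst xy) - f (snd xy)) / dist (fst xy) (snd xy) powr \<alpha> \<le> A"
      using assms(1) by (simp add: hl_def divide_le_eq)
  qed
  ultimately have "holder_norm \<alpha> f \<le> ennreal A + ennreal A" unfolding holder_norm_def by (rule add_mono)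
  also have "\<dots> = ennreal (2 * A)" using A0 by (simp flip: ennreal_plus)
  finally show ?thesis .
qed

text \<open>On \<open>holder\<close> the norm is finite, so it can itself serve as the real constant
  \<open>A\<close>, and the inequalities between extended reals reduce to real ones.\<close>

lemma holder_norm_lower:
  assumes f: "f \<in> holder \<alpha>" and \<alpha>: "\<alpha> > 0"
  obtains A where "A \<ge> 0" "hl \<alpha> A f" "\<And>x. cmod (f x) \<le> A" "holder_norm \<alpha> f = ennreal A"
proof -
  obtain K where K: "hl \<alpha> K f" using f by (auto simp: holder_def hl_def)
  have "continuous_on UNIV f" by (rule hl_continuous[OF K \<alpha>])
  hence "bounded (range f)" by (intro compact_imp_bounded compact_continuous_image compact_UNIV_rsphere)
  then obtain B where B: "\<And>x. cmod (f x) \<le> B" by (auto simp: bounded_iff)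
  have "holder_norm \<alpha> f \<le> ennreal (2 * max K B)"
    by (rule holder_norm_upper[OF hl_weaken[OF K]]) (use B in \<open>auto simp: le_max_iff_disj\<close>)
  hence fin: "holder_norm \<alpha> f < top" by (metis ennreal_less_top order_le_less_trans)
  define A where "A = enn2real (holder_norm \<alpha> f)"
  have A: "holder_norm \<alpha> f = ennreal A" using fin by (simp add: A_def)
  have A0: "A \<ge> 0" by (simp add: A_def)
  have "ennreal (cmod (f x)) \<le> ennreal A" for x
    unfolding A[symmetric] holder_norm_def by (rule add_increasing2) (auto intro: SUP_upper)
  hence 1: "cmod (f x) \<le> A" for x using A0 by (simp add: ennreal_le_iff)
  have "cmod (f x - f y) \<le> A * dist x y powr \<alpha>" for x y
  proof (cases "x = y")
    case False
    have "ennreal (cmod (f (fst (x,y)) - f (snd (x,y))) / dist (fst (x,y)) (snd (x,y)) powr \<alpha>) \<le> ennreal A"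
      unfolding A[symmetric] holder_norm_def
      by (rule add_increasing, simp, rule SUP_upper) (use False in simp)
    hence "cmod (f x - f y) / dist x y powr \<alpha> \<le> A" using A0 by (simp add: ennreal_le_iff)
    thus ?thesis using False by (simp add: divide_le_eq)
  qed simp
  hence "hl \<alpha> A f" by (simp add: hl_def)
  thus ?thesis using that A0 1 A by blast
qed

theorem mainTheorem12:
  fixes \<tau> :: "(rsphere \<Rightarrow> rsphere) measure"
  assumes "\<tau> \<in> M1c"
    and "kernel_julia (Gtau \<tau>) = {}"
    and "julia (Gtau \<tau>) \<noteq> {}"
    and "Stau \<tau> \<subseteq> fatou (Gtau \<tau>)"
  defines "r \<equiv> (\<Prod>L\<in>Min_sets (Gtau \<tau>). cdim (LS (Ufun \<tau> L)))"
  shows "\<exists>\<alpha> lam C. 0 < \<alpha> \<and> \<alpha> < 1 \<and> 0 < lam \<and> lam < 1 \<and> 0 < C \<and>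
    (\<forall>\<phi> \<in> holder \<alpha>. \<forall>n::nat.
       holder_norm \<alpha> (\<lambda>z. (Mop \<tau> ^^ (n * r)) \<phi> z - proj \<tau> \<phi> z)
         \<le> ennreal (C * lam ^ n) * holder_norm \<alpha> (\<lambda>z. \<phi> z - proj \<tau> \<phi> z) \<and>
       holder_norm \<alpha> ((Mop \<tau> ^^ n) (\<lambda>z. \<phi> z - proj \<tau> \<phi> z))
         \<le> ennreal (C * lam ^ n) * holder_norm \<alpha> (\<lambda>z. \<phi> z - proj \<tau> \<phi> z) \<and>
       holder_norm \<alpha> ((Mop \<tau> ^^ n) (\<lambda>z. \<phi> z - proj \<tau> \<phi> z))
         \<le> ennreal (C * lam ^ n) * holder_norm \<alpha> \<phi> \<and>
       holder_norm \<alpha> (proj \<tau> \<phi>) \<le> ennreal C * holder_norm \<alpha> \<phi>)"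
proof -
  interpret mean_stable \<tau> by standard (fact assms(1-4))+
  obtain \<alpha> C D where \<alpha>: "0 < \<alpha>" "\<alpha> < 1" and C: "C \<ge> 1" and D: "D \<ge> 0"
    and pb: "\<And>\<phi> A j. hl \<alpha> A \<phi> \<Longrightarrow> (\<And>x. cmod (\<phi> x) \<le> A) \<Longrightarrow> hl \<alpha> (C * A) (Mn j \<phi>)"
    and DF: "\<And>\<eta>. \<eta> > 0 \<Longrightarrow> \<exists>N. \<forall>\<phi> A s. hl \<alpha> A \<phi> \<longrightarrow> (\<forall>x. cmod (\<phi> x) \<le> A) \<longrightarrow>
       (\<forall>x. cmod (\<phi> x) \<le> s) \<longrightarrow> hl \<alpha> (\<eta> * A + D * s) (Mn N \<phi>)"
    using doeblin_fortet by metis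
  interpret power_bounded \<tau> \<alpha> C by standard (use \<alpha> C pb in auto)
  obtain lam where lam: "0 < lam" "lam < 1"
    "\<And>\<phi> A n. hl \<alpha> A \<phi> \<Longrightarrow> (\<And>x. cmod (\<phi> x) \<le> A) \<Longrightarrow> \<phi> \<in> decaying \<tau> \<Longrightarrow>
       hl \<alpha> (2 * C * A * lam ^ n) (Mn n \<phi>) \<and> (\<forall>x. cmod (Mn n \<phi> x) \<le> 2 * C * A * lam ^ n)"
    using exponential_decay[OF D DF] by metis
  have r: "r = rr" by (simp add: r_def rr_def Gtau_def)
  \<comment> \<open>One constant for all four estimates: 4 is the 2 of
    \<open>holder_norm_upper\<close> times the 2 of \<open>exponential_decay\<close>, and
    \<open>1 + C\<close> comes from bounding the decaying part by the norm of \<phi>.\<close>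
  define E where "E = 4 * C * (1 + C)"
  have E: "E > 0" "4 * C \<le> E" "2 * C \<le> E"
  proof -
    have "4 * C * 1 \<le> E" unfolding E_def using C by (intro mult_left_mono) auto
    thus "E > 0" "4 * C \<le> E" "2 * C \<le> E" using C by auto
  qed
  have key: "holder_norm \<alpha> (Mn n \<xi>) \<le> ennreal (4 * C * lam ^ n * B)"
    if "hl \<alpha> B \<xi>" "\<And>x. cmod (\<xi> x) \<le> B" "\<xi> \<in> decaying \<tau>" for B \<xi> n
  proof -
    have "holder_norm \<alpha> (Mn n \<xi>) \<le> ennreal (2 * (2 * C * B * lam ^ n))"
      by (rule holder_norm_upper) (use lam(3)[OF that] in auto)
    thus ?thesis by (simp add: mult_ac)
  qed
  have main: "holder_norm \<alpha> (\<lambda>z. (Mop \<tau> ^^ (n * r)) \<phi> z - proj \<tau> \<phi> z)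
         \<le> ennreal (E * lam ^ n) * holder_norm \<alpha> (\<lambda>z. \<phi> z - proj \<tau> \<phi> z) \<and>
       holder_norm \<alpha> ((Mop \<tau> ^^ n) (\<lambda>z. \<phi> z - proj \<tau> \<phi> z))
         \<le> ennreal (E * lam ^ n) * holder_norm \<alpha> (\<lambda>z. \<phi> z - proj \<tau> \<phi> z) \<and>
       holder_norm \<alpha> ((Mop \<tau> ^^ n) (\<lambda>z. \<phi> z - proj \<tau> \<phi> z))
         \<le> ennreal (E * lam ^ n) * holder_norm \<alpha> \<phi> \<and>
       holder_norm \<alpha> (proj \<tau> \<phi>) \<le> ennreal E * holder_norm \<alpha> \<phi>"
    if \<phi>: "\<phi> \<in> holder \<alpha>" for \<phi> n
  proof -
    obtain A where A: "A \<ge> 0" "hl \<alpha> A \<phi>" "\<And>x. cmod (\<phi> x) \<le> A" "holder_norm \<alpha> \<phi> = ennreal A"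
      by (rule holder_norm_lower[OF \<phi> \<alpha>(1)]) metis
    define \<psi> where "\<psi> = proj \<tau> \<phi>"
    have \<psi>: "hl \<alpha> (C * A) \<psi>" "\<And>x. cmod (\<psi> x) \<le> A" "Mn rr \<psi> = \<psi>" "(\<lambda>z. \<phi> z - \<psi> z) \<in> decaying \<tau>"
      unfolding \<psi>_def using proj_properties[OF A(2,3)] by auto
    define \<xi> where "\<xi> = (\<lambda>z. \<phi> z - \<psi> z)"
    have CA: "A \<le> C * A" using A(1) C mult_right_mono[of 1 C A] by simp
    have \<xi>1: "hl \<alpha> ((1 + C) * A) \<xi>"
      unfolding hl_def
    proof (intro allI)
      fix x y
      have "cmod (\<xi> x - \<xi> y) \<le> cmod (\<phi> x - \<phi> y) + cmod (\<psi> x - \<psi> y)"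
        using norm_triangle_ineq4[of "\<phi> x - \<phi> y" "\<psi> x - \<psi> y"] by (simp add: \<xi>_def algebra_simps)
      also have "\<dots> \<le> A * dist x y powr \<alpha> + C * A * dist x y powr \<alpha>"
        using A(2) \<psi>(1) unfolding hl_def by (intro add_mono) blast+
      finally show "cmod (\<xi> x - \<xi> y) \<le> (1 + C) * A * dist x y powr \<alpha>" by (simp add: algebra_simps)
    qed
    have \<xi>2: "cmod (\<xi> x) \<le> (1 + C) * A" for x
      using norm_triangle_ineq4[of "\<phi> x" "\<psi> x"] A(3)[of x] \<psi>(2)[of x] CA
      by (simp add: \<xi>_def algebra_simps)
    have \<xi>3: "\<xi> \<in> decaying \<tau>" using \<psi>(4) by (simp add: \<xi>_def)
    have "\<xi> \<in> holder \<alpha>" using \<xi>1 by (auto simp: holder_def hl_def)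
    then obtain B where B: "B \<ge> 0" "hl \<alpha> B \<xi>" "\<And>x. cmod (\<xi> x) \<le> B" "holder_norm \<alpha> \<xi> = ennreal B"
      by (rule holder_norm_lower[OF _ \<alpha>(1)]) metis
    have 2: "holder_norm \<alpha> (Mn k \<xi>) \<le> ennreal (E * lam ^ k) * holder_norm \<alpha> \<xi>" for k
    proof -
      have "holder_norm \<alpha> (Mn k \<xi>) \<le> ennreal (4 * C * lam ^ k * B)" by (rule key[OF B(2,3) \<xi>3])
      also have "\<dots> \<le> ennreal (E * lam ^ k * B)"
        using E lam B(1) by (intro ennreal_leI mult_right_mono) auto
      finally show ?thesis unfolding B(4) using E lam B(1) by (simp add: ennreal_mult)
    qed
    have 3: "holder_norm \<alpha> (Mn n \<xi>) \<le> ennreal (E * lam ^ n) * holder_norm \<alpha> \<phi>"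
    proof -
      have "holder_norm \<alpha> (Mn n \<xi>) \<le> ennreal (4 * C * lam ^ n * ((1 + C) * A))" by (rule key[OF \<xi>1 \<xi>2 \<xi>3])
      also have "4 * C * lam ^ n * ((1 + C) * A) = E * lam ^ n * A" by (simp add: E_def)
      finally show ?thesis unfolding A(4) using E lam A(1) by (simp add: ennreal_mult)
    qed
    have 4: "holder_norm \<alpha> \<psi> \<le> ennreal E * holder_norm \<alpha> \<phi>"
    proof -
      have "holder_norm \<alpha> \<psi> \<le> ennreal (2 * (C * A))"
        by (rule holder_norm_upper[OF \<psi>(1)]) (use \<psi>(2) CA order_trans in blast)
      also have "\<dots> \<le> ennreal (E * A)" using mult_right_mono[OF E(3) A(1)] by (intro ennreal_leI) simp
      finally show ?thesis unfolding A(4) using E A(1) by (simp add: ennreal_mult)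
    qed
    have c: "continuous_on UNIV \<phi>" "continuous_on UNIV \<psi>" using hl_continuous A(2) \<psi>(1) \<alpha>(1) by blast+
    \<comment> \<open>As the projection is fixed by these iterates, the first estimate is one for
      the decaying part after \<open>n * rr\<close> steps; \<open>rr\<close> being positive, the
      rate over \<open>n\<close> steps is enough.\<close>
    have "(\<lambda>z. Mn (n * r) \<phi> z - \<psi> z) = Mn (n * rr) \<xi>"
      unfolding \<xi>_def Mn_diff[OF c] Mn_periodic[OF \<psi>(3)] r ..
    moreover have "holder_norm \<alpha> (Mn (n * rr) \<xi>) \<le> ennreal (E * lam ^ n) * holder_norm \<alpha> \<xi>"
    proof -
      have "lam ^ (n * rr) \<le> lam ^ n" using lam rr_pos by (intro power_decreasing) auto
      hence "ennreal (E * lam ^ (n * rr)) \<le> ennreal (E * lam ^ n)"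
        using E by (intro ennreal_leI mult_left_mono) auto
      thus ?thesis using 2[of "n * rr"] by (meson mult_right_mono order_trans zero_le)
    qed
    ultimately show ?thesis using 2[of n] 3 4 unfolding \<xi>_def \<psi>_def by simp
  qed
  show ?thesis
    by (intro exI[of _ \<alpha>] exI[of _ lam] exI[of _ E] conjI ballI allI \<alpha> lam(1,2) E(1)) (use main in blast)+
qed

end
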